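(* Let $\{B_t: t\geq0\}$ be a fractional Brownian motion of Hurst index $H\in[\frac12,1)$. For every $n\geq1$ define $$A_n:=\frac{n^{1+H}}{2}\int_0^1 t^{n-1}(B_1^2-B_t^2)\,dt.$$ As $n\to\infty$, the sequence $A_n$ converges stably to $S\eta$, where $\eta$ is a random variable independent of $B$ with law $\mathcal{N}(0,1)$ and $S=c_H|B_1|$. Moreover, there exists a constant $k$ (independent of $n$) such that $$d_{\mathrm{TV}}(A_n,S\eta)\leq k\,n^{-(1-H)/15},\qquad n\geq1.$$
   Context: A fractional Brownian motion with Hurst parameter $H\in(0,1)$ is a centered Gaussian process $B=\{B_t:t\ge0\}$ with covariance $E(B_sB_t)=\frac12(t^{2H}+s^{2H}-|t-s|^{2H})$. The underlying probability space is $(\Omega,\mathcal{F},P)$ with $\mathcal{F}$ the $P$-completion of $\sigma(B)$. Constants: $c_H=\sqrt{H(2H-1)\Gamma(2H-1)}$ for $H>1/2$, and $c_{1/2}=\lim_{H\downarrow1/2}c_H=\frac1{\sqrt2}$. Stable convergence: real random variables $F_n$ on $(\Omega,\mathcal{F},P)$ converge stably to $F$, defined on an extended probability space $(\Omega',\mathcal{F}',P')$, if $\lim_nE[Ze^{i\lambda F_n}]=E'[Ze^{i\lambda F}]$ for every $\lambda\in\mathbb{R}$ and every bounded $\mathcal{F}$-measurable $Z$. Total variation distance: $d_{\mathrm{TV}}(F,G)=\sup_{A\in\mathscr{B}(\mathbb{R})}|P(F\in A)-P(G\in A)|$. *)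

theory Defs
  imports "HOL-Probability.Probability"
begin

section \<open>Gaussian processes and fractional Brownian motion\<close>

text \<open>Degenerate (constant) variables count as Gaussian.\<close>

definition gaussian_rv :: "'a measure \<Rightarrow> ('a \<Rightarrow> real) \<Rightarrow> bool" where
  "gaussian_rv M X \<longleftrightarrow> X \<in> borel_measurable M \<and>
     ((\<exists>\<mu>. AE \<omega> in M. X \<omega> = \<mu>) \<or>
      (\<exists>\<mu> \<sigma>. 0 < \<sigma> \<and> distributed M lborel X (normal_density \<mu> \<sigma>)))"

definition gaussian_process :: "'a measure \<Rightarrow> 't set \<Rightarrow> ('t \<Rightarrow> 'a \<Rightarrow> real) \<Rightarrow> bool" where
  "gaussian_process M T X \<longleftrightarrow> prob_space M \<and> (\<forall>t\<in>T. X t \<in> borel_measurable M) \<and>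
     (\<forall>J c. finite J \<longrightarrow> J \<subseteq> T \<longrightarrow> gaussian_rv M (\<lambda>\<omega>. \<Sum>t\<in>J. c t * X t \<omega>))"

definition fractional_brownian_motion :: "'a measure \<Rightarrow> real \<Rightarrow> (real \<Rightarrow> 'a \<Rightarrow> real) \<Rightarrow> bool" where
  "fractional_brownian_motion M H B \<longleftrightarrow> 0 < H \<and> H < 1 \<and> gaussian_process M {0..} B \<and>
     (\<forall>t\<ge>0. integral\<^sup>L M (B t) = 0) \<and>
     (\<forall>s\<ge>0. \<forall>t\<ge>0. (\<integral>\<omega>. B s \<omega> * B t \<omega> \<partial>M) =
        (t powr (2 * H) + s powr (2 * H) - \<bar>t - s\<bar> powr (2 * H)) / 2)"

definition process_sigma :: "'a measure \<Rightarrow> 't set \<Rightarrow> ('t \<Rightarrow> 'a \<Rightarrow> real) \<Rightarrow> 'a measure" where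
  "process_sigma M T X =
     sigma (space M) (\<Union>t\<in>T. {X t -` A \<inter> space M | A. A \<in> sets borel})"

text \<open>
  The \<open>\<sigma>\<close>-algebra of \<open>M\<close> is the completion, under the measure of \<open>M\<close>, of the
  one generated by the process.
\<close>

definition completed_generated_by :: "'a measure \<Rightarrow> 't set \<Rightarrow> ('t \<Rightarrow> 'a \<Rightarrow> real) \<Rightarrow> bool" where
  "completed_generated_by M T X \<longleftrightarrow>
     sets M = sets (completion (restr_to_subalg M (process_sigma M T X)))"

text \<open>
  Joint measurability, up to null sets of the product measure.  This is what makes the pathwise
  integrals over \<open>[0,1]\<close> meaningful.  Every process that has almost surely continuous
  paths on a complete probability space satisfies it.
\<close>

definition measurable_process_01 :: "'a measure \<Rightarrow> (real \<Rightarrow> 'a \<Rightarrow> real) \<Rightarrow> bool" where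
  "measurable_process_01 M X \<longleftrightarrow>
     (\<lambda>(t, \<omega>). X t \<omega>) \<in> borel_measurable (completion (restrict_space lborel {0..1} \<Otimes>\<^sub>M M))"

section \<open>Extended probability spaces, stable convergence, total variation\<close>

text \<open>
  \<open>M'\<close> extends \<open>M\<close> through the projection \<open>p\<close>; a random variable \<open>Z\<close> on \<open>M\<close> is
  identified with \<open>Z \<circ> p\<close> on \<open>M'\<close>.
\<close>

definition extends_prob_space :: "'b measure \<Rightarrow> ('b \<Rightarrow> 'a) \<Rightarrow> 'a measure \<Rightarrow> bool" where
  "extends_prob_space M' p M \<longleftrightarrow>
     prob_space M' \<and> p \<in> measurable M' M \<and> distr M' M p = M"

definition converges_stably ::
  "'a measure \<Rightarrow> (nat \<Rightarrow> 'a \<Rightarrow> real) \<Rightarrow> 'b measure \<Rightarrow> ('b \<Rightarrow> 'a) \<Rightarrow> ('b \<Rightarrow> real) \<Rightarrow> bool" where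
  "converges_stably M F M' p G \<longleftrightarrow>
     (\<forall>n. F n \<in> borel_measurable M) \<and> G \<in> borel_measurable M' \<and>
     (\<forall>l::real. \<forall>Z. Z \<in> borel_measurable M \<longrightarrow> (\<exists>C. \<forall>\<omega>\<in>space M. \<bar>Z \<omega>\<bar> \<le> C) \<longrightarrow>
        (\<lambda>n. \<integral>\<omega>. complex_of_real (Z \<omega>) * exp (\<i> * complex_of_real (l * F n \<omega>)) \<partial>M)
          \<longlonglongrightarrow> (\<integral>\<omega>'. complex_of_real (Z (p \<omega>')) * exp (\<i> * complex_of_real (l * G \<omega>')) \<partial>M'))"

definition dTV :: "'a measure \<Rightarrow> ('a \<Rightarrow> real) \<Rightarrow> 'b measure \<Rightarrow> ('b \<Rightarrow> real) \<Rightarrow> real" where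
  "dTV M F N G =
     (SUP A\<in>sets (borel :: real measure).
        \<bar>measure M (F -` A \<inter> space M) - measure N (G -` A \<inter> space N)\<bar>)"

definition independent_of_process ::
  "'b measure \<Rightarrow> ('b \<Rightarrow> real) \<Rightarrow> 't set \<Rightarrow> ('t \<Rightarrow> 'b \<Rightarrow> real) \<Rightarrow> bool" where
  "independent_of_process M Y T X \<longleftrightarrow>
     prob_space.indep_set M {Y -` A \<inter> space M | A. A \<in> sets borel} (sets (process_sigma M T X))"

section \<open>The quadratic functionals and the limiting constant\<close>

definition quad_fun :: "real \<Rightarrow> (real \<Rightarrow> 'a \<Rightarrow> real) \<Rightarrow> nat \<Rightarrow> 'a \<Rightarrow> real" where
  "quad_fun H B n \<omega> = real n powr (1 + H) / 2 *
     (LINT t:{0..1}|lebesgue. t ^ (n - 1) * ((B 1 \<omega>)\<^sup>2 - (B t \<omega>)\<^sup>2))"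

definition c_const :: "real \<Rightarrow> real" where
  "c_const H = (if H = 1/2 then 1 / sqrt 2 else sqrt (H * (2 * H - 1) * Gamma (2 * H - 1)))"

lemma c_const_half_limit: "(c_const \<longlongrightarrow> c_const (1/2)) (at_right (1/2))"
proof -
  have ev: "eventually (\<lambda>h. sqrt (h * Gamma (2 * h)) = c_const h) (at_right (1/2::real))"
    unfolding eventually_at_right_field
  proof (intro exI[of _ 1] conjI allI impI)
    fix h :: real assume h: "1/2 < h" "h < 1"
    have "Gamma (2 * h - 1 + 1) = (2 * h - 1) * Gamma (2 * h - 1)"
      using h by (intro Gamma_plus1) (auto elim!: nonpos_Ints_cases')
    then show "sqrt (h * Gamma (2 * h)) = c_const h"
      using h by (simp add: c_const_def mult.assoc)
  qed auto
  have "isCont (\<lambda>h::real. sqrt (h * Gamma (2 * h))) (1/2)"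
    by (intro continuous_intros) (auto elim!: nonpos_Ints_cases')
  then have "((\<lambda>h::real. sqrt (h * Gamma (2 * h))) \<longlongrightarrow> sqrt (1/2 * Gamma (2 * (1/2)))) (at_right (1/2))"
    unfolding isCont_def by (rule filterlim_mono) (auto simp: at_le)
  then show ?thesis
    using ev by (auto simp: c_const_def real_sqrt_divide intro: Lim_transform_eventually)
qed

end

(*
  With xi = B_1, write B_1^2 - B_t^2 through B_t = rho(t) xi + Y_t, where Y is independent of xi.
  Then A_n = alpha xi^2 + beta xi + gamma, where alpha is deterministic of size n^(H-1), beta is a
  centred Gaussian variable, and gamma has L^1 norm of size n^(H-1); moreover (beta, gamma) is
  independent of xi.  The variance of beta tends to c_H^2 = Gamma(2H+1)/2 at rate n^(H-1), by an exact
  computation with Beta integrals.  Given (beta, gamma), the law of A_n is that of beta xi up to a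
  total variation error of order (|alpha| + |gamma|)/|beta|, by a change of variables; the event
  |beta| < epsilon has probability O(epsilon), so epsilon = n^(-(1-H)/2) yields the (better) rate
  n^(-(1-H)/2).

  For stable convergence, A_n is L^1-close to B_1 X_n with X_n Gaussian, of variance tending to c_H^2
  and asymptotically uncorrelated with each fixed X_k.  Hence the bounded variables
  cos(mu X_n + theta) - E cos(mu X_n + theta) are asymptotically orthogonal to one another, and so
  they tend weakly to 0.

  Everything Gaussian is done for finite Riemann sums in place of the integral: these converge to A_n
  in L^1 because B is mean-square Hoelder continuous, and bounds on total variation survive this limit.
*)
theory Submission
  imports Defs
begin

section \<open>Perturbation of the standard normal law\<close>

text \<open>The hypotheses give Gaussian laws only for finite linear combinations of
  \<open>B\<close>, and joint measurability only up to null sets; hence the detour through Riemann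
  sums. Its price is that total variation is not continuous under L^1 convergence. The way round:
  expectations of tests with values in [0,1] are compared with a bound that is uniform in the mesh
  and in the test. A Lipschitz constant multiplies only the discretization error, which vanishes at
  fixed \<open>n\<close>, and total variation is recovered from Lipschitz tests.

  The powers of \<open>n\<close> have one main source. The weight n t^(n-1) is a probability density
  under which 1 - t has mean 1/(n+1). Since 2H >= 1, the quantities 1 - rho(t), Var Y_t and Var(B_1
  - B_t) are at most a constant times 1 - t, so a prefactor n^H becomes n^(H-1). The choice of
  epsilon balances the probability that |beta| < epsilon against n^(H-1)/epsilon.

  The form Gamma(2H+1)/2 treats H = 1/2 together with H > 1/2. In the limit law |B_1| may be
  replaced by B_1, since eta is symmetric and independent of \<open>B\<close>.\<close>

lemma integrable_std_normal_density_bounded: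
  fixes g :: "real \<Rightarrow> real"
  assumes "g \<in> borel_measurable borel" "\<And>x. \<bar>g x\<bar> \<le> C"
  shows "integrable lborel (\<lambda>x. g x * std_normal_density x)"
proof (rule Bochner_Integration.integrable_bound[where f = "\<lambda>x. C * std_normal_density x"])
  show "AE x in lborel. norm (g x * std_normal_density x) \<le> norm (C * std_normal_density x)"
  proof (rule AE_I2)
    fix x
    have "\<bar>g x\<bar> \<le> \<bar>C\<bar>" using assms(2)[of x] by linarith
    then show "norm (g x * std_normal_density x) \<le> norm (C * std_normal_density x)"
      by (simp add: abs_mult mult_right_mono)
  qed
qed (use assms in auto)

text \<open>Markov's inequality with the fourth moment, which is 3. The power 4 suffices because the
  tails will be cut at a height of order \<open>\<delta>\<close> to the power -1/3 and need only be
  of order \<open>\<delta>\<close>.\<close>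

lemma std_normal_tail:
  assumes "0 < R" "A \<in> sets borel" "\<And>x. x \<in> A \<Longrightarrow> R \<le> \<bar>x\<bar>"
  shows "(\<integral>x. indicator A x * std_normal_density x \<partial>lborel) \<le> 3 / R ^ 4"
proof -
  have "(\<integral>x. indicator A x * std_normal_density x \<partial>lborel)
      \<le> (\<integral>x. (std_normal_density x * x ^ (2 * 2)) / R ^ 4 \<partial>lborel)"
  proof (rule integral_mono)
    show "integrable lborel (\<lambda>x. indicator A x * std_normal_density x :: real)"
      by (rule integrable_std_normal_density_bounded[where C = 1])
        (use assms in \<open>auto split: split_indicator\<close>)
    show "integrable lborel (\<lambda>x. (std_normal_density x * x ^ (2 * 2)) / R ^ 4)"
      by (intro integrable_divide integrable_std_normal_moment)
    fix x :: real
    show "indicator A x * std_normal_density x \<le> (std_normal_density x * x ^ (2 * 2)) / R ^ 4"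
    proof (cases "x \<in> A")
      case True
      then have "R ^ 4 \<le> \<bar>x\<bar> ^ 4" using assms by (intro power_mono) auto
      then have "1 \<le> x ^ 4 / R ^ 4" using assms(1) by (simp add: field_simps)
      then have "std_normal_density x * 1 \<le> std_normal_density x * (x ^ 4 / R ^ 4)"
        by (intro mult_left_mono) auto
      then show ?thesis using True by simp
    qed (simp add: zero_le_even_power)
  qed
  also have "\<dots> = 3 / R ^ 4"
    by (subst integral_divide_zero, subst integral_std_normal_moment_even) (simp add: fact_numeral)
  finally show ?thesis .
qed

text \<open>Symmetry of the Gaussian law; it later removes the absolute value from the factor of the
  limit variable.\<close>

lemma std_normal_integral_reflect:
  fixes g :: "real \<Rightarrow> real"
  shows "(\<integral>y. g (- y) * std_normal_density y \<partial>lborel) = (\<integral>y. g y * std_normal_density y \<partial>lborel)"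
proof -
  have "(\<integral>y. g y * std_normal_density y \<partial>lborel) = \<bar>- 1\<bar> *\<^sub>R (\<integral>y. g (0 + (- 1) * y) * std_normal_density (0 + (- 1) * y) \<partial>lborel)"
    by (rule lborel_integral_real_affine) simp
  then show ?thesis by (simp add: normal_density_def)
qed

lemma std_normal_integral_01:
  fixes g :: "real \<Rightarrow> real"
  assumes [measurable]: "g \<in> borel_measurable borel" and "\<And>x. 0 \<le> g x" "\<And>x. g x \<le> 1"
  shows "0 \<le> (\<integral>x. g x * std_normal_density x \<partial>lborel)" "(\<integral>x. g x * std_normal_density x \<partial>lborel) \<le> 1"
proof -
  show "0 \<le> (\<integral>x. g x * std_normal_density x \<partial>lborel)" using assms by (intro integral_nonneg_AE) auto
  have "(\<integral>x. g x * std_normal_density x \<partial>lborel) \<le> (\<integral>x. std_normal_density x \<partial>lborel)"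
  proof (rule integral_mono)
    show "integrable lborel (\<lambda>x. g x * std_normal_density x)"
      by (rule integrable_std_normal_density_bounded[where C = 1]) (use assms in \<open>auto simp: abs_le_iff intro: order_trans[of _ 0]\<close>)
    show "g x * std_normal_density x \<le> std_normal_density x" for x
      using assms by (intro mult_left_le_one_le) auto
  qed simp
  then show "(\<integral>x. g x * std_normal_density x \<partial>lborel) \<le> 1" by simp
qed

lemma std_normal_density_shift_ratio:
  fixes x r :: real
  shows "std_normal_density (x + r) = std_normal_density x * exp (- (x * r + r\<^sup>2 / 2))"
proof -
  have "- (x + r)\<^sup>2 / 2 = - x\<^sup>2 / 2 + - (x * r + r\<^sup>2 / 2)"
    by (simp add: power2_eq_square field_simps)
  then have "exp (- (x + r)\<^sup>2 / 2) = exp (- x\<^sup>2 / 2) * exp (- (x * r + r\<^sup>2 / 2))"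
    by (metis exp_add)
  then show ?thesis by (simp add: normal_density_def)
qed

lemma abs_exp_minus_one_le:
  fixes u M :: real
  assumes "\<bar>u\<bar> \<le> M"
  shows "\<bar>exp u - 1\<bar> \<le> exp M * \<bar>u\<bar>"
proof (cases "0 \<le> u")
  case True
  have "exp u - 1 \<le> exp u * u"
    using exp_ge_add_one_self[of "-u"] True
    by (simp add: exp_minus field_simps)
  also have "\<dots> \<le> exp M * u" using True assms by (intro mult_right_mono) auto
  finally show ?thesis using True by simp
next
  case False
  have "1 - exp u \<le> 1 * \<bar>u\<bar>" using exp_ge_add_one_self[of u] False by linarith
  also have "\<dots> \<le> exp M * \<bar>u\<bar>" using assms abs_ge_zero[of u] by (intro mult_right_mono) (auto simp del: abs_ge_zero)
  finally show ?thesis using False by simp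
qed

text \<open>
  The map \<open>x + r x\<close> is increasing on \<open>\<bar>x\<bar> \<le> L\<close> with \<open>L ^ 3 = 1 / \<delta>\<close>; there the two densities differ by a
  bounded factor, and the mass beyond \<open>L - 1\<close> is of order \<open>\<delta>\<close>.
\<close>

lemma gaussian_quadratic_perturbation:
  fixes f :: "real \<Rightarrow> real" and d e a \<delta> :: real
  assumes f[measurable]: "f \<in> borel_measurable borel" and f01: "\<And>x. 0 \<le> f x" "\<And>x. f x \<le> 1"
    and d: "\<bar>d\<bar> \<le> \<delta>" and e: "\<bar>e\<bar> \<le> \<delta>" and a: "\<bar>a\<bar> \<le> \<delta>"
  shows "\<bar>(\<integral>x. f (x + (d + e * x + a * x\<^sup>2)) * std_normal_density x \<partial>lborel)
      - (\<integral>x. f x * std_normal_density x \<partial>lborel)\<bar> \<le> 2500 * \<delta>"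
proof -
  define r where "r x = d + e * x + a * x\<^sup>2" for x
  define h where "h x = x + r x" for x
  define h' where "h' x = 1 + e + 2 * a * x" for x
  define \<phi> where "\<phi> = (std_normal_density :: real \<Rightarrow> real)"
  have [measurable]: "r \<in> borel_measurable borel" "h \<in> borel_measurable borel"
    "h' \<in> borel_measurable borel" "\<phi> \<in> borel_measurable borel"
    unfolding r_def[abs_def] h_def[abs_def] h'_def[abs_def] \<phi>_def by measurable
  have \<phi>0: "0 \<le> \<phi> x" for x by (simp add: \<phi>_def)
  have int\<phi>: "integrable lborel (\<lambda>x. g x * \<phi> x)" if "g \<in> borel_measurable borel" "\<And>x. \<bar>g x\<bar> \<le> 1" for g
    unfolding \<phi>_def by (rule integrable_std_normal_density_bounded[OF that])
  have tot: "(\<integral>x. \<phi> x \<partial>lborel) = 1" by (simp add: \<phi>_def)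
  have i01: "0 \<le> (\<integral>x. g x * \<phi> x \<partial>lborel) \<and> (\<integral>x. g x * \<phi> x \<partial>lborel) \<le> 1"
    if g: "g \<in> borel_measurable borel" "\<And>x. 0 \<le> g x" "\<And>x. g x \<le> 1" for g
  proof
    show "0 \<le> (\<integral>x. g x * \<phi> x \<partial>lborel)" using that \<phi>0 by (intro integral_nonneg_AE) auto
    have "(\<integral>x. g x * \<phi> x \<partial>lborel) \<le> (\<integral>x. \<phi> x \<partial>lborel)"
    proof (rule integral_mono)
      show "integrable lborel (\<lambda>x. g x * \<phi> x)" using g by (intro int\<phi>) (auto simp: abs_le_iff intro: order_trans[of _ 0])
      show "integrable lborel \<phi>" by (simp add: \<phi>_def)
      show "g x * \<phi> x \<le> \<phi> x" for x using g(3)[of x] \<phi>0[of x] by (simp add: mult_left_le_one_le g(2))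
    qed
    then show "(\<integral>x. g x * \<phi> x \<partial>lborel) \<le> 1" using tot by simp
  qed
  have "\<bar>(\<integral>x. f (h x) * \<phi> x \<partial>lborel) - (\<integral>x. f x * \<phi> x \<partial>lborel)\<bar> \<le> 2500 * \<delta>"
  \<comment> \<open>For \<open>\<delta>\<close> above 1/27 the claim is trivial, as both integrals
    lie in [0,1]. The threshold is the one that makes \<open>L\<close> at least 3 below.\<close>
  proof (cases "1 / 27 < \<delta> \<or> \<delta> = 0")
    case True
    show ?thesis
    proof (cases "\<delta> = 0")
      case True
      then have "h = (\<lambda>x. x)" using d e a by (auto simp: h_def r_def fun_eq_iff)
      then show ?thesis using True by simp
    next
      case False
      then have "1 < 27 * \<delta>" using True by simp
      moreover have "0 \<le> (\<integral>x. f (h x) * \<phi> x \<partial>lborel) \<and> (\<integral>x. f (h x) * \<phi> x \<partial>lborel) \<le> 1"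
        by (rule i01) (use f01 in auto)
      moreover have "0 \<le> (\<integral>x. f x * \<phi> x \<partial>lborel) \<and> (\<integral>x. f x * \<phi> x \<partial>lborel) \<le> 1"
        by (rule i01) (use f01 in auto)
      ultimately show ?thesis by linarith
    qed
  next
    case False
    then have \<delta>: "0 < \<delta>" "\<delta> \<le> 1 / 27" using d by auto
    \<comment> \<open>The exponent 3 is forced: the logarithm of the ratio of the densities at
      \<open>h x\<close> and \<open>x\<close> is about \<open>x * r x\<close>, of order
      \<open>\<delta> * L ^ 3\<close>, and has to stay bounded.\<close>
    define L where "L = 1 / root 3 \<delta>"
    have Lpos: "0 < L" using \<delta> by (simp add: L_def)
    have L3: "\<delta> * L ^ 3 = 1" using \<delta> by (simp add: L_def power_divide)
    have L: "3 \<le> L"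
    proof (rule ccontr)
      assume "\<not> 3 \<le> L"
      then have "L ^ 3 < 3 ^ 3" using Lpos by (intro power_strict_mono) auto
      then have "\<delta> * L ^ 3 < \<delta> * 27" using \<delta> by simp
      then show False using L3 \<delta> by simp
    qed
    have \<delta>L2: "\<delta> * L\<^sup>2 = 1 / L" using L3 Lpos by (simp add: field_simps power2_eq_square power3_eq_cube)
    have r1: "\<bar>r x\<bar> \<le> \<delta> * (1 + \<bar>x\<bar> + x\<^sup>2)" for x
    proof -
      have "\<bar>r x\<bar> \<le> \<bar>d\<bar> + \<bar>e * x\<bar> + \<bar>a * x\<^sup>2\<bar>" unfolding r_def by linarith
      also have "\<dots> \<le> \<delta> + \<delta> * \<bar>x\<bar> + \<delta> * x\<^sup>2"
        using d e a by (intro add_mono) (auto simp: abs_mult intro!: mult_right_mono)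
      finally show ?thesis by (simp add: algebra_simps)
    qed
    have L1: "1 / L \<le> 1 / 3" using L by (simp add: field_simps)
    have r2: "\<bar>r x\<bar> \<le> 3 / L" if "\<bar>x\<bar> \<le> L" for x
    proof -
      have xL: "x\<^sup>2 \<le> L\<^sup>2" using that by (metis abs_ge_zero power2_abs power_mono)
      have "L \<le> L\<^sup>2" using L by (simp add: power2_eq_square)
      then have "1 + \<bar>x\<bar> + x\<^sup>2 \<le> 3 * L\<^sup>2" using xL that L by linarith
      then have "\<delta> * (1 + \<bar>x\<bar> + x\<^sup>2) \<le> \<delta> * (3 * L\<^sup>2)" using \<delta> by (intro mult_left_mono) auto
      then show ?thesis using r1[of x] \<delta>L2 by (simp add: mult.left_commute)
    qed
    have r3: "\<bar>r x\<bar> \<le> 1" if "\<bar>x\<bar> \<le> L" for x using r2[OF that] L1 by simp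
    have dh: "(h has_real_derivative h' x) (at x)" for x
      unfolding h_def[abs_def] r_def h'_def by (auto intro!: derivative_eq_intros)
    have h'1: "\<bar>h' x - 1\<bar> \<le> \<delta> * (1 + 2 * \<bar>x\<bar>)" for x
    proof -
      have "\<bar>h' x - 1\<bar> \<le> \<bar>e\<bar> + 2 * (\<bar>a\<bar> * \<bar>x\<bar>)" unfolding h'_def by (simp add: abs_mult[symmetric])
      also have "\<dots> \<le> \<delta> + 2 * (\<delta> * \<bar>x\<bar>)"
        using e a by (intro add_mono mult_left_mono mult_right_mono) auto
      finally show ?thesis by (simp add: algebra_simps)
    qed
    have h'pos: "0 \<le> h' x" if "\<bar>x\<bar> \<le> L" for x
    proof -
      have "\<delta> * (1 + 2 * \<bar>x\<bar>) \<le> \<delta> * (L\<^sup>2)"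
        using that L \<delta> by (intro mult_left_mono) (auto simp: power2_eq_square intro: order_trans[OF _ mult_right_mono[of 3]])
      then show ?thesis using h'1[of x] \<delta>L2 L1 by linarith
    qed
    define I where "I = {-L..L}"
    have [measurable]: "I \<in> sets borel" by (simp add: I_def)
    \<comment> \<open>The change of variables: \<open>h\<close> is nondecreasing on
      \<open>{-L..L}\<close>, so the integral of \<open>f\<close> against \<open>\<phi>\<close> over
      the image becomes one of \<open>f (h x)\<close> against the density
      \<open>\<phi> (h x) * h' x\<close>, which is then compared with
      \<open>\<phi> x\<close>.\<close>
    have subst: "(\<integral>x. (f x * \<phi> x) * indicator {h (-L)..h L} x \<partial>lborel)
       = (\<integral>x. (f (h x) * \<phi> (h x)) * h' x * indicator {-L..L} x \<partial>lborel)"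
      and sint: "set_integrable lborel {-L..L} (\<lambda>x. (f (h x) * \<phi> (h x)) * h' x)"
    proof -
      have *: "set_integrable lborel {h (-L)..h L} (\<lambda>x. f x * \<phi> x)"
        unfolding set_integrable_def
        using int\<phi>[of "\<lambda>x. indicator {h (-L)..h L} x * f x"] f01
        by (simp add: mult.assoc abs_mult split: split_indicator) 
      have h'c: "continuous_on {-L..L} h'"
        unfolding h'_def[abs_def] by (intro continuous_intros)
      show "(\<integral>x. (f x * \<phi> x) * indicator {h (-L)..h L} x \<partial>lborel)
       = (\<integral>x. (f (h x) * \<phi> (h x)) * h' x * indicator {-L..L} x \<partial>lborel)"
        "set_integrable lborel {-L..L} (\<lambda>x. (f (h x) * \<phi> (h x)) * h' x)"
        using integral_substitution[of h "-L" L "\<lambda>x. f x * \<phi> x" h'] * dh h'pos Lpos h'c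
        by (auto simp: abs_le_iff)
    qed
    \<comment> \<open>Relative error of the pulled-back density: the exponent contributes 9/4 and
      the derivative 2, rounded up to 5. The factor \<open>exp 4\<close> bounds the exponential, as
      \<open>\<bar>u\<bar> \<le> 4\<close>.\<close>
    have pt: "\<bar>\<phi> x - \<phi> (h x) * h' x\<bar> \<le> exp 4 * (5 * \<delta>) * ((1 + x\<^sup>2)\<^sup>2 * \<phi> x)" if x: "\<bar>x\<bar> \<le> L" for x
    proof -
      define u where "u = - (x * r x + (r x)\<^sup>2 / 2)"
      have hx: "\<phi> (h x) = \<phi> x * exp u"
        unfolding h_def u_def \<phi>_def by (rule std_normal_density_shift_ratio)
      have ur: "\<bar>u\<bar> \<le> \<bar>r x\<bar> * (\<bar>x\<bar> + 1)"
      proof -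
        have "\<bar>u\<bar> \<le> \<bar>r x\<bar> * \<bar>x\<bar> + \<bar>r x\<bar> * \<bar>r x\<bar> / 2"
        proof -
          have "\<bar>r x\<bar> * \<bar>x\<bar> = \<bar>x * r x\<bar>" "\<bar>r x\<bar> * \<bar>r x\<bar> = (r x)\<^sup>2"
            by (simp_all add: abs_mult power2_eq_square)
          then show ?thesis unfolding u_def using zero_le_power2[of "r x"] by linarith
        qed
        also have "\<bar>r x\<bar> * \<bar>r x\<bar> / 2 \<le> \<bar>r x\<bar> * 1"
          using r3[OF x] mult_left_mono[of "\<bar>r x\<bar>" 1 "\<bar>r x\<bar>"] by linarith
        finally show ?thesis by (simp add: algebra_simps)
      qed
      have "\<bar>u\<bar> \<le> 3 / L * (L + 1)"
        using ur mult_mono[OF r2[OF x], of "\<bar>x\<bar> + 1" "L + 1"] x Lpos by simp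
      also have "\<dots> \<le> 4" using L by (simp add: field_simps)
      finally have u4: "\<bar>u\<bar> \<le> 4" .
      have ax: "2 * \<bar>x\<bar> \<le> 1 + x\<^sup>2" using zero_le_power2[of "\<bar>x\<bar> - 1"] by (simp add: power2_diff)
      have q1: "1 + x\<^sup>2 \<le> (1 + x\<^sup>2)\<^sup>2" using mult_left_mono[of 1 "1 + x\<^sup>2" "1 + x\<^sup>2"] by (simp add: power2_eq_square[of "1 + x\<^sup>2"])
      have "\<bar>u\<bar> \<le> \<delta> * (1 + \<bar>x\<bar> + x\<^sup>2) * (\<bar>x\<bar> + 1)"
        using ur mult_right_mono[OF r1[of x], of "\<bar>x\<bar> + 1"] by simp
      also have "\<dots> \<le> \<delta> * (3 / 2 * (1 + x\<^sup>2)) * (3 / 2 * (1 + x\<^sup>2))"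
      proof (intro mult_mono)
        show "1 + \<bar>x\<bar> + x\<^sup>2 \<le> 3 / 2 * (1 + x\<^sup>2)" using ax by simp
        show "\<bar>x\<bar> + 1 \<le> 3 / 2 * (1 + x\<^sup>2)" using ax zero_le_power2[of x] by argo
      qed (use \<delta> in auto)
      also have "\<dots> = 9 / 4 * \<delta> * (1 + x\<^sup>2)\<^sup>2" by (simp add: power2_eq_square algebra_simps)
      finally have u5: "\<bar>u\<bar> \<le> 9 / 4 * \<delta> * (1 + x\<^sup>2)\<^sup>2" .
      have "\<bar>h' x - 1\<bar> \<le> \<delta> * (2 * (1 + x\<^sup>2)\<^sup>2)"
      proof (intro order_trans[OF h'1] mult_left_mono)
        show "1 + 2 * \<bar>x\<bar> \<le> 2 * (1 + x\<^sup>2)\<^sup>2" using ax q1 zero_le_power2[of x] by argo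
      qed (use \<delta> in simp)
      then have h5: "\<bar>h' x - 1\<bar> \<le> 2 * \<delta> * (1 + x\<^sup>2)\<^sup>2" by simp
      have "\<bar>1 - exp u * h' x\<bar> \<le> \<bar>exp u - 1\<bar> + exp u * \<bar>h' x - 1\<bar>"
      proof -
        have "1 - exp u * h' x = - (exp u - 1) - exp u * (h' x - 1)" by (simp add: algebra_simps)
        then show ?thesis by (metis abs_exp_cancel abs_minus_cancel abs_mult abs_triangle_ineq4)
      qed
      also have "\<dots> \<le> exp 4 * \<bar>u\<bar> + exp 4 * \<bar>h' x - 1\<bar>"
        using u4 by (intro add_mono abs_exp_minus_one_le mult_right_mono) auto
      also have "\<dots> = exp 4 * (\<bar>u\<bar> + \<bar>h' x - 1\<bar>)" by (simp add: algebra_simps)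
      also have "\<dots> \<le> exp 4 * (9 / 4 * \<delta> * (1 + x\<^sup>2)\<^sup>2 + 2 * \<delta> * (1 + x\<^sup>2)\<^sup>2)"
        using u5 h5 by (intro mult_left_mono add_mono) auto
      also have "\<dots> \<le> exp 4 * (5 * \<delta> * (1 + x\<^sup>2)\<^sup>2)"
      proof (rule mult_left_mono)
        have "0 \<le> \<delta> * (1 + x\<^sup>2)\<^sup>2" using \<delta> by simp
        then show "9 / 4 * \<delta> * (1 + x\<^sup>2)\<^sup>2 + 2 * \<delta> * (1 + x\<^sup>2)\<^sup>2 \<le> 5 * \<delta> * (1 + x\<^sup>2)\<^sup>2" by linarith
      qed simp
      finally have "\<phi> x * \<bar>1 - exp u * h' x\<bar> \<le> \<phi> x * (exp 4 * (5 * \<delta> * (1 + x\<^sup>2)\<^sup>2))"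
        using \<phi>0 by (intro mult_left_mono)
      moreover have "\<bar>\<phi> x - \<phi> (h x) * h' x\<bar> = \<phi> x * \<bar>1 - exp u * h' x\<bar>"
        using \<phi>0[of x] unfolding hx by (metis abs_mult abs_of_nonneg mult.assoc mult.right_neutral right_diff_distrib)
      ultimately show ?thesis by (simp add: mult_ac)
    qed
    \<comment> \<open>6 = 1 + 2 * 1 + 3, from the moments of order 0, 2 and 4.\<close>
    have m4: "integrable lborel (\<lambda>x. (1 + x\<^sup>2)\<^sup>2 * \<phi> x) \<and> (\<integral>x. (1 + x\<^sup>2)\<^sup>2 * \<phi> x \<partial>lborel) = 6"
    proof -
      have "has_bochner_integral lborel (\<lambda>x. \<phi> x * x ^ (2 * 0) + 2 * (\<phi> x * x ^ (2 * 1)) + \<phi> x * x ^ (2 * 2))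
        (fact (2 * 0) / (2^0 * fact 0) + 2 * (fact (2 * 1) / (2^1 * fact 1)) + (fact (2 * 2) / (2^2 * fact 2)))"
        unfolding \<phi>_def
        by (intro has_bochner_integral_add has_bochner_integral_mult_right std_normal_moment_even)
      moreover have "(\<lambda>x. \<phi> x * x ^ (2 * 0) + 2 * (\<phi> x * x ^ (2 * 1)) + \<phi> x * x ^ (2 * 2)) = (\<lambda>x. (1 + x\<^sup>2)\<^sup>2 * \<phi> x)"
        by (simp add: fun_eq_iff power2_eq_square power4_eq_xxxx algebra_simps)
      moreover have "(fact (2 * 0) / (2^0 * fact 0) + 2 * (fact (2 * 1) / (2^1 * fact 1)) + (fact (2 * 2) / (2^2 * fact 2))) = (6::real)"
        by (simp add: fact_numeral)
      ultimately show ?thesis by (simp add: has_bochner_integral_iff)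
    qed
    let ?T = "\<lambda>g. (\<integral>x. g x \<partial>lborel) :: real"
    have iI: "integrable lborel (\<lambda>x. indicator I x * f (h x) * \<phi> x)"
      by (rule int\<phi>) (use f01 in \<open>auto simp: abs_mult split: split_indicator\<close>)
    have iIc: "integrable lborel (\<lambda>x. indicator (-I) x * f (h x) * \<phi> x)"
      by (rule int\<phi>) (use f01 in \<open>auto simp: abs_mult split: split_indicator\<close>)
    have iIs: "integrable lborel (\<lambda>x. indicator I x * (f (h x) * (\<phi> (h x) * h' x)))"
      using sint unfolding set_integrable_def I_def by (simp add: mult_ac)
    define J where "J = {h (-L)..h L}"
    have [measurable]: "J \<in> sets borel" by (simp add: J_def)
    have iJ: "integrable lborel (\<lambda>x. indicator J x * f x * \<phi> x)"
      by (rule int\<phi>) (use f01 in \<open>auto simp: abs_mult split: split_indicator\<close>)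
    have iJc: "integrable lborel (\<lambda>x. indicator (-J) x * f x * \<phi> x)"
      by (rule int\<phi>) (use f01 in \<open>auto simp: abs_mult split: split_indicator\<close>)
    have e1: "?T (\<lambda>x. f (h x) * \<phi> x) = ?T (\<lambda>x. indicator I x * f (h x) * \<phi> x) + ?T (\<lambda>x. indicator (-I) x * f (h x) * \<phi> x)"
      by (subst Bochner_Integration.integral_add[symmetric, OF iI iIc], rule Bochner_Integration.integral_cong)
        (auto split: split_indicator)
    have e2: "?T (\<lambda>x. f x * \<phi> x) = ?T (\<lambda>x. indicator J x * f x * \<phi> x) + ?T (\<lambda>x. indicator (-J) x * f x * \<phi> x)"
      by (subst Bochner_Integration.integral_add[symmetric, OF iJ iJc], rule Bochner_Integration.integral_cong)
        (auto split: split_indicator)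
    have e3: "?T (\<lambda>x. indicator J x * f x * \<phi> x) = ?T (\<lambda>x. indicator I x * (f (h x) * (\<phi> (h x) * h' x)))"
      using subst unfolding I_def J_def by (simp add: mult_ac)
    \<comment> \<open>The cut is at \<open>L - 1\<close> because \<open>h\<close> moves the
      endpoints of \<open>I\<close> by at most 1, so the complement of the image \<open>J\<close>
      starts no earlier. The constant: \<open>L \<ge> 3\<close> gives L - 1 >= 2/3 * L, and 3 *
      (3/2)^4 is below 16.\<close>
    have tail: "0 \<le> ?T (\<lambda>x. indicator A x * g x * \<phi> x) \<and> ?T (\<lambda>x. indicator A x * g x * \<phi> x) \<le> 16 * \<delta>"
      if [measurable]: "A \<in> sets borel" "g \<in> borel_measurable borel"
        and g: "\<And>x. 0 \<le> g x" "\<And>x. g x \<le> 1" and A: "\<And>x. x \<in> A \<Longrightarrow> L - 1 \<le> \<bar>x\<bar>" for A g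
    proof
      show "0 \<le> ?T (\<lambda>x. indicator A x * g x * \<phi> x)"
        using g \<phi>0 by (intro integral_nonneg_AE) auto
      have "?T (\<lambda>x. indicator A x * g x * \<phi> x) \<le> ?T (\<lambda>x. indicator A x * \<phi> x)"
      proof (rule integral_mono)
        show "integrable lborel (\<lambda>x. indicator A x * g x * \<phi> x)"
          by (rule int\<phi>) (use g in \<open>auto simp: abs_mult split: split_indicator\<close>)
        show "integrable lborel (\<lambda>x. indicator A x * \<phi> x)"
          by (rule int\<phi>) (auto split: split_indicator)
        show "indicator A x * g x * \<phi> x \<le> indicator A x * \<phi> x" for x
          using g \<phi>0[of x] by (auto split: split_indicator intro: mult_left_le_one_le)
      qed
      also have "\<dots> \<le> 3 / (L - 1) ^ 4"
        unfolding \<phi>_def by (rule std_normal_tail) (use L A in auto)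
      also have "\<dots> \<le> 3 / (2 / 3 * L) ^ 4"
        using L by (intro divide_left_mono power_mono mult_pos_pos zero_less_power) auto
      also have "\<dots> \<le> 16 / L ^ 4" using L by (simp add: field_simps)
      also have "\<dots> \<le> 16 / L ^ 3" using L by (intro divide_left_mono power_increasing mult_pos_pos zero_less_power) auto
      also have "\<dots> = 16 * \<delta>" using L3 Lpos by (simp add: field_simps)
      finally show "?T (\<lambda>x. indicator A x * g x * \<phi> x) \<le> 16 * \<delta>" .
    qed
    have t1: "0 \<le> ?T (\<lambda>x. indicator (-I) x * f (h x) * \<phi> x) \<and> ?T (\<lambda>x. indicator (-I) x * f (h x) * \<phi> x) \<le> 16 * \<delta>"
      by (rule tail) (use f01 in \<open>auto simp: I_def\<close>)
    have t2: "0 \<le> ?T (\<lambda>x. indicator (-J) x * f x * \<phi> x) \<and> ?T (\<lambda>x. indicator (-J) x * f x * \<phi> x) \<le> 16 * \<delta>"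
    proof (rule tail)
      fix x assume "x \<in> - J"
      then have "x < h (-L) \<or> h L < x" by (auto simp: J_def)
      then show "L - 1 \<le> \<bar>x\<bar>" using r3[of L] r3[of "-L"] Lpos unfolding h_def by (auto simp: abs_le_iff)
    qed (use f01 in auto)
    have "\<bar>?T (\<lambda>x. indicator I x * f (h x) * \<phi> x) - ?T (\<lambda>x. indicator I x * (f (h x) * (\<phi> (h x) * h' x)))\<bar>
       = \<bar>?T (\<lambda>x. indicator I x * f (h x) * \<phi> x - indicator I x * (f (h x) * (\<phi> (h x) * h' x)))\<bar>"
      by (subst Bochner_Integration.integral_diff[OF iI iIs]) simp
    also have "\<dots> \<le> ?T (\<lambda>x. exp 4 * (5 * \<delta>) * ((1 + x\<^sup>2)\<^sup>2 * \<phi> x))"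
    proof (rule order_trans[OF integral_abs_bound integral_mono])
      show "integrable lborel (\<lambda>x. \<bar>indicator I x * f (h x) * \<phi> x - indicator I x * (f (h x) * (\<phi> (h x) * h' x))\<bar>)"
        by (intro integrable_abs Bochner_Integration.integrable_diff iI iIs)
      show "integrable lborel (\<lambda>x. exp 4 * (5 * \<delta>) * ((1 + x\<^sup>2)\<^sup>2 * \<phi> x))"
        using m4 by auto
      fix x
      show "\<bar>indicator I x * f (h x) * \<phi> x - indicator I x * (f (h x) * (\<phi> (h x) * h' x))\<bar>
        \<le> exp 4 * (5 * \<delta>) * ((1 + x\<^sup>2)\<^sup>2 * \<phi> x)"
      proof (cases "x \<in> I")
        case True
        then have x: "\<bar>x\<bar> \<le> L" by (auto simp: I_def)
        have "\<bar>indicator I x * f (h x) * \<phi> x - indicator I x * (f (h x) * (\<phi> (h x) * h' x))\<bar> = f (h x) * \<bar>\<phi> x - \<phi> (h x) * h' x\<bar>"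
          using True f01(1)[of "h x"] by (simp add: right_diff_distrib[symmetric] abs_mult)
        also have "\<dots> \<le> \<bar>\<phi> x - \<phi> (h x) * h' x\<bar>"
          by (rule mult_left_le_one_le) (use f01 in auto)
        also note pt[OF x]
        finally show ?thesis .
      qed (use \<phi>0 \<delta> in simp)
    qed
    also have "\<dots> = exp 4 * (5 * \<delta>) * 6" by (subst integral_mult_right_zero) (simp only: m4)
    \<comment> \<open>\<open>exp 4\<close> is at most 3^4 = 81, so the bulk costs 2430 times
      \<open>\<delta>\<close>. With tails of at most 16 times \<open>\<delta>\<close> each, this is
      the origin of 2500.\<close>
    also have "\<dots> \<le> 81 * (5 * \<delta>) * 6"
    proof -
      have "exp (4::real) = exp 1 ^ 4" by (simp flip: exp_of_nat_mult)
      also have "\<dots> \<le> 3 ^ 4" by (rule power_mono[OF exp_le]) simp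
      finally show ?thesis using \<delta> by simp
    qed
    finally have "\<bar>?T (\<lambda>x. indicator I x * f (h x) * \<phi> x) - ?T (\<lambda>x. indicator I x * (f (h x) * (\<phi> (h x) * h' x)))\<bar> \<le> 81 * (5 * \<delta>) * 6" .
    then show ?thesis using e1 e2 e3 t1 t2 \<delta>(1) by linarith
  qed
  then show ?thesis by (simp add: h_def r_def \<phi>_def)
qed

text \<open>The three terms of the bound have separate origins: the event that
  \<open>\<beta>\<close> is at most \<open>\<epsilon>\<close> in absolute value, the terms
  \<open>\<alpha>\<close> and \<open>\<gamma>\<close> divided by \<open>\<beta>\<close> off that
  event, and the replacement of the standard deviation \<open>\<sigma>\<close> by \<open>c\<close>.
  The hypothesis \<open>ind\<close> allows \<open>\<xi>\<close> to be integrated out first, with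
  \<open>\<beta>\<close> and \<open>\<gamma>\<close> frozen.\<close>

lemma (in prob_space) std_normal_affine_quadratic_comparison:
  fixes \<xi> \<beta> \<gamma> :: "'a \<Rightarrow> real" and f :: "real \<Rightarrow> real"
  assumes \<xi>: "distributed M lborel \<xi> std_normal_density"
    and \<beta>: "distributed M lborel \<beta> (normal_density 0 \<sigma>)" and \<sigma>: "0 < \<sigma>"
    and \<gamma>: "integrable M \<gamma>"
    and ind: "distr M borel \<xi> \<Otimes>\<^sub>M distr M (borel \<Otimes>\<^sub>M borel) (\<lambda>\<omega>. (\<beta> \<omega>, \<gamma> \<omega>))
      = distr M (borel \<Otimes>\<^sub>M (borel \<Otimes>\<^sub>M borel)) (\<lambda>\<omega>. (\<xi> \<omega>, (\<beta> \<omega>, \<gamma> \<omega>)))"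
    and f[measurable]: "f \<in> borel_measurable borel" and f01: "\<And>x. 0 \<le> f x" "\<And>x. f x \<le> 1"
    and \<epsilon>: "0 < \<epsilon>" and c: "0 < c"
  shows "\<bar>expectation (\<lambda>\<omega>. f (\<alpha> * (\<xi> \<omega>)\<^sup>2 + \<beta> \<omega> * \<xi> \<omega> + \<gamma> \<omega>))
      - (\<integral>x. (\<integral>y. f (c * x * y) * std_normal_density y \<partial>lborel) * std_normal_density x \<partial>lborel)\<bar>
    \<le> \<epsilon> / \<sigma> + 2500 * (\<bar>\<alpha>\<bar> + expectation (\<lambda>\<omega>. \<bar>\<gamma> \<omega>\<bar>)) / \<epsilon> + 2500 * \<bar>\<sigma> / c - 1\<bar>"
proof -
  let ?N = "std_normal_distribution"
  interpret N: prob_space ?N by (rule prob_space_normal_density) simp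
  have [measurable]: "\<xi> \<in> borel_measurable M" "\<beta> \<in> borel_measurable M" "\<gamma> \<in> borel_measurable M"
    using \<xi> \<beta> \<gamma> by (auto simp: distributed_def)
  have NI: "(\<integral>x. g x \<partial>?N) = (\<integral>x. g x * std_normal_density x \<partial>lborel)"
    if "g \<in> borel_measurable borel" for g :: "real \<Rightarrow> real"
    using that by (subst integral_density) (auto simp: mult.commute)
  have d\<xi>: "distr M borel \<xi> = ?N"
    using distributed_distr_eq_density[OF \<xi>] by (metis distr_cong sets_lborel)
  have NB: "(\<integral>y. g (\<sigma> * y) \<partial>?N) = expectation (\<lambda>\<omega>. g (\<beta> \<omega>))"
    if [measurable]: "g \<in> borel_measurable borel" for g :: "real \<Rightarrow> real"
  proof -
    have "distributed M lborel (\<lambda>\<omega>. (\<beta> \<omega> - 0) / \<sigma>) std_normal_density"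
      using \<beta> normal_standard_normal_convert[OF \<sigma>, of \<beta> 0] by simp
    then have "distr M borel (\<lambda>\<omega>. \<beta> \<omega> / \<sigma>) = ?N"
      using distributed_distr_eq_density by (metis (no_types, lifting) diff_zero distr_cong sets_lborel)
    then have "(\<integral>y. g (\<sigma> * y) \<partial>?N) = (\<integral>y. g (\<sigma> * y) \<partial>distr M borel (\<lambda>\<omega>. \<beta> \<omega> / \<sigma>))" by simp
    also have "\<dots> = expectation (\<lambda>\<omega>. g (\<beta> \<omega>))"
      using \<sigma> by (subst integral_distr) auto
    finally show ?thesis .
  qed
  define Q where "Q = distr M (borel \<Otimes>\<^sub>M borel) (\<lambda>\<omega>. (\<beta> \<omega>, \<gamma> \<omega>))"
  interpret Q: prob_space Q unfolding Q_def by (rule prob_space_distr) simp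
  interpret QN: pair_prob_space ?N Q ..
  have dec: "?N \<Otimes>\<^sub>M Q = distr M (borel \<Otimes>\<^sub>M (borel \<Otimes>\<^sub>M borel)) (\<lambda>\<omega>. (\<xi> \<omega>, (\<beta> \<omega>, \<gamma> \<omega>)))"
    using ind unfolding d\<xi> Q_def by simp
  have sQ[measurable_cong, simp]: "sets Q = sets (borel \<Otimes>\<^sub>M borel)" by (simp add: Q_def)
  have sN[measurable_cong]: "sets ?N = sets borel" by simp
  have b01: "\<bar>f x\<bar> \<le> 1" for x using f01[of x] by simp
  define F where "F b g = (\<integral>x. f (\<alpha> * x\<^sup>2 + b * x + g) \<partial>?N)" for b g
  have F_meas[measurable]: "(\<lambda>(b, g). F b g) \<in> borel_measurable (borel \<Otimes>\<^sub>M borel)"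
    unfolding F_def[abs_def] by measurable
  define K where "K x q = f (\<alpha> * x\<^sup>2 + fst q * x + snd q)" for x :: real and q :: "real \<times> real"
  have [measurable]: "case_prod K \<in> borel_measurable (borel \<Otimes>\<^sub>M (borel \<Otimes>\<^sub>M borel))"
    unfolding K_def[abs_def] by measurable
  have E1: "expectation (\<lambda>\<omega>. f (\<alpha> * (\<xi> \<omega>)\<^sup>2 + \<beta> \<omega> * \<xi> \<omega> + \<gamma> \<omega>)) = expectation (\<lambda>\<omega>. F (\<beta> \<omega>) (\<gamma> \<omega>))"
  proof -
    have "expectation (\<lambda>\<omega>. f (\<alpha> * (\<xi> \<omega>)\<^sup>2 + \<beta> \<omega> * \<xi> \<omega> + \<gamma> \<omega>))
       = (\<integral>z. K (fst z) (snd z) \<partial>(?N \<Otimes>\<^sub>M Q))"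
      unfolding dec K_def by (subst integral_distr) auto
    also have "\<dots> = (\<integral>q. (\<integral>x. K x q \<partial>?N) \<partial>Q)"
    proof -
      have "integrable (?N \<Otimes>\<^sub>M Q) (case_prod K)"
        by (rule QN.integrable_const_bound[where B = 1]) (auto simp: b01 K_def)
      from QN.integral_snd[OF this] show ?thesis by (simp add: split_beta')
    qed
    also have "\<dots> = (\<integral>q. (case q of (b, g) \<Rightarrow> F b g) \<partial>Q)"
      by (simp add: F_def K_def split_beta')
    also have "\<dots> = expectation (\<lambda>\<omega>. F (\<beta> \<omega>) (\<gamma> \<omega>))"
      unfolding Q_def by (subst integral_distr) auto
    finally show ?thesis .
  qed
  define G where "G b = (\<integral>x. f (b * x) \<partial>?N)" for b
  have G_meas[measurable]: "G \<in> borel_measurable borel"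
    unfolding G_def[abs_def] by measurable
  have F01: "0 \<le> F b g \<and> F b g \<le> 1" for b g
    unfolding F_def using f01
    by (auto intro!: integral_nonneg_AE N.integral_le_const N.integrable_const_bound[where B = 1] simp: b01)
  have G01: "0 \<le> G b \<and> G b \<le> 1" for b
    unfolding G_def using f01
    by (auto intro!: integral_nonneg_AE N.integral_le_const N.integrable_const_bound[where B = 1] simp: b01)
  \<comment> \<open>For a frozen \<open>b\<close> off the small event, \<open>b\<close> is absorbed
    into the test function and the perturbation lemma applies with \<open>d = g / b\<close>,
    \<open>e = 0\<close> and the quadratic coefficient \<open>\<alpha> / b\<close>. On the small
    event only the range [0,1] is used.\<close>
  have FG: "\<bar>F b g - G b\<bar> \<le> indicator {-\<epsilon>..\<epsilon>} b + 2500 * (\<bar>\<alpha>\<bar> + \<bar>g\<bar>) / \<epsilon>" for b g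
  proof (cases "\<bar>b\<bar> \<le> \<epsilon>")
    case True
    have "0 \<le> 2500 * (\<bar>\<alpha>\<bar> + \<bar>g\<bar>) / \<epsilon>" using \<epsilon> by simp
    moreover have "indicator {-\<epsilon>..\<epsilon>} b = (1::real)" using True by (auto simp: abs_le_iff)
    ultimately show ?thesis using F01[of b g] G01[of b] by linarith
  next
    case False
    then have b: "b \<noteq> 0" "\<epsilon> < \<bar>b\<bar>" using \<epsilon> by auto
    define \<delta> where "\<delta> = (\<bar>\<alpha>\<bar> + \<bar>g\<bar>) / \<bar>b\<bar>"
    have "\<bar>(\<integral>x. f (b * (x + (g / b + 0 * x + \<alpha> / b * x\<^sup>2))) * std_normal_density x \<partial>lborel)
       - (\<integral>x. f (b * x) * std_normal_density x \<partial>lborel)\<bar> \<le> 2500 * \<delta>"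
      by (rule gaussian_quadratic_perturbation[of "\<lambda>x. f (b * x)"])
        (auto simp: f01 \<delta>_def intro!: divide_right_mono)
    moreover have "b * (x + (g / b + 0 * x + \<alpha> / b * x\<^sup>2)) = \<alpha> * x\<^sup>2 + b * x + g" for x
      using b by (simp add: field_simps)
    ultimately have "\<bar>F b g - G b\<bar> \<le> 2500 * \<delta>"
      unfolding F_def G_def by (subst (1 2) NI) auto
    also have "\<dots> \<le> 2500 * (\<bar>\<alpha>\<bar> + \<bar>g\<bar>) / \<epsilon>"
      unfolding \<delta>_def using b \<epsilon> by (simp add: divide_left_mono mult_pos_pos)
    also have "\<dots> \<le> indicator {-\<epsilon>..\<epsilon>} b + 2500 * (\<bar>\<alpha>\<bar> + \<bar>g\<bar>) / \<epsilon>" by simp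
    finally show ?thesis .
  qed
  \<comment> \<open>The density is at most \<open>1 / (2 * \<sigma>)\<close> and the interval has
    length \<open>2 * \<epsilon>\<close>.\<close>
  have small: "prob (\<beta> -` {-\<epsilon>..\<epsilon>} \<inter> space M) \<le> \<epsilon> / \<sigma>"
  proof -
    have "emeasure M (\<beta> -` {-\<epsilon>..\<epsilon>} \<inter> space M) = (\<integral>\<^sup>+x. ennreal (normal_density 0 \<sigma> x) * indicator {-\<epsilon>..\<epsilon>} x \<partial>lborel)"
      by (rule distributed_emeasure[OF \<beta>]) simp
    also have "\<dots> \<le> (\<integral>\<^sup>+x. ennreal (1 / (2 * \<sigma>)) * indicator {-\<epsilon>..\<epsilon>} x \<partial>lborel)"
    proof (intro nn_integral_mono mult_right_mono ennreal_leI)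
      fix x :: real
      have "2 \<le> sqrt (2 * pi)" using pi_gt3 by (intro real_le_rsqrt) auto
      then have "2 * \<sigma> \<le> sqrt (2 * pi * \<sigma>\<^sup>2)" using \<sigma> by (simp add: real_sqrt_mult)
      then have "1 / sqrt (2 * pi * \<sigma>\<^sup>2) \<le> 1 / (2 * \<sigma>)" using \<sigma> by (intro divide_left_mono) auto
      moreover have "exp (- (x - 0)\<^sup>2 / (2 * \<sigma>\<^sup>2)) \<le> 1" by simp
      ultimately have "1 / sqrt (2 * pi * \<sigma>\<^sup>2) * exp (- (x - 0)\<^sup>2 / (2 * \<sigma>\<^sup>2)) \<le> 1 / (2 * \<sigma>) * 1"
        using \<sigma> by (intro mult_mono) auto
      then show "normal_density 0 \<sigma> x \<le> 1 / (2 * \<sigma>)" by (simp add: normal_density_def)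
    qed auto
    also have "\<dots> = ennreal (1 / (2 * \<sigma>)) * ennreal (2 * \<epsilon>)"
      using \<epsilon> by (subst nn_integral_cmult_indicator) auto
    also have "\<dots> = ennreal (\<epsilon> / \<sigma>)" using \<epsilon> \<sigma> by (simp flip: ennreal_mult)
    finally show ?thesis using \<epsilon> \<sigma> by (simp add: emeasure_eq_measure)
  qed
  have iF: "integrable M (\<lambda>\<omega>. F (\<beta> \<omega>) (\<gamma> \<omega>))"
  proof (rule integrable_const_bound[where B = 1])
    have "(\<lambda>\<omega>. (case (\<beta> \<omega>, \<gamma> \<omega>) of (b, g) \<Rightarrow> F b g)) \<in> borel_measurable M" by measurable
    then show "(\<lambda>\<omega>. F (\<beta> \<omega>) (\<gamma> \<omega>)) \<in> borel_measurable M" by simp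
  qed (use F01 in auto)
  have iG: "integrable M (\<lambda>\<omega>. G (\<beta> \<omega>))"
    by (rule integrable_const_bound[where B = 1]) (use G01 in auto)
  have S1: "\<bar>expectation (\<lambda>\<omega>. F (\<beta> \<omega>) (\<gamma> \<omega>)) - expectation (\<lambda>\<omega>. G (\<beta> \<omega>))\<bar>
     \<le> \<epsilon> / \<sigma> + 2500 * (\<bar>\<alpha>\<bar> + expectation (\<lambda>\<omega>. \<bar>\<gamma> \<omega>\<bar>)) / \<epsilon>"
  proof -
    have "\<bar>expectation (\<lambda>\<omega>. F (\<beta> \<omega>) (\<gamma> \<omega>)) - expectation (\<lambda>\<omega>. G (\<beta> \<omega>))\<bar>
       = \<bar>expectation (\<lambda>\<omega>. F (\<beta> \<omega>) (\<gamma> \<omega>) - G (\<beta> \<omega>))\<bar>"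
      using iF iG by simp
    also have "\<dots> \<le> expectation (\<lambda>\<omega>. indicator (\<beta> -` {-\<epsilon>..\<epsilon>} \<inter> space M) \<omega> + 2500 * (\<bar>\<alpha>\<bar> + \<bar>\<gamma> \<omega>\<bar>) / \<epsilon>)"
    proof (rule order_trans[OF integral_abs_bound integral_mono])
      show "integrable M (\<lambda>\<omega>. \<bar>F (\<beta> \<omega>) (\<gamma> \<omega>) - G (\<beta> \<omega>)\<bar>)" using iF iG by auto
      show "integrable M (\<lambda>\<omega>. indicator (\<beta> -` {-\<epsilon>..\<epsilon>} \<inter> space M) \<omega> + 2500 * (\<bar>\<alpha>\<bar> + \<bar>\<gamma> \<omega>\<bar>) / \<epsilon>)"
        using \<gamma> by (intro Bochner_Integration.integrable_add integrable_divide integrable_mult_right integrable_abs integrable_const)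
          (auto intro!: integrable_real_indicator simp: emeasure_eq_measure)
      fix \<omega> assume "\<omega> \<in> space M"
      then show "\<bar>F (\<beta> \<omega>) (\<gamma> \<omega>) - G (\<beta> \<omega>)\<bar> \<le> indicator (\<beta> -` {-\<epsilon>..\<epsilon>} \<inter> space M) \<omega> + 2500 * (\<bar>\<alpha>\<bar> + \<bar>\<gamma> \<omega>\<bar>) / \<epsilon>"
        using FG[of "\<beta> \<omega>" "\<gamma> \<omega>"] by (simp add: indicator_def)
    qed
    also have "\<dots> = prob (\<beta> -` {-\<epsilon>..\<epsilon>} \<inter> space M) + 2500 * (\<bar>\<alpha>\<bar> + expectation (\<lambda>\<omega>. \<bar>\<gamma> \<omega>\<bar>)) / \<epsilon>"
      using \<gamma> by (subst Bochner_Integration.integral_add) (auto intro!: integrable_real_indicator simp: emeasure_eq_measure prob_space)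
    finally show ?thesis using small by linarith
  qed
  interpret NN: pair_prob_space ?N ?N ..
  \<comment> \<open>With \<open>\<alpha>\<close> and \<open>\<gamma>\<close> gone the two normal
    variables play symmetric roles; exchanging the integrals gives the outer one the place it has in
    the target.\<close>
  have E2: "expectation (\<lambda>\<omega>. G (\<beta> \<omega>)) = (\<integral>x. (\<integral>y. f (\<sigma> * y * x) \<partial>?N) \<partial>?N)"
  proof -
    have "expectation (\<lambda>\<omega>. G (\<beta> \<omega>)) = (\<integral>y. G (\<sigma> * y) \<partial>?N)" by (simp add: NB)
    also have "\<dots> = (\<integral>y. (\<integral>x. f (\<sigma> * y * x) \<partial>?N) \<partial>?N)" by (simp add: G_def)
    also have "\<dots> = (\<integral>x. (\<integral>y. f (\<sigma> * y * x) \<partial>?N) \<partial>?N)"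
      by (rule NN.Fubini_integral) (auto intro!: NN.integrable_const_bound[where B = 1] simp: b01)
    finally show ?thesis .
  qed
  have S2: "\<bar>(\<integral>x. (\<integral>y. f (\<sigma> * y * x) \<partial>?N) \<partial>?N) - (\<integral>x. (\<integral>y. f (c * x * y) \<partial>?N) \<partial>?N)\<bar> \<le> 2500 * \<bar>\<sigma> / c - 1\<bar>"
  proof -
    \<comment> \<open>Here the perturbation is purely linear, with coefficient
      \<open>\<sigma> / c - 1\<close>. Since \<open>c * x\<close> goes into the test function, the
      bound is uniform in \<open>x\<close>, also near 0.\<close>
    have pw: "\<bar>(\<integral>y. f (\<sigma> * y * x) \<partial>?N) - (\<integral>y. f (c * x * y) \<partial>?N)\<bar> \<le> 2500 * \<bar>\<sigma> / c - 1\<bar>" for x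
    proof -
      have "\<bar>(\<integral>y. f (c * x * (y + (0 + (\<sigma> / c - 1) * y + 0 * y\<^sup>2))) * std_normal_density y \<partial>lborel)
       - (\<integral>y. f (c * x * y) * std_normal_density y \<partial>lborel)\<bar> \<le> 2500 * \<bar>\<sigma> / c - 1\<bar>"
        by (rule gaussian_quadratic_perturbation[of "\<lambda>y. f (c * x * y)"]) (auto simp: f01)
      moreover have "c * x * (y + (0 + (\<sigma> / c - 1) * y + 0 * y\<^sup>2)) = \<sigma> * y * x" for y
        using c by (simp add: field_simps)
      moreover have "(\<integral>y. f (\<sigma> * y * x) \<partial>?N) = (\<integral>y. f (\<sigma> * y * x) * std_normal_density y \<partial>lborel)"
        "(\<integral>y. f (c * x * y) \<partial>?N) = (\<integral>y. f (c * x * y) * std_normal_density y \<partial>lborel)"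
        by (auto intro!: NI)
      ultimately show ?thesis by (simp only:)
    qed
    have H01: "0 \<le> (\<integral>y. g y \<partial>?N) \<and> (\<integral>y. g y \<partial>?N) \<le> 1"
      if "g \<in> borel_measurable borel" "\<And>y. 0 \<le> g y" "\<And>y. g y \<le> 1" for g :: "real \<Rightarrow> real"
      using that by (auto intro!: integral_nonneg_AE N.integral_le_const N.integrable_const_bound[where B = 1])
    have ii: "integrable ?N (\<lambda>x. (\<integral>y. f (\<sigma> * y * x) \<partial>?N))" "integrable ?N (\<lambda>x. (\<integral>y. f (c * x * y) \<partial>?N))"
      using H01[of "\<lambda>y. f (\<sigma> * y * x)" for x] H01[of "\<lambda>y. f (c * x * y)" for x] f01
      by (auto intro!: N.integrable_const_bound[where B = 1])
    have "\<bar>(\<integral>x. (\<integral>y. f (\<sigma> * y * x) \<partial>?N) \<partial>?N) - (\<integral>x. (\<integral>y. f (c * x * y) \<partial>?N) \<partial>?N)\<bar>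
       = \<bar>(\<integral>x. (\<integral>y. f (\<sigma> * y * x) \<partial>?N) - (\<integral>y. f (c * x * y) \<partial>?N) \<partial>?N)\<bar>"
      using ii by simp
    also have "\<dots> \<le> (\<integral>x. \<bar>(\<integral>y. f (\<sigma> * y * x) \<partial>?N) - (\<integral>y. f (c * x * y) \<partial>?N)\<bar> \<partial>?N)"
      by (rule integral_abs_bound)
    also have "\<dots> \<le> 2500 * \<bar>\<sigma> / c - 1\<bar>"
      using ii pw by (intro N.integral_le_const integrable_abs Bochner_Integration.integrable_diff AE_I2) auto
    finally show ?thesis .
  qed
  have "(\<integral>x. (\<integral>y. f (c * x * y) \<partial>?N) \<partial>?N)
      = (\<integral>x. (\<integral>y. f (c * x * y) * std_normal_density y \<partial>lborel) * std_normal_density x \<partial>lborel)"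
    by (subst NI, measurable) (simp add: NI)
  then show ?thesis using E1 E2 S1 S2 by simp
qed

section \<open>Independence from characteristic functions\<close>

text \<open>Levy's uniqueness theorem for the laws of \<open>Y\<close> under \<open>M\<close> and under the density \<open>(D + w) / D\<close>.\<close>

lemma (in prob_space) fourier_annihilator_real:
  fixes w Y :: "'a \<Rightarrow> real"
  assumes [measurable]: "w \<in> borel_measurable M" "Y \<in> borel_measurable M"
    and bnd: "\<And>\<omega>. \<bar>w \<omega>\<bar> \<le> C"
    and zero: "\<And>s. (\<integral>\<omega>. complex_of_real (w \<omega>) * iexp (s * Y \<omega>) \<partial>M) = 0"
    and [measurable]: "A \<in> sets borel"
  shows "(\<integral>\<omega>. w \<omega> * indicator A (Y \<omega>) \<partial>M) = 0"
proof -
  define D where "D = C + 1"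
  have D: "0 < D" "\<bar>w \<omega>\<bar> \<le> D" for \<omega> using bnd[of undefined] bnd[of \<omega>] by (auto simp: D_def)
  \<comment> \<open>\<open>D\<close> exceeds the bound on \<open>w\<close>, so \<open>v\<close> is
    nonnegative, and the hypothesis at s = 0 gives it mean 1.\<close>
  define v where "v \<omega> = (D + w \<omega>) / D" for \<omega>
  have v0: "0 \<le> v \<omega>" for \<omega> using D(2)[of \<omega>] D(1) by (simp add: v_def abs_le_iff)
  have [measurable]: "v \<in> borel_measurable M" unfolding v_def[abs_def] by measurable
  have iw: "integrable M w" by (rule integrable_const_bound[where B = C]) (use bnd in auto)
  have iv: "integrable M v" unfolding v_def using iw by auto
  have Ew: "expectation w = 0" using zero[of 0] by (simp add: integral_complex_of_real)
  have Ev: "expectation v = 1"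
    unfolding v_def using iw D(1) Ew by (simp add: prob_space)
  have psd: "prob_space (density M v)"
  proof
    have "emeasure (density M v) (space M) = (\<integral>\<^sup>+\<omega>. v \<omega> \<partial>M)"
      by (subst emeasure_density) (auto intro!: nn_integral_cong)
    also have "\<dots> = ennreal (expectation v)" by (rule nn_integral_eq_integral) (use iv v0 in auto)
    finally show "emeasure (density M v) (space (density M v)) = 1" using Ev by simp
  qed
  interpret V: prob_space "density M v" by (rule psd)
  define M1 where "M1 = distr (density M v) borel Y"
  define M2 where "M2 = distr M borel Y"
  have "M1 = M2"
  proof (rule Levy_uniqueness)
    show "real_distribution M1" unfolding M1_def by (rule V.real_distribution_distr) simp
    show "real_distribution M2" unfolding M2_def by (rule real_distribution_distr) simp
    show "char M1 = char M2"
    proof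
      fix s
      have i1: "integrable M (\<lambda>\<omega>. iexp (s * Y \<omega>))"
        by (rule integrable_const_bound[where B = 1]) auto
      have i2: "integrable M (\<lambda>\<omega>. complex_of_real (w \<omega>) * iexp (s * Y \<omega>))"
        by (rule integrable_const_bound[where B = C]) (use bnd in \<open>auto simp: norm_mult\<close>)
      have "char M1 s = (\<integral>\<omega>. v \<omega> *\<^sub>R iexp (s * Y \<omega>) \<partial>M)"
        unfolding char_def M1_def by (subst integral_distr, simp_all, subst integral_density) (use v0 in auto)
      also have "\<dots> = (\<integral>\<omega>. iexp (s * Y \<omega>) + (complex_of_real (w \<omega>) * iexp (s * Y \<omega>)) / complex_of_real D \<partial>M)"
        using D(1) by (intro Bochner_Integration.integral_cong) (auto simp: v_def scaleR_conv_of_real field_simps)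
      also have "\<dots> = char M2 s"
        unfolding char_def M2_def
        by (subst Bochner_Integration.integral_add[OF i1 integrable_divide[OF i2]]) (simp add: zero[simplified] integral_distr)
      finally show "char M1 s = char M2 s" .
    qed
  qed
  then have eq: "(\<integral>x. indicator A x \<partial>M1) = (\<integral>x. indicator A x \<partial>M2 :: real)" by simp
  have i3: "integrable M (\<lambda>\<omega>. indicator A (Y \<omega>) :: real)"
    by (rule integrable_const_bound[where B = 1]) auto
  have i4: "integrable M (\<lambda>\<omega>. w \<omega> * indicator A (Y \<omega>))"
    by (rule integrable_const_bound[where B = C]) (use bnd order_trans[OF abs_ge_zero bnd] in \<open>auto split: split_indicator\<close>)
  have "(\<integral>x. indicator A x \<partial>M1) = (\<integral>\<omega>. v \<omega> *\<^sub>R (indicator A (Y \<omega>) :: real) \<partial>M)"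
    unfolding M1_def by (subst integral_distr, simp_all, subst integral_density) (use v0 in auto)
  also have "\<dots> = (\<integral>\<omega>. indicator A (Y \<omega>) + (w \<omega> * indicator A (Y \<omega>)) / D \<partial>M)"
    using D(1) by (intro Bochner_Integration.integral_cong) (auto simp: v_def field_simps)
  also have "\<dots> = (\<integral>\<omega>. indicator A (Y \<omega>) \<partial>M) + (\<integral>\<omega>. w \<omega> * indicator A (Y \<omega>) \<partial>M) / D"
    by (subst Bochner_Integration.integral_add[OF i3 integrable_divide[OF i4]]) simp
  also have "(\<integral>\<omega>. indicator A (Y \<omega>) \<partial>M) = (\<integral>x. indicator A x \<partial>M2 :: real)"
    unfolding M2_def by (subst integral_distr) auto
  finally show ?thesis using eq D(1) by simp
qed

text \<open>The hypothesis passes to the conjugate of \<open>W\<close> by conjugating the integral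
  and changing the sign of \<open>s\<close>. Hence it holds for the real and the imaginary part, to
  which the real version applies.\<close>

lemma (in prob_space) fourier_annihilator:
  fixes W :: "'a \<Rightarrow> complex" and Y :: "'a \<Rightarrow> real"
  assumes [measurable]: "W \<in> borel_measurable M" "Y \<in> borel_measurable M"
    and bnd: "\<And>\<omega>. norm (W \<omega>) \<le> C"
    and zero: "\<And>s. (\<integral>\<omega>. W \<omega> * iexp (s * Y \<omega>) \<partial>M) = 0"
    and [measurable]: "A \<in> sets borel"
  shows "(\<integral>\<omega>. W \<omega> * indicator A (Y \<omega>) \<partial>M) = 0"
proof -
  have [measurable]: "cnj \<in> borel_measurable borel"
    by (intro borel_measurable_continuous_onI continuous_intros)
  have i1: "integrable M (\<lambda>\<omega>. W \<omega> * iexp (s * Y \<omega>))" for s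
    by (rule integrable_const_bound[where B = C]) (use bnd in \<open>auto simp: norm_mult\<close>)
  have i2: "integrable M (\<lambda>\<omega>. cnj (W \<omega>) * iexp (s * Y \<omega>))" for s
    by (rule integrable_const_bound[where B = C]) (use bnd in \<open>auto simp: norm_mult\<close>)
  have zero': "(\<integral>\<omega>. cnj (W \<omega>) * iexp (s * Y \<omega>) \<partial>M) = 0" for s
  proof -
    have "(\<integral>\<omega>. cnj (W \<omega>) * iexp (s * Y \<omega>) \<partial>M) = (\<integral>\<omega>. cnj (W \<omega> * iexp (- s * Y \<omega>)) \<partial>M)"
      by (intro Bochner_Integration.integral_cong) (auto simp: exp_cnj)
    also have "\<dots> = cnj (\<integral>\<omega>. W \<omega> * iexp (- s * Y \<omega>) \<partial>M)" by (rule Bochner_Integration.integral_cnj)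
    also have "\<dots> = 0" by (subst zero) simp
    finally show ?thesis .
  qed
  have re: "(\<integral>\<omega>. Re (W \<omega>) * indicator A (Y \<omega>) \<partial>M) = 0"
  proof (rule fourier_annihilator_real[where C = C])
    show "\<bar>Re (W \<omega>)\<bar> \<le> C" for \<omega> using bnd[of \<omega>] abs_Re_le_cmod order_trans by blast
    fix s
    have "(\<integral>\<omega>. complex_of_real (Re (W \<omega>)) * iexp (s * Y \<omega>) \<partial>M)
        = (\<integral>\<omega>. (W \<omega> * iexp (s * Y \<omega>) + cnj (W \<omega>) * iexp (s * Y \<omega>)) / 2 \<partial>M)"
      by (intro Bochner_Integration.integral_cong) (auto simp: distrib_right[symmetric] complex_add_cnj)
    also have "\<dots> = 0" by (subst integral_divide_zero, subst Bochner_Integration.integral_add[OF i1 i2]) (simp only: zero zero', simp)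
    finally show "(\<integral>\<omega>. complex_of_real (Re (W \<omega>)) * iexp (s * Y \<omega>) \<partial>M) = 0" .
  qed auto
  have im: "(\<integral>\<omega>. Im (W \<omega>) * indicator A (Y \<omega>) \<partial>M) = 0"
  proof (rule fourier_annihilator_real[where C = C])
    show "\<bar>Im (W \<omega>)\<bar> \<le> C" for \<omega> using bnd[of \<omega>] abs_Im_le_cmod order_trans by blast
    fix s
    have "(\<integral>\<omega>. complex_of_real (Im (W \<omega>)) * iexp (s * Y \<omega>) \<partial>M)
        = (\<integral>\<omega>. (W \<omega> * iexp (s * Y \<omega>) - cnj (W \<omega>) * iexp (s * Y \<omega>)) / (2 * \<i>) \<partial>M)"
    proof (intro Bochner_Integration.integral_cong refl)
      fix \<omega>
      have "W \<omega> * e - cnj (W \<omega>) * e = (2 * \<i>) * (complex_of_real (Im (W \<omega>)) * e)" for e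
        by (simp add: left_diff_distrib[symmetric] complex_diff_cnj)
      then show "complex_of_real (Im (W \<omega>)) * iexp (s * Y \<omega>)
          = (W \<omega> * iexp (s * Y \<omega>) - cnj (W \<omega>) * iexp (s * Y \<omega>)) / (2 * \<i>)" by simp
    qed
    also have "\<dots> = 0" by (subst integral_divide_zero, subst Bochner_Integration.integral_diff[OF i1 i2]) (simp only: zero zero', simp)
    finally show "(\<integral>\<omega>. complex_of_real (Im (W \<omega>)) * iexp (s * Y \<omega>) \<partial>M) = 0" .
  qed auto
  have iA: "integrable M (\<lambda>\<omega>. W \<omega> * indicator A (Y \<omega>))"
    by (rule integrable_const_bound[where B = C]) (use bnd order_trans[OF norm_ge_zero bnd] in \<open>auto simp: norm_mult split: split_indicator\<close>)
  have "Re (\<integral>\<omega>. W \<omega> * indicator A (Y \<omega>) \<partial>M) = (\<integral>\<omega>. Re (W \<omega>) * indicator A (Y \<omega>) \<partial>M)"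
    by (subst integral_Re[OF iA, symmetric]) (auto intro!: Bochner_Integration.integral_cong split: split_indicator)
  moreover have "Im (\<integral>\<omega>. W \<omega> * indicator A (Y \<omega>) \<partial>M) = (\<integral>\<omega>. Im (W \<omega>) * indicator A (Y \<omega>) \<partial>M)"
    by (subst integral_Im[OF iA, symmetric]) (auto intro!: Bochner_Integration.integral_cong split: split_indicator)
  ultimately show ?thesis using re im by (simp add: complex_eq_iff)
qed

text \<open>The exponentials are exchanged for indicators one coordinate at a time. Those still
  present count as part of the weight, which is why complex weights were needed.\<close>

lemma (in prob_space) fourier_annihilator_finite:
  fixes W :: "'a \<Rightarrow> complex" and Y :: "'j \<Rightarrow> 'a \<Rightarrow> real"
  assumes "finite J" "W \<in> borel_measurable M" "\<And>\<omega>. norm (W \<omega>) \<le> C"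
    and "\<And>j. j \<in> J \<Longrightarrow> Y j \<in> borel_measurable M"
    and "\<And>s. (\<integral>\<omega>. W \<omega> * (\<Prod>j\<in>J. iexp (s j * Y j \<omega>)) \<partial>M) = 0"
    and "\<And>j. j \<in> J \<Longrightarrow> A j \<in> sets borel"
  shows "(\<integral>\<omega>. W \<omega> * (\<Prod>j\<in>J. indicator (A j) (Y j \<omega>)) \<partial>M) = 0"
  using assms
proof (induction J arbitrary: W rule: finite_induct)
  case (insert j J)
  note [measurable] = insert.prems(1) insert.prems(3)[of j] insert.prems(5)[of j]
  have [measurable]: "\<And>i. i \<in> J \<Longrightarrow> Y i \<in> borel_measurable M" using insert.prems(3) by auto
  have C0: "0 \<le> C" using order_trans[OF norm_ge_zero insert.prems(2)] .
  have "(\<integral>\<omega>. (W \<omega> * indicator (A j) (Y j \<omega>)) * (\<Prod>i\<in>J. indicator (A i) (Y i \<omega>)) \<partial>M) = 0"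
  proof (rule insert.IH)
    show "(\<lambda>\<omega>. W \<omega> * indicator (A j) (Y j \<omega>)) \<in> borel_measurable M" by measurable
    show "norm (W \<omega> * indicator (A j) (Y j \<omega>)) \<le> C" for \<omega>
      using insert.prems(2)[of \<omega>] C0 by (auto split: split_indicator)
    fix s :: "'j \<Rightarrow> real"
    have "(\<integral>\<omega>. (W \<omega> * (\<Prod>i\<in>J. iexp (s i * Y i \<omega>))) * indicator (A j) (Y j \<omega>) \<partial>M) = 0"
    proof (rule fourier_annihilator[where C = C])
      show "norm (W \<omega> * (\<Prod>i\<in>J. iexp (s i * Y i \<omega>))) \<le> C" for \<omega>
        using insert.prems(2)[of \<omega>] by (simp add: norm_mult prod_norm[symmetric])
      fix r :: real
      have "(\<Prod>i\<in>J. iexp ((s(j := r)) i * Y i \<omega>)) = (\<Prod>i\<in>J. iexp (s i * Y i \<omega>))" for \<omega>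
        using insert.hyps by (intro prod.cong) auto
      then show "(\<integral>\<omega>. (W \<omega> * (\<Prod>i\<in>J. iexp (s i * Y i \<omega>))) * iexp (r * Y j \<omega>) \<partial>M) = 0"
        using insert.prems(4)[of "s(j := r)"] insert.hyps by (simp add: mult_ac)
    qed measurable
    then show "(\<integral>\<omega>. (W \<omega> * indicator (A j) (Y j \<omega>)) * (\<Prod>i\<in>J. iexp (s i * Y i \<omega>)) \<partial>M) = 0"
      by (simp add: mult_ac)
  qed (use insert.prems in auto)
  then show ?case using insert.hyps by (simp add: mult_ac)
qed simp

text \<open>The annihilator is applied twice. For fixed \<open>r\<close>, the exponential of the
  combination of the \<open>Y j\<close> minus its mean annihilates all exponentials of
  \<open>X\<close>, hence all indicators of \<open>X\<close>; then an indicator of \<open>X\<close>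
  minus its mean annihilates all exponentials of the vector. The map \<open>g\<close> makes the
  conclusion available for nonlinear functions of the vector.\<close>

lemma (in prob_space) indep_vector_of_char_factorization:
  fixes X :: "'a \<Rightarrow> real" and Y :: "'j \<Rightarrow> 'a \<Rightarrow> real" and g :: "('j \<Rightarrow> real) \<Rightarrow> 'c"
  assumes J: "finite J" and [measurable]: "X \<in> borel_measurable M" "\<And>j. j \<in> J \<Longrightarrow> Y j \<in> borel_measurable M"
    and fact: "\<And>s r. (\<integral>\<omega>. iexp (s * X \<omega>) * iexp (\<Sum>j\<in>J. r j * Y j \<omega>) \<partial>M)
       = (\<integral>\<omega>. iexp (s * X \<omega>) \<partial>M) * (\<integral>\<omega>. iexp (\<Sum>j\<in>J. r j * Y j \<omega>) \<partial>M)"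
    and g[measurable]: "g \<in> measurable (Pi\<^sub>M J (\<lambda>_. borel)) S"
  shows "distr M borel X \<Otimes>\<^sub>M distr M S (\<lambda>\<omega>. g (\<lambda>j\<in>J. Y j \<omega>))
     = distr M (borel \<Otimes>\<^sub>M S) (\<lambda>\<omega>. (X \<omega>, g (\<lambda>j\<in>J. Y j \<omega>)))"
proof -
  define V where "V \<omega> = (\<lambda>j\<in>J. Y j \<omega>)" for \<omega>
  have [measurable]: "V \<in> measurable M (Pi\<^sub>M J (\<lambda>_. borel))" unfolding V_def[abs_def] by measurable
  have box: "(\<integral>\<omega>. indicator A (X \<omega>) * (\<Prod>j\<in>J. indicator (C j) (Y j \<omega>)) \<partial>M)
      = (\<integral>\<omega>. indicator A (X \<omega>) \<partial>M) * (\<integral>\<omega>. (\<Prod>j\<in>J. indicator (C j) (Y j \<omega>)) \<partial>M :: complex)"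
    if [measurable]: "A \<in> sets borel" and C: "\<And>j. j \<in> J \<Longrightarrow> C j \<in> sets borel" for A C
  proof -
    note [measurable] = C
    let ?a = "\<integral>\<omega>. indicator A (X \<omega>) \<partial>M :: complex"
    have na: "norm ?a \<le> 1"
      by (rule order_trans[OF integral_norm_bound integral_le_const])
        (auto intro!: integrable_norm integrable_const_bound[where B = 1] split: split_indicator)
    have "(\<integral>\<omega>. (indicator A (X \<omega>) - ?a) * (\<Prod>j\<in>J. indicator (C j) (Y j \<omega>)) \<partial>M) = 0"
    proof (rule fourier_annihilator_finite[OF J, where C = 2])
      show "norm (indicator A (X \<omega>) - ?a) \<le> 2" for \<omega>
        using norm_triangle_ineq4[of "indicator A (X \<omega>)" ?a] na by (auto split: split_indicator)
      fix r :: "'j \<Rightarrow> real"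
      let ?S = "\<lambda>\<omega>. iexp (\<Sum>j\<in>J. r j * Y j \<omega>)"
      let ?e = "\<integral>\<omega>. ?S \<omega> \<partial>M"
      have iS: "integrable M ?S" by (rule integrable_const_bound[where B = 1]) auto
      have ne: "norm ?e \<le> 1"
        by (rule order_trans[OF integral_norm_bound integral_le_const]) (use iS in auto)
      have "(\<integral>\<omega>. (?S \<omega> - ?e) * indicator A (X \<omega>) \<partial>M) = 0"
      proof (rule fourier_annihilator[where C = 2])
        show "norm (?S \<omega> - ?e) \<le> 2" for \<omega>
          using norm_triangle_ineq4[of "?S \<omega>" ?e] ne by auto
        fix s
        have i1: "integrable M (\<lambda>\<omega>. iexp (s * X \<omega>))" "integrable M (\<lambda>\<omega>. iexp (s * X \<omega>) * ?S \<omega>)"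
          by (auto intro!: integrable_const_bound[where B = 1] simp: norm_mult)
        have "(\<integral>\<omega>. (?S \<omega> - ?e) * iexp (s * X \<omega>) \<partial>M) = (\<integral>\<omega>. iexp (s * X \<omega>) * ?S \<omega> - ?e * iexp (s * X \<omega>) \<partial>M)"
          by (simp add: algebra_simps)
        also have "\<dots> = 0"
          using i1 by (subst Bochner_Integration.integral_diff) (auto simp: fact[simplified])
        finally show "(\<integral>\<omega>. (?S \<omega> - ?e) * iexp (s * X \<omega>) \<partial>M) = 0" .
      qed measurable
      moreover have i2: "integrable M (\<lambda>\<omega>. ?S \<omega> * indicator A (X \<omega>))" "integrable M (\<lambda>\<omega>. indicator A (X \<omega>) :: complex)"
        by (auto intro!: integrable_const_bound[where B = 1] simp: norm_mult split: split_indicator)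
      ultimately have "(\<integral>\<omega>. ?S \<omega> * indicator A (X \<omega>) \<partial>M) = ?e * ?a"
        by (simp add: left_diff_distrib)
      moreover have "(\<integral>\<omega>. (indicator A (X \<omega>) - ?a) * ?S \<omega> \<partial>M)
          = (\<integral>\<omega>. ?S \<omega> * indicator A (X \<omega>) - ?a * ?S \<omega> \<partial>M)"
        by (simp add: algebra_simps)
      ultimately have "(\<integral>\<omega>. (indicator A (X \<omega>) - ?a) * ?S \<omega> \<partial>M) = 0"
        using i2 iS by simp
      moreover have "(\<Prod>j\<in>J. iexp (r j * Y j \<omega>)) = ?S \<omega>" for \<omega>
        using J by (simp add: exp_sum sum_distrib_left)
      ultimately show "(\<integral>\<omega>. (indicator A (X \<omega>) - ?a) * (\<Prod>j\<in>J. iexp (r j * Y j \<omega>)) \<partial>M) = 0" by simp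
    qed (use C in measurable)
    moreover have pl: "cmod (\<Prod>j\<in>J. indicator (C j) (Y j \<omega>)) \<le> 1" for \<omega>
      unfolding prod_norm[symmetric] by (rule prod_le_1) (auto split: split_indicator)
    moreover have "integrable M (\<lambda>\<omega>. indicator A (X \<omega>) * (\<Prod>j\<in>J. indicator (C j) (Y j \<omega>)) :: complex)"
        "integrable M (\<lambda>\<omega>. (\<Prod>j\<in>J. indicator (C j) (Y j \<omega>)) :: complex)"
      using pl by (auto intro!: integrable_const_bound[where B = 1] simp: norm_mult split: split_indicator)
    ultimately show ?thesis by (simp add: left_diff_distrib)
  qed
  have ind_c: "(\<integral>\<omega>. indicator E \<omega> \<partial>M) = complex_of_real (prob E)" if "E \<in> events" for E
  proof -
    have "(\<integral>\<omega>. indicator E \<omega> \<partial>M) = (\<integral>\<omega>. complex_of_real (indicator E \<omega>) \<partial>M)"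
      by (intro Bochner_Integration.integral_cong) (auto split: split_indicator)
    then show ?thesis using that by (simp add: integral_complex_of_real)
  qed
  have ind: "emeasure M (X -` A \<inter> V -` E \<inter> space M) = emeasure M (X -` A \<inter> space M) * emeasure M (V -` E \<inter> space M)"
    if [measurable]: "A \<in> sets borel" and E[measurable]: "E \<in> sets (Pi\<^sub>M J (\<lambda>_. borel))" for A E
  proof -
    \<comment> \<open>Two finite measures that agree on boxes by \<open>box\<close>: the law of
      \<open>V\<close> multiplied by the probability that \<open>X\<close> lies in \<open>A\<close>,
      and the law of \<open>V\<close> restricted to that event.\<close>
    define m1 where "m1 = scale_measure (emeasure M (X -` A \<inter> space M)) (distr M (Pi\<^sub>M J (\<lambda>_. borel)) V)"
    define m2 where "m2 = distr (density M (indicator (X -` A \<inter> space M))) (Pi\<^sub>M J (\<lambda>_. borel)) V"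
    have m1e: "emeasure m1 D = emeasure M (X -` A \<inter> space M) * emeasure M (V -` D \<inter> space M)"
      if "D \<in> sets (Pi\<^sub>M J (\<lambda>_. borel))" for D
      using that by (simp add: m1_def emeasure_distr)
    have m2e: "emeasure m2 D = emeasure M (X -` A \<inter> V -` D \<inter> space M)"
      if D[measurable]: "D \<in> sets (Pi\<^sub>M J (\<lambda>_. borel))" for D
    proof -
      have "emeasure m2 D = (\<integral>\<^sup>+\<omega>. indicator (X -` A \<inter> space M) \<omega> * indicator (V -` D \<inter> space M) \<omega> \<partial>M)"
        unfolding m2_def by (subst emeasure_distr, simp_all, subst emeasure_density) auto
      also have "\<dots> = (\<integral>\<^sup>+\<omega>. indicator (X -` A \<inter> V -` D \<inter> space M) \<omega> \<partial>M)"
        by (intro nn_integral_cong) (auto split: split_indicator)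
      finally show ?thesis by simp
    qed
    have "m1 = m2"
    proof (rule measure_eqI_PiM_finite[OF J, of _ "\<lambda>_. borel" _ "\<lambda>_. Pi\<^sub>E J (\<lambda>_. UNIV)"])
      show "sets m1 = Pi\<^sub>M J (\<lambda>_. borel)" by (simp add: m1_def)
      show "sets m2 = Pi\<^sub>M J (\<lambda>_. borel)" by (simp add: m2_def)
      fix C :: "'j \<Rightarrow> real set" assume C: "\<And>j. j \<in> J \<Longrightarrow> C j \<in> sets borel"
      note [measurable] = C
      have PE: "Pi\<^sub>E J C \<in> sets (Pi\<^sub>M J (\<lambda>_. borel))" using J C by (intro sets_PiM_I_finite) auto
      have V_iff: "(\<Prod>j\<in>J. indicator (C j) (Y j \<omega>)) = (indicator (V -` Pi\<^sub>E J C \<inter> space M) \<omega> :: complex)"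
        if "\<omega> \<in> space M" for \<omega>
        using that J by (auto simp: V_def indicator_def prod.If_cases PiE_def Pi_def) 
      have "complex_of_real (prob (X -` A \<inter> V -` Pi\<^sub>E J C \<inter> space M))
         = (\<integral>\<omega>. indicator (X -` A \<inter> V -` Pi\<^sub>E J C \<inter> space M) \<omega> \<partial>M)"
        using PE by (intro ind_c[symmetric]) auto
      also have "\<dots> = (\<integral>\<omega>. indicator A (X \<omega>) * (\<Prod>j\<in>J. indicator (C j) (Y j \<omega>)) \<partial>M)"
        using V_iff by (intro Bochner_Integration.integral_cong) (auto simp: indicator_def)
      also have "\<dots> = (\<integral>\<omega>. indicator A (X \<omega>) \<partial>M) * (\<integral>\<omega>. (\<Prod>j\<in>J. indicator (C j) (Y j \<omega>)) \<partial>M)"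
        by (rule box) (use C in auto)
      also have "(\<integral>\<omega>. indicator A (X \<omega>) \<partial>M) = (\<integral>\<omega>. indicator (X -` A \<inter> space M) \<omega> \<partial>M :: complex)"
        by (intro Bochner_Integration.integral_cong) (auto simp: indicator_def)
      also have "(\<integral>\<omega>. (\<Prod>j\<in>J. indicator (C j) (Y j \<omega>)) \<partial>M) = (\<integral>\<omega>. indicator (V -` Pi\<^sub>E J C \<inter> space M) \<omega> \<partial>M :: complex)"
        using V_iff by (intro Bochner_Integration.integral_cong) auto
      also have "(\<integral>\<omega>. indicator (X -` A \<inter> space M) \<omega> \<partial>M) * (\<integral>\<omega>. indicator (V -` Pi\<^sub>E J C \<inter> space M) \<omega> \<partial>M)
         = complex_of_real (prob (X -` A \<inter> space M) * prob (V -` Pi\<^sub>E J C \<inter> space M))"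
        using PE by (subst (1 2) ind_c) auto
      finally have "prob (X -` A \<inter> V -` Pi\<^sub>E J C \<inter> space M) = prob (X -` A \<inter> space M) * prob (V -` Pi\<^sub>E J C \<inter> space M)"
        by (simp only: of_real_eq_iff)
      then show "emeasure m1 (Pi\<^sub>E J C) = emeasure m2 (Pi\<^sub>E J C)"
        using PE by (simp add: m1e m2e emeasure_eq_measure ennreal_mult)
    next
      show "range (\<lambda>_::nat. Pi\<^sub>E J (\<lambda>_. UNIV :: real set)) \<subseteq> prod_algebra J (\<lambda>_. borel)"
        using J by (auto intro!: prod_algebraI_finite)
      show "(\<Union>i::nat. Pi\<^sub>E J (\<lambda>_. UNIV :: real set)) = space (Pi\<^sub>M J (\<lambda>_. borel))"
        by (simp add: space_PiM)
      show "emeasure m1 (Pi\<^sub>E J (\<lambda>_. UNIV)) \<noteq> \<infinity>"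
        using J by (subst m1e) (auto simp: emeasure_eq_measure ennreal_mult_eq_top_iff)
    qed
    then show ?thesis using m1e[OF E] m2e[OF E] by simp
  qed
  have gV[measurable]: "(\<lambda>\<omega>. g (V \<omega>)) \<in> measurable M S" by measurable
  interpret D1: prob_space "distr M borel X" by (rule prob_space_distr) simp
  interpret D2: prob_space "distr M S (\<lambda>\<omega>. g (V \<omega>))" by (rule prob_space_distr) simp
  have "distr M borel X \<Otimes>\<^sub>M distr M S (\<lambda>\<omega>. g (V \<omega>)) = distr M (borel \<Otimes>\<^sub>M S) (\<lambda>\<omega>. (X \<omega>, g (V \<omega>)))"
  proof (rule pair_measure_eqI)
    show "sigma_finite_measure (distr M borel X)" "sigma_finite_measure (distr M S (\<lambda>\<omega>. g (V \<omega>)))" by unfold_locales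
    show "sets (distr M borel X \<Otimes>\<^sub>M distr M S (\<lambda>\<omega>. g (V \<omega>))) = sets (distr M (borel \<Otimes>\<^sub>M S) (\<lambda>\<omega>. (X \<omega>, g (V \<omega>))))"
      by (simp cong: sets_pair_measure_cong)
    fix A B assume "A \<in> sets (distr M borel X)" "B \<in> sets (distr M S (\<lambda>\<omega>. g (V \<omega>)))"
    then have [measurable]: "A \<in> sets borel" "B \<in> sets S" by auto
    define E where "E = g -` B \<inter> space (Pi\<^sub>M J (\<lambda>_. borel))"
    have [measurable]: "E \<in> sets (Pi\<^sub>M J (\<lambda>_. borel))" unfolding E_def by measurable
    have VE: "V -` E \<inter> space M = (\<lambda>\<omega>. g (V \<omega>)) -` B \<inter> space M"
      using measurable_space[of V M "Pi\<^sub>M J (\<lambda>_. borel)"] by (auto simp: E_def)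
    have "(\<lambda>\<omega>. (X \<omega>, g (V \<omega>))) -` (A \<times> B) \<inter> space M = X -` A \<inter> V -` E \<inter> space M"
      using VE by auto
    then show "emeasure (distr M borel X) A * emeasure (distr M S (\<lambda>\<omega>. g (V \<omega>))) B =
         emeasure (distr M (borel \<Otimes>\<^sub>M S) (\<lambda>\<omega>. (X \<omega>, g (V \<omega>)))) (A \<times> B)"
      using ind[of A E] VE by (simp add: emeasure_distr)
  qed
  then show ?thesis unfolding V_def .
qed

section \<open>Weakly null sequences and total variation\<close>

text \<open>
  Otherwise a signed sum \<open>G\<close> of \<open>N\<close> almost orthogonal members would satisfy \<open>N * \<epsilon> \<le> E (Z * G)\<close>,
  although its \<open>L\<^sup>2\<close> norm is only of order \<open>sqrt N\<close>.
\<close>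

lemma (in prob_space) almost_orthogonal_imp_weakly_null:
  fixes f :: "nat \<Rightarrow> 'a \<Rightarrow> real" and Z :: "'a \<Rightarrow> real"
  assumes f[measurable]: "\<And>n. f n \<in> borel_measurable M" and fC: "\<And>n \<omega>. \<bar>f n \<omega>\<bar> \<le> C"
    and orth: "\<And>k. (\<lambda>n. expectation (\<lambda>\<omega>. f n \<omega> * f k \<omega>)) \<longlonglongrightarrow> 0"
    and Z[measurable]: "Z \<in> borel_measurable M" and ZD: "\<And>\<omega>. \<omega> \<in> space M \<Longrightarrow> \<bar>Z \<omega>\<bar> \<le> D"
  shows "(\<lambda>n. expectation (\<lambda>\<omega>. Z \<omega> * f n \<omega>)) \<longlonglongrightarrow> 0"
proof (rule ccontr)
  assume "\<not> ?thesis"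
  then obtain \<epsilon> where \<epsilon>: "0 < \<epsilon>" "\<exists>\<^sub>F n in sequentially. \<epsilon> \<le> \<bar>expectation (\<lambda>\<omega>. Z \<omega> * f n \<omega>)\<bar>"
    unfolding tendsto_iff by (auto simp: not_eventually not_less dist_real_def)
  define D' where "D' = \<bar>D\<bar> + 1"
  have D': "0 < D'" "\<And>\<omega>. \<omega> \<in> space M \<Longrightarrow> \<bar>Z \<omega>\<bar> \<le> D'" using ZD by (force simp: D'_def)+
  have C0: "0 \<le> C" using order_trans[OF abs_ge_zero fC] .
  \<comment> \<open>Half of what the contradiction can afford: the off-diagonal terms, at most N^2
    times \<open>\<delta>\<close>, take half of N^2 times
    \<open>\<epsilon>\<^sup>2 / D'\<^sup>2\<close>.\<close>
  define \<delta> where "\<delta> = \<epsilon>\<^sup>2 / (2 * D'\<^sup>2)"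
  have \<delta>: "0 < \<delta>" using \<epsilon> D' by (simp add: \<delta>_def)
  have sq: "x * x \<le> c * c" if "\<bar>x\<bar> \<le> c" for x c :: real
    using power_mono[OF that, of 2] by (simp add: power2_eq_square)
  have iff: "integrable M (\<lambda>\<omega>. f n \<omega> * f k \<omega>)" for n k
    by (rule integrable_const_bound[where B = "C * C"]) (use fC C0 in \<open>auto simp: abs_mult intro!: mult_mono\<close>)
  have iZf: "integrable M (\<lambda>\<omega>. Z \<omega> * f n \<omega>)" for n
    by (rule integrable_const_bound[where B = "D' * C"]) (use fC D' C0 in \<open>auto simp: abs_mult intro!: mult_mono AE_I2\<close>)
  \<comment> \<open>A greedy choice. \<open>orth\<close> controls a correlation only for one index
    tending to infinity with the other fixed, so each new index is taken far beyond the finitely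
    many already chosen.\<close>
  have S_ex: "\<exists>S. finite S \<and> card S = N \<and> (\<forall>n\<in>S. \<epsilon> \<le> \<bar>expectation (\<lambda>\<omega>. Z \<omega> * f n \<omega>)\<bar>)
     \<and> (\<forall>n\<in>S. \<forall>k\<in>S. n \<noteq> k \<longrightarrow> \<bar>expectation (\<lambda>\<omega>. f n \<omega> * f k \<omega>)\<bar> \<le> \<delta>)" for N
  proof (induction N)
    case 0
    then show ?case by (intro exI[of _ "{}"]) auto
  next
    case (Suc N)
    then obtain S where S: "finite S" "card S = N" "\<forall>n\<in>S. \<epsilon> \<le> \<bar>expectation (\<lambda>\<omega>. Z \<omega> * f n \<omega>)\<bar>"
     "\<forall>n\<in>S. \<forall>k\<in>S. n \<noteq> k \<longrightarrow> \<bar>expectation (\<lambda>\<omega>. f n \<omega> * f k \<omega>)\<bar> \<le> \<delta>" by blast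
    have "\<forall>\<^sub>F n in sequentially. \<forall>k\<in>S. \<bar>expectation (\<lambda>\<omega>. f n \<omega> * f k \<omega>)\<bar> < \<delta>"
      unfolding eventually_ball_finite_distrib[OF S(1)]
      using orth \<delta> unfolding tendsto_iff by (auto simp: dist_real_def)
    then have "\<forall>\<^sub>F n in sequentially. (\<forall>k\<in>S. \<bar>expectation (\<lambda>\<omega>. f n \<omega> * f k \<omega>)\<bar> < \<delta>) \<and> n \<notin> S"
      by (rule eventually_elim2[OF _ eventually_gt_at_top[of "Max S"]]) (use S(1) Max_ge leD in blast)
    from frequently_eventually_frequently[OF \<epsilon>(2) this, THEN frequently_ex]
    obtain n where n: "\<epsilon> \<le> \<bar>expectation (\<lambda>\<omega>. Z \<omega> * f n \<omega>)\<bar>"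
      "\<forall>k\<in>S. \<bar>expectation (\<lambda>\<omega>. f n \<omega> * f k \<omega>)\<bar> < \<delta>" "n \<notin> S" by blast
    have sym: "expectation (\<lambda>\<omega>. f i \<omega> * f k \<omega>) = expectation (\<lambda>\<omega>. f k \<omega> * f i \<omega>)" for i k
      by (intro Bochner_Integration.integral_cong) (auto simp: mult.commute)
    show ?case
    proof (intro exI[of _ "insert n S"] conjI ballI impI)
      fix i k assume ik: "i \<in> insert n S" "k \<in> insert n S" "i \<noteq> k"
      then consider "i \<in> S" "k \<in> S" | "i = n" "k \<in> S" | "k = n" "i \<in> S" by blast
      then show "\<bar>expectation (\<lambda>\<omega>. f i \<omega> * f k \<omega>)\<bar> \<le> \<delta>"
      proof cases
        case 1
        then show ?thesis using S(4) ik(3) by blast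
      next
        case 2
        then show ?thesis using n(2) less_imp_le by blast
      next
        case 3
        then have "\<bar>expectation (\<lambda>\<omega>. f k \<omega> * f i \<omega>)\<bar> < \<delta>" using n(2) by blast
        then show ?thesis unfolding sym[of i k] by linarith
      qed
    next
      fix i assume "i \<in> insert n S"
      then show "\<epsilon> \<le> \<bar>expectation (\<lambda>\<omega>. Z \<omega> * f i \<omega>)\<bar>" using S(3) n(1) by blast
    qed (use S(1,2) n(3) in simp_all)
  qed
  obtain N :: nat where N: "2 * D'\<^sup>2 * C\<^sup>2 / \<epsilon>\<^sup>2 < real N" using reals_Archimedean2 by blast
  from S_ex[of N] obtain S where S: "finite S" "card S = N" "\<forall>n\<in>S. \<epsilon> \<le> \<bar>expectation (\<lambda>\<omega>. Z \<omega> * f n \<omega>)\<bar>"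
     "\<forall>n\<in>S. \<forall>k\<in>S. n \<noteq> k \<longrightarrow> \<bar>expectation (\<lambda>\<omega>. f n \<omega> * f k \<omega>)\<bar> \<le> \<delta>" by blast
  define \<theta> where "\<theta> n = sgn (expectation (\<lambda>\<omega>. Z \<omega> * f n \<omega>))" for n
  have \<theta>1: "\<bar>\<theta> n\<bar> \<le> 1" for n by (simp add: \<theta>_def sgn_if)
  define G where "G \<omega> = (\<Sum>n\<in>S. \<theta> n * f n \<omega>)" for \<omega>
  \<comment> \<open>The minimizer in \<open>t\<close> of the quadratic upper bound for the second
    moment of \<open>G - t * Z\<close> below, as in the proof of the Cauchy-Schwarz
    inequality.\<close>
  define t where "t = real N * \<epsilon> / D'\<^sup>2"
  have N0: "0 < real N" using N C0 \<epsilon> D' by (intro le_less_trans[OF _ N]) auto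
  have t0: "0 < t" using N0 \<epsilon> D' by (simp add: t_def)
  have GG: "(G \<omega>)\<^sup>2 = (\<Sum>n\<in>S. \<Sum>k\<in>S. (\<theta> n * \<theta> k) * (f n \<omega> * f k \<omega>))" for \<omega>
    by (simp add: G_def power2_eq_square sum_product mult_ac)
  have ZG: "Z \<omega> * G \<omega> = (\<Sum>n\<in>S. \<theta> n * (Z \<omega> * f n \<omega>))" for \<omega>
    by (simp add: G_def sum_distrib_left mult.left_commute)
  have iG2: "integrable M (\<lambda>\<omega>. (G \<omega>)\<^sup>2)"
    unfolding GG by (intro Bochner_Integration.integrable_sum integrable_mult_right iff)
  have iZG: "integrable M (\<lambda>\<omega>. Z \<omega> * G \<omega>)"
    unfolding ZG by (intro Bochner_Integration.integrable_sum integrable_mult_right iZf)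
  have EG: "expectation (\<lambda>\<omega>. (G \<omega>)\<^sup>2) \<le> real N * C\<^sup>2 + (real N)\<^sup>2 * \<delta>"
  proof -
    have "expectation (\<lambda>\<omega>. (G \<omega>)\<^sup>2) = (\<Sum>n\<in>S. \<Sum>k\<in>S. (\<theta> n * \<theta> k) * expectation (\<lambda>\<omega>. f n \<omega> * f k \<omega>))"
      unfolding GG using iff by (simp add: Bochner_Integration.integral_sum)
    also have "\<dots> \<le> (\<Sum>n\<in>S. \<Sum>k\<in>S. (if n = k then C\<^sup>2 else 0) + \<delta>)"
    proof (intro sum_mono)
      fix n k assume nk: "n \<in> S" "k \<in> S"
      have \<theta>2: "\<bar>\<theta> n * \<theta> k\<bar> \<le> 1" using \<theta>1[of n] \<theta>1[of k] by (simp add: abs_mult mult_le_one)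
      have "(\<theta> n * \<theta> k) * expectation (\<lambda>\<omega>. f n \<omega> * f k \<omega>) \<le> \<bar>\<theta> n * \<theta> k\<bar> * \<bar>expectation (\<lambda>\<omega>. f n \<omega> * f k \<omega>)\<bar>"
        by (metis abs_ge_self abs_mult)
      also have "\<dots> \<le> \<bar>expectation (\<lambda>\<omega>. f n \<omega> * f k \<omega>)\<bar>" using \<theta>2 by (intro mult_left_le_one_le) auto
      also have "\<dots> \<le> (if n = k then C\<^sup>2 else 0) + \<delta>"
      proof (cases "n = k")
        case True
        have "0 \<le> expectation (\<lambda>\<omega>. f n \<omega> * f k \<omega>)" using True by (intro integral_nonneg_AE) auto
        moreover have "expectation (\<lambda>\<omega>. f n \<omega> * f k \<omega>) \<le> C * C"
          unfolding True by (intro integral_le_const AE_I2 iff sq fC)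
        ultimately show ?thesis using True \<delta> by (simp add: power2_eq_square)
      qed (use S(4) nk in auto)
      finally show "(\<theta> n * \<theta> k) * expectation (\<lambda>\<omega>. f n \<omega> * f k \<omega>) \<le> (if n = k then C\<^sup>2 else 0) + \<delta>" .
    qed
    also have "\<dots> = real N * C\<^sup>2 + (real N)\<^sup>2 * \<delta>"
      using S(1,2) by (simp add: sum.distrib sum.delta power2_eq_square algebra_simps)
    finally show ?thesis .
  qed
  have EZG: "real N * \<epsilon> \<le> expectation (\<lambda>\<omega>. Z \<omega> * G \<omega>)"
  proof -
    have "expectation (\<lambda>\<omega>. Z \<omega> * G \<omega>) = (\<Sum>n\<in>S. \<theta> n * expectation (\<lambda>\<omega>. Z \<omega> * f n \<omega>))"
      unfolding ZG using iZf by (simp add: Bochner_Integration.integral_sum)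
    also have "\<dots> = (\<Sum>n\<in>S. \<bar>expectation (\<lambda>\<omega>. Z \<omega> * f n \<omega>)\<bar>)"
      by (simp add: \<theta>_def abs_sgn mult.commute)
    finally show ?thesis using sum_mono[of S "\<lambda>_. \<epsilon>", OF S(3)[rule_format]] S(2) by simp
  qed
  have iZ2: "integrable M (\<lambda>\<omega>. (Z \<omega>)\<^sup>2)"
    unfolding power2_eq_square
    by (rule integrable_const_bound[where B = "D' * D'"]) (use sq D' in auto)
  have EZ: "expectation (\<lambda>\<omega>. (Z \<omega>)\<^sup>2) \<le> D'\<^sup>2"
    using iZ2 unfolding power2_eq_square by (intro integral_le_const AE_I2 sq D')
  have "0 \<le> expectation (\<lambda>\<omega>. (G \<omega> - t * Z \<omega>)\<^sup>2)" by (intro integral_nonneg_AE) auto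
  also have "\<dots> = expectation (\<lambda>\<omega>. (G \<omega>)\<^sup>2 - 2 * t * (Z \<omega> * G \<omega>) + t\<^sup>2 * (Z \<omega>)\<^sup>2)"
    by (simp add: power2_eq_square algebra_simps)
  also have "\<dots> = expectation (\<lambda>\<omega>. (G \<omega>)\<^sup>2) - 2 * t * expectation (\<lambda>\<omega>. Z \<omega> * G \<omega>) + t\<^sup>2 * expectation (\<lambda>\<omega>. (Z \<omega>)\<^sup>2)"
    using iG2 iZG iZ2 by simp
  also have "\<dots> \<le> (real N * C\<^sup>2 + (real N)\<^sup>2 * \<delta>) - 2 * t * (real N * \<epsilon>) + t\<^sup>2 * D'\<^sup>2"
    using EG EZG EZ t0 by (intro add_mono diff_mono mult_left_mono) auto
  also have "t\<^sup>2 * D'\<^sup>2 = t * (real N * \<epsilon>)" using D' by (simp add: t_def power2_eq_square)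
  finally have "t * (real N * \<epsilon>) \<le> real N * C\<^sup>2 + (real N)\<^sup>2 * \<delta>" by (simp add: mult_ac)
  then have "real N * (real N * \<epsilon>\<^sup>2 / D'\<^sup>2) \<le> real N * (C\<^sup>2 + real N * \<delta>)"
    by (simp add: t_def power2_eq_square algebra_simps)
  then have "real N * \<epsilon>\<^sup>2 / D'\<^sup>2 \<le> C\<^sup>2 + real N * \<delta>" by (simp only: mult_le_cancel_left_pos[OF N0])
  then have "real N * \<epsilon>\<^sup>2 \<le> 2 * D'\<^sup>2 * C\<^sup>2" using D' \<epsilon> by (simp add: \<delta>_def field_simps)
  then show False using N \<epsilon> by (simp add: field_simps)
qed

text \<open>One \<open>b\<close> serves every Lipschitz constant \<open>K\<close>. This lets
  truncated multiples of the distance to the complement increase to the indicator of an open set;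
  outer regularity then reaches all Borel sets.\<close>

lemma tv_bound_of_lipschitz_tests:
  fixes \<mu> \<nu> :: "real measure"
  assumes \<mu>: "real_distribution \<mu>" and \<nu>: "real_distribution \<nu>"
    and test: "\<And>f K. (\<And>x y. \<bar>f x - f y\<bar> \<le> K * \<bar>x - y\<bar>) \<Longrightarrow> (\<And>x. 0 \<le> f x) \<Longrightarrow> (\<And>x. f x \<le> 1) \<Longrightarrow>
       f \<in> borel_measurable borel \<Longrightarrow> \<bar>(\<integral>x. f x \<partial>\<mu>) - (\<integral>x. f x \<partial>\<nu>)\<bar> \<le> b"
    and A: "A \<in> sets borel"
  shows "\<bar>measure \<mu> A - measure \<nu> A\<bar> \<le> b"
proof -
  interpret \<mu>: real_distribution \<mu> by fact
  interpret \<nu>: real_distribution \<nu> by fact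
  have b0: "0 \<le> b" using test[of "\<lambda>_. 0" 0] by simp
  have opn: "\<bar>measure \<mu> U - measure \<nu> U\<bar> \<le> b" if U: "open U" for U :: "real set"
  \<comment> \<open>The distance to the empty set is 0 by convention, so the functions below do not
    approximate the indicator of the whole line.\<close>
  proof (cases "U = UNIV")
    case True
    then show ?thesis using \<mu>.prob_space \<nu>.prob_space b0 by simp
  next
    case False
    define f where "f k x = min 1 (real k * infdist x (- U))" for k x
    have [measurable]: "f k \<in> borel_measurable borel" for k
      unfolding f_def[abs_def] by (intro borel_measurable_continuous_onI continuous_intros)
    have f01: "0 \<le> f k x" "f k x \<le> 1" for k x by (auto simp: f_def infdist_nonneg)
    have lip: "\<bar>f k x - f k y\<bar> \<le> real k * \<bar>x - y\<bar>" for k x y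
    proof -
      have "\<bar>f k x - f k y\<bar> \<le> \<bar>real k * infdist x (- U) - real k * infdist y (- U)\<bar>"
        unfolding f_def by linarith
      also have "\<dots> = real k * \<bar>infdist x (- U) - infdist y (- U)\<bar>"
        by (simp add: right_diff_distrib[symmetric] abs_mult)
      also have "\<dots> \<le> real k * \<bar>x - y\<bar>"
        using infdist_triangle_abs[of x "- U" y] by (intro mult_left_mono) (auto simp: dist_real_def)
      finally show ?thesis .
    qed
    have lim: "(\<lambda>k. f k x) \<longlonglongrightarrow> indicator U x" for x
    proof (cases "x \<in> U")
      case True
      then have "0 < infdist x (- U)" using U False
        by (intro infdist_pos_not_in_closed) auto
      then have "\<forall>\<^sub>F k in sequentially. f k x = indicator U x"
        using eventually_ge_at_top[of "nat \<lceil>1 / infdist x (- U)\<rceil>"] True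
        by (auto elim!: eventually_mono simp: f_def min_def field_simps ceiling_le_iff nat_le_iff)
      then show ?thesis by (simp add: tendsto_eventually)
    qed (simp add: f_def)
    have "(\<lambda>k. \<integral>x. f k x \<partial>\<mu>) \<longlonglongrightarrow> (\<integral>x. indicator U x \<partial>\<mu>)" 
      by (rule integral_dominated_convergence[where w = "\<lambda>_. 1"]) (use U lim f01 in auto)
    moreover have "(\<lambda>k. \<integral>x. f k x \<partial>\<nu>) \<longlonglongrightarrow> (\<integral>x. indicator U x \<partial>\<nu>)"
      by (rule integral_dominated_convergence[where w = "\<lambda>_. 1"]) (use U lim f01 in auto)
    ultimately have "(\<lambda>k. \<bar>(\<integral>x. f k x \<partial>\<mu>) - (\<integral>x. f k x \<partial>\<nu>)\<bar>) \<longlonglongrightarrow> \<bar>measure \<mu> U - measure \<nu> U\<bar>"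
      using U by (intro tendsto_rabs tendsto_diff) auto
    then show ?thesis
      by (rule LIMSEQ_le_const2) (use test[OF lip f01] in auto)
  qed
  have reg: "\<exists>U. open U \<and> A \<subseteq> U \<and> measure \<rho> U \<le> measure \<rho> A + e"
    if \<rho>: "real_distribution \<rho>" and e: "0 < e" for \<rho> :: "real measure" and e :: real
  proof -
    interpret \<rho>: real_distribution \<rho> by fact
    have "(INF U \<in> {U. A \<subseteq> U \<and> open U}. emeasure \<rho> U) < ennreal (measure \<rho> A + e)"
    proof -
      have "emeasure \<rho> A = (INF U \<in> {U. A \<subseteq> U \<and> open U}. emeasure \<rho> U)"
        by (rule outer_regular) (use A in auto)
      moreover have "emeasure \<rho> A < ennreal (measure \<rho> A + e)"
        using e by (simp add: \<rho>.emeasure_eq_measure ennreal_less_iff)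
      ultimately show ?thesis by simp
    qed
    then obtain U where U: "A \<subseteq> U" "open U" "emeasure \<rho> U < ennreal (measure \<rho> A + e)"
      unfolding INF_less_iff by blast
    have "measure \<rho> U < measure \<rho> A + e"
      using U(3) by (simp add: \<rho>.emeasure_eq_measure ennreal_less_iff)
    then show ?thesis using U by (intro exI[of _ U]) auto
  qed
  show ?thesis
  proof (rule field_le_epsilon)
    fix e :: real assume e: "0 < e"
    obtain U where U: "open U" "A \<subseteq> U" "measure \<mu> U \<le> measure \<mu> A + e" using reg[OF \<mu> e] by blast
    obtain V where V: "open V" "A \<subseteq> V" "measure \<nu> V \<le> measure \<nu> A + e" using reg[OF \<nu> e] by blast
    \<comment> \<open>The intersection is a single open set that is close to \<open>A\<close> for
      both measures.\<close>
    have "\<bar>measure \<mu> (U \<inter> V) - measure \<nu> (U \<inter> V)\<bar> \<le> b" using U V by (intro opn) auto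
    moreover have "measure \<mu> A \<le> measure \<mu> (U \<inter> V)" "measure \<mu> (U \<inter> V) \<le> measure \<mu> U"
      using U V A by (auto intro!: \<mu>.finite_measure_mono)
    moreover have "measure \<nu> A \<le> measure \<nu> (U \<inter> V)" "measure \<nu> (U \<inter> V) \<le> measure \<nu> V"
      using U V A by (auto intro!: \<nu>.finite_measure_mono)
    ultimately show "\<bar>measure \<mu> A - measure \<nu> A\<bar> \<le> b + e" using U V by linarith
  qed
qed

section \<open>Power laws on the unit interval and their grids\<close>

text \<open>Mean value theorem: for exponents from 1 on, the derivative stays bounded down to 0. It
  is used with \<open>a = 2 * H\<close>.\<close>

lemma powr_lipschitz_01:
  fixes x y a :: real
  assumes "0 \<le> x" "x \<le> 1" "0 \<le> y" "y \<le> 1" "1 \<le> a" "a \<le> 2"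
  shows "\<bar>x powr a - y powr a\<bar> \<le> 2 * \<bar>x - y\<bar>"
proof -
  have *: "\<bar>x powr a - y powr a\<bar> \<le> 2 * \<bar>x - y\<bar>" if "0 \<le> x" "x < y" "y \<le> 1" for x y :: real
  proof (cases "x = 0")
    case True
    then have "y powr a \<le> y powr 1" using that assms by (intro powr_mono') auto
    then show ?thesis using True that by simp
  next
    case False
    then have x: "0 < x" using that by simp
    have "\<exists>z. x < z \<and> z < y \<and> y powr a - x powr a = (y - x) * (a * z powr (a - 1))"
      using x that by (intro MVT2) (auto intro!: derivative_eq_intros simp: powr_diff)
    then obtain z where z: "x < z" "z < y" "y powr a - x powr a = (y - x) * (a * z powr (a - 1))" by blast
    have "z powr (a - 1) \<le> 1" using z x that assms by (intro powr_le1) auto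
    then have "a * z powr (a - 1) \<le> 2 * 1" using assms by (intro mult_mono) auto
    then have "(y - x) * (a * z powr (a - 1)) \<le> (y - x) * 2" using that by (intro mult_left_mono) auto
    moreover have "0 \<le> (y - x) * (a * z powr (a - 1))" using that assms by (intro mult_nonneg_nonneg) auto
    ultimately show ?thesis using z that by (simp add: abs_if)
  qed
  show ?thesis
    using *[of x y] *[of y x] assms by (cases x y rule: linorder_cases) (auto simp: abs_minus_commute)
qed

text \<open>For \<open>n\<close> at least 1 this is the Beta(n, 1) law. It absorbs one factor
  \<open>n\<close>, which leaves \<open>n powr H / 2\<close> in front of the integral of B_1^2 -
  B_t^2 in the functional.\<close>

definition power_law :: "nat \<Rightarrow> real measure" where
  "power_law n = density lborel (\<lambda>t. indicator {0..1} t * (real n * t ^ (n - 1)))"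

text \<open>The mass that \<open>power_law n\<close> gives to the cell \<open>((i - 1) / m, i / m]\<close>.\<close>

definition grid_weight :: "nat \<Rightarrow> nat \<Rightarrow> nat \<Rightarrow> real" where
  "grid_weight n m i = (real i / real m) ^ n - ((real i - 1) / real m) ^ n"

lemma sets_power_law[simp, measurable_cong]: "sets (power_law n) = sets borel"
  by (simp add: power_law_def)

lemma space_power_law[simp]: "space (power_law n) = UNIV"
  by (simp add: power_law_def)

lemma grid_weight_nonneg: "1 \<le> i \<Longrightarrow> 0 \<le> grid_weight n m i"
  by (auto simp: grid_weight_def intro!: power_mono divide_right_mono)

lemma integral_power_law:
  assumes "f \<in> borel_measurable borel"
  shows "(\<integral>t. f t \<partial>power_law n) = (\<integral>t. indicator {0..1} t * (real n * t ^ (n - 1) * f t) \<partial>lborel)"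
  using assms unfolding power_law_def
  by (subst integral_density) (auto simp: mult_ac split: split_indicator)

lemma emeasure_power_law_Ioc:
  assumes "1 \<le> n" "0 \<le> c" "c \<le> d" "d \<le> 1"
  shows "emeasure (power_law n) {c<..d} = ennreal (d ^ n - c ^ n)"
proof -
  have "emeasure (power_law n) {c<..d} = (\<integral>\<^sup>+t. ennreal (real n * t ^ (n - 1)) * indicator {c..d} t \<partial>lborel)"
    unfolding power_law_def
    by (subst emeasure_density, simp, simp, intro nn_integral_cong_AE AE_I[where N = "{c}"])
      (use assms in \<open>auto split: split_indicator simp: indicator_def\<close>)
  also have "\<dots> = ennreal (d ^ n - c ^ n)"
    by (rule nn_integral_FTC_Icc) (use assms in \<open>auto intro!: derivative_eq_intros\<close>)
  finally show ?thesis .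
qed

lemma prob_space_power_law:
  assumes "1 \<le> n"
  shows "prob_space (power_law n)"
proof
  have "emeasure (power_law n) (space (power_law n)) = emeasure (power_law n) {0<..1}"
    unfolding power_law_def
    by (subst (1 2) emeasure_density, simp, simp, simp, simp, intro nn_integral_cong_AE AE_I[where N = "{0}"])
      (auto split: split_indicator simp: indicator_def)
  then show "emeasure (power_law n) (space (power_law n)) = 1"
    using emeasure_power_law_Ioc[of n 0 1] assms by simp
qed

lemma AE_power_law: "AE t in power_law n. 0 < t \<and> t \<le> 1"
  unfolding power_law_def
  by (subst AE_density, simp, rule AE_I[where N = "{0}"]) (auto simp: indicator_def)

text \<open>A cell is closed on the right and represented by its right endpoint. The representative
  is therefore never below t, which later bounds 1 - i/m by 1 - t without a mesh error. The point t
  = 0 falls outside all cells but is a null set.\<close>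

lemma grid_index:
  fixes t :: real
  assumes "0 < t" "t \<le> 1" "1 \<le> m"
  shows "nat \<lceil>real m * t\<rceil> \<in> {1..m}" "t \<le> real (nat \<lceil>real m * t\<rceil>) / real m"
    "real (nat \<lceil>real m * t\<rceil>) / real m - t \<le> 1 / real m" "real (nat \<lceil>real m * t\<rceil>) / real m \<le> 1"
proof -
  have m: "0 < real m" using assms by simp
  have pos: "0 < \<lceil>real m * t\<rceil>" using assms by simp
  have ub: "\<lceil>real m * t\<rceil> \<le> int m" using mult_left_mono[OF assms(2), of "real m"] by (simp add: ceiling_le_iff)
  then have "1 \<le> nat \<lceil>real m * t\<rceil>" "nat \<lceil>real m * t\<rceil> \<le> m" using pos by linarith+
  then show "nat \<lceil>real m * t\<rceil> \<in> {1..m}" by simp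
  have r: "real (nat \<lceil>real m * t\<rceil>) = of_int \<lceil>real m * t\<rceil>" using pos by simp
  show "t \<le> real (nat \<lceil>real m * t\<rceil>) / real m"
    using m le_of_int_ceiling[of "real m * t"] unfolding r by (simp add: field_simps)
  show "real (nat \<lceil>real m * t\<rceil>) / real m - t \<le> 1 / real m"
  proof -
    have "of_int \<lceil>real m * t\<rceil> \<le> real m * t + 1" using ceiling_correct[of "real m * t"] by linarith
    then have "of_int \<lceil>real m * t\<rceil> / real m \<le> (real m * t + 1) / real m" by (rule divide_right_mono) simp
    also have "\<dots> = t + 1 / real m" using m by (simp add: add_divide_distrib)
    finally show ?thesis unfolding r by simp
  qed
  show "real (nat \<lceil>real m * t\<rceil>) / real m \<le> 1"
    using m ub unfolding r by (simp add: field_simps)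
qed

lemma grid_index_eq_iff:
  fixes t :: real
  assumes "0 < t" "t \<le> 1" "1 \<le> m" "1 \<le> i"
  shows "nat \<lceil>real m * t\<rceil> = i \<longleftrightarrow> t \<in> {(real i - 1) / real m<..real i / real m}"
proof -
  have m: "0 < real m" using assms by simp
  have "nat \<lceil>real m * t\<rceil> = i \<longleftrightarrow> \<lceil>real m * t\<rceil> = int i" using assms by auto
  also have "\<dots> \<longleftrightarrow> real i - 1 < real m * t \<and> real m * t \<le> real i" by (simp add: ceiling_eq_iff)
  finally show ?thesis using m by (simp add: field_simps)
qed

text \<open>A grid sum is the exact integral of a step function against \<open>power_law n\<close>,
  so sums and integrals can be compared pointwise under one probability measure.\<close>

lemma integral_grid_index:
  fixes f :: "nat \<Rightarrow> real"
  assumes n: "1 \<le> n" and m: "1 \<le> m"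
  shows "(\<integral>t. f (nat \<lceil>real m * t\<rceil>) \<partial>power_law n) = (\<Sum>i=1..m. grid_weight n m i * f i)"
proof -
  interpret prob_space "power_law n" by (rule prob_space_power_law[OF n])
  let ?I = "\<lambda>i. {(real i - 1) / real m<..real i / real m}"
  have "(\<integral>t. f (nat \<lceil>real m * t\<rceil>) \<partial>power_law n) = (\<integral>t. (\<Sum>i=1..m. indicator (?I i) t * f i) \<partial>power_law n)"
  proof (intro integral_cong_AE)
    show "AE t in power_law n. f (nat \<lceil>real m * t\<rceil>) = (\<Sum>i=1..m. indicator (?I i) t * f i)"
      using AE_power_law
    proof eventually_elim
      case (elim t)
      have "indicator (?I i) t * f i = (if nat \<lceil>real m * t\<rceil> = i then f i else 0)" if "i \<in> {1..m}" for i
        using grid_index_eq_iff[of t m i] elim m that by (auto simp: indicator_def)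
      then have "(\<Sum>i=1..m. indicator (?I i) t * f i) = (\<Sum>i=1..m. if nat \<lceil>real m * t\<rceil> = i then f i else 0)"
        by (intro sum.cong) auto
      also have "\<dots> = f (nat \<lceil>real m * t\<rceil>)" using grid_index(1)[of t m] elim m by simp
      finally show ?case by simp
    qed
  qed measurable
  also have "\<dots> = (\<Sum>i=1..m. (\<integral>t. indicator (?I i) t * f i \<partial>power_law n))"
    by (intro Bochner_Integration.integral_sum) (auto intro!: integrable_real_mult_indicator simp: emeasure_eq_measure)
  also have "\<dots> = (\<Sum>i=1..m. grid_weight n m i * f i)"
  proof (intro sum.cong refl)
    fix i assume i: "i \<in> {1..m}"
    have "emeasure (power_law n) (?I i) = ennreal (grid_weight n m i)"
      unfolding grid_weight_def using i m n
      by (intro emeasure_power_law_Ioc) (auto simp: field_simps)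
    then have "measure (power_law n) (?I i) = grid_weight n m i"
      using grid_weight_nonneg[of i n m] i by (simp add: measure_def)
    then show "(\<integral>t. indicator (?I i) t * f i \<partial>power_law n) = grid_weight n m i * f i"
      by simp
  qed
  finally show ?thesis .
qed

lemma sum_grid_weight:
  assumes "1 \<le> n" "1 \<le> m"
  shows "(\<Sum>i=1..m. grid_weight n m i) = 1"
proof -
  interpret prob_space "power_law n" by (rule prob_space_power_law[OF assms(1)])
  show ?thesis using integral_grid_index[OF assms, of "\<lambda>_. 1"] prob_space by simp
qed

lemma grid_sum_approx:
  fixes F :: "real \<Rightarrow> real"
  assumes n: "1 \<le> n" and m: "1 \<le> m" and [measurable]: "F \<in> borel_measurable borel"
    and bnd: "\<And>t. 0 < t \<Longrightarrow> t \<le> 1 \<Longrightarrow> \<bar>F t\<bar> \<le> C"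
    and appr: "\<And>t. 0 < t \<Longrightarrow> t \<le> 1 \<Longrightarrow> \<bar>v (nat \<lceil>real m * t\<rceil>) - F t\<bar> \<le> e"
  shows "\<bar>(\<Sum>i=1..m. grid_weight n m i * v i) - (\<integral>t. F t \<partial>power_law n)\<bar> \<le> e"
proof -
  interpret prob_space "power_law n" by (rule prob_space_power_law[OF n])
  have iF: "integrable (power_law n) F"
    by (rule integrable_const_bound[where B = C]) (use AE_power_law in eventually_elim, auto intro: bnd)
  have iv: "integrable (power_law n) (\<lambda>t. v (nat \<lceil>real m * t\<rceil>))"
  proof (rule integrable_const_bound[where B = "Max ((\<lambda>i. \<bar>v i\<bar>) ` {1..m})"])
    show "AE t in power_law n. norm (v (nat \<lceil>real m * t\<rceil>)) \<le> Max ((\<lambda>i. \<bar>v i\<bar>) ` {1..m})"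
      using AE_power_law by eventually_elim (use grid_index(1) m in \<open>auto intro!: Max_ge imageI simp del: atLeastAtMost_iff\<close>)
  qed measurable
  have "\<bar>(\<Sum>i=1..m. grid_weight n m i * v i) - (\<integral>t. F t \<partial>power_law n)\<bar>
     = \<bar>(\<integral>t. v (nat \<lceil>real m * t\<rceil>) - F t \<partial>power_law n)\<bar>"
    unfolding integral_grid_index[OF n m, symmetric] using iF iv by simp
  also have "\<dots> \<le> (\<integral>t. \<bar>v (nat \<lceil>real m * t\<rceil>) - F t\<bar> \<partial>power_law n)" by (rule integral_abs_bound)
  also have "\<dots> \<le> e"
    using iF iv by (intro integral_le_const) (auto intro!: AE_mp[OF AE_power_law AE_I2] appr)
  finally show ?thesis .
qed

section \<open>Exact moments of the power laws\<close>

lemma integral_power_law_of_has_integral: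
  assumes [measurable]: "f \<in> borel_measurable borel"
    and nonneg: "\<And>t. t \<in> {0..1} \<Longrightarrow> 0 \<le> f t"
    and hi: "(g has_integral I) {0..1}"
    and eq: "\<And>t. 0 < t \<Longrightarrow> t \<le> 1 \<Longrightarrow> g t = real n * t ^ (n - 1) * f t"
  shows "(\<integral>t. f t \<partial>power_law n) = I"
proof -
  \<comment> \<open>The point 0 is exempt because \<open>t powr (real n - 1)\<close> and
    \<open>t ^ (n - 1)\<close> differ there when n = 1: \<open>0 powr 0\<close> is 0, but
    \<open>0 ^ 0\<close> is 1.\<close>
  have hi': "((\<lambda>t. real n * t ^ (n - 1) * f t) has_integral I) {0..1}"
    by (rule has_integral_spike[OF negligible_sing[of 0] _ hi]) (auto simp: eq)
  have I0: "0 \<le> I" by (rule has_integral_nonneg[OF hi']) (use nonneg in auto)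
  have nn: "(\<integral>\<^sup>+t. ennreal (indicator {0..1} t * (real n * t ^ (n - 1) * f t)) \<partial>lborel) = ennreal I"
    using nn_integral_has_integral_lebesgue[OF _ hi'] nonneg by auto
  have "(\<integral>t. f t \<partial>power_law n) = (\<integral>t. indicator {0..1} t * (real n * t ^ (n - 1) * f t) \<partial>lborel)"
    by (rule integral_power_law) simp
  also have "\<dots> = enn2real (ennreal I)"
    unfolding nn[symmetric] by (rule integral_eq_nn_integral) (use nonneg in \<open>auto split: split_indicator\<close>)
  finally show ?thesis using I0 by simp
qed

lemma power_law_beta_moment:
  fixes a :: real
  assumes n: "1 \<le> n" and a: "0 \<le> a"
  shows "(\<integral>t. (1 - t) powr a \<partial>power_law n) = real n * Beta (real n) (a + 1)"
proof (rule integral_power_law_of_has_integral)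
  show "((\<lambda>t. real n * (t powr (real n - 1) * (1 - t) powr (a + 1 - 1))) has_integral real n * Beta (real n) (a + 1)) {0..1}"
    by (intro has_integral_mult_right has_integral_Beta_real) (use n a in auto)
  fix t :: real assume "0 < t" "t \<le> 1"
  then show "real n * (t powr (real n - 1) * (1 - t) powr (a + 1 - 1)) = real n * t ^ (n - 1) * (1 - t) powr a"
    using n by (simp add: powr_realpow[symmetric] of_nat_diff)
qed auto

lemma power_law_powr_moment:
  fixes b :: real
  assumes n: "1 \<le> n" and b: "0 \<le> b"
  shows "(\<integral>t. t powr b \<partial>power_law n) = real n / (real n + b)"
proof (rule integral_power_law_of_has_integral)
  have "((\<lambda>t. real n * (t powr (real n - 1 + b))) has_integral real n * (1 powr (real n - 1 + b + 1) / (real n - 1 + b + 1))) {0..1}"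
    by (intro has_integral_mult_right has_integral_powr_from_0) (use n b in auto)
  then show "((\<lambda>t. real n * (t powr (real n - 1 + b))) has_integral real n / (real n + b)) {0..1}"
    by (simp add: add.commute)
  fix t :: real assume "0 < t" "t \<le> 1"
  then show "real n * (t powr (real n - 1 + b)) = real n * t ^ (n - 1) * t powr b"
    using n by (simp add: powr_realpow[symmetric] of_nat_diff powr_add)
qed auto

text \<open>By symmetry the double integral splits into two equal halves. For s below t the
  substitution s = t * u gives \<open>t powr (real n + a)\<close> times the Beta moment, and what
  remains over t is a power moment.\<close>

lemma power_law_abs_diff_moment:
  fixes a :: real
  assumes n: "1 \<le> n" and a: "0 < a"
  shows "(\<integral>t. (\<integral>s. \<bar>t - s\<bar> powr a \<partial>power_law n) \<partial>power_law n)
     = real n * Beta (real n) (a + 1) * (2 * real n / (2 * real n + a))"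
proof -
  let ?U = "power_law n"
  interpret U: prob_space ?U by (rule prob_space_power_law[OF n])
  interpret UU: pair_prob_space ?U ?U ..
  \<comment> \<open>The half of the square with s at most t. The two halves overlap only on the
    diagonal, where the integrand is 0.\<close>
  define k where "k t s = (if 0 \<le> s \<and> s \<le> t \<and> t \<le> 1 then (t - s) powr a else 0)" for t s :: real
  have k_meas: "(\<lambda>(t, s). k t s) \<in> borel_measurable (borel \<Otimes>\<^sub>M borel)"
    unfolding k_def[abs_def] by measurable
  have [measurable]: "(\<lambda>s. k t s) \<in> borel_measurable borel" "(\<lambda>s. k s t) \<in> borel_measurable borel" for t
    unfolding k_def[abs_def] by measurable
  have k01: "0 \<le> k t s" "k t s \<le> 1" for t s
    using a by (auto simp: k_def intro!: powr_le1)
  have k_int: "integrable ?U (\<lambda>s. k t s)" "integrable ?U (\<lambda>s. k s t)" for t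
    by (rule U.integrable_const_bound[where B = 1]; use k01 in auto)+
  have kU: "integrable (?U \<Otimes>\<^sub>M ?U) (\<lambda>(t, s). k t s)"
    by (rule UU.integrable_const_bound[where B = 1]) (use k01 k_meas in \<open>auto cong: measurable_cong_sets sets_pair_measure_cong\<close>)
  have inner: "(\<integral>s. k t s \<partial>?U) = t powr (real n + a) * (real n * Beta (real n) (a + 1))"
    if t: "0 < t" "t \<le> 1" for t
  proof -
    have "(\<integral>s. k t s \<partial>?U) = (\<integral>s. indicator {0..1} s * (real n * s ^ (n - 1) * k t s) \<partial>lborel)"
      by (rule integral_power_law) simp
    also have "\<dots> = \<bar>t\<bar> *\<^sub>R (\<integral>u. indicator {0..1} (0 + t * u) * (real n * (0 + t * u) ^ (n - 1) * k t (0 + t * u)) \<partial>lborel)"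
      by (rule lborel_integral_real_affine) (use t in auto)
    also have "\<dots> = (\<integral>u. t * (indicator {0..1} (0 + t * u) * (real n * (0 + t * u) ^ (n - 1) * k t (0 + t * u))) \<partial>lborel)"
      using t by simp
    also have "\<dots> = (\<integral>u. t powr (real n + a) * (indicator {0..1} u * (real n * u ^ (n - 1) * (1 - u) powr a)) \<partial>lborel)"
    proof (intro Bochner_Integration.integral_cong refl)
      fix u :: real
      consider "u < 0" | "1 < u" | "0 \<le> u" "u \<le> 1" by linarith
      then show "t * (indicator {0..1} (0 + t * u) * (real n * (0 + t * u) ^ (n - 1) * k t (0 + t * u)))
         = t powr (real n + a) * (indicator {0..1} u * (real n * u ^ (n - 1) * (1 - u) powr a))"
      proof cases
        case 1
        then have "t * u < 0" using t by (simp add: mult_less_0_iff)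
        then show ?thesis using 1 by simp
      next
        case 2
        then have "t < t * u" using t by simp
        then show ?thesis using 2 by (simp add: k_def)
      next
        case 3
        have tu: "0 \<le> t * u" "t * u \<le> t" "t * u \<le> 1"
          using t 3 mult_left_mono[of u 1 t] mult_le_one[of t u] by auto
        have "t - t * u = t * (1 - u)" by (simp add: algebra_simps)
        then have k: "k t (t * u) = t powr a * (1 - u) powr a"
          using t tu 3 by (simp add: k_def powr_mult)
        have "t powr (real n + a) = t * t ^ (n - 1) * t powr a"
          using t n by (simp add: powr_add powr_realpow power_eq_if[of t n])
        then show ?thesis using 3 tu k by (simp add: power_mult_distrib)
      qed
    qed
    also have "\<dots> = t powr (real n + a) * (\<integral>u. (1 - u) powr a \<partial>?U)"
      by (subst integral_power_law) auto
    finally show ?thesis using n a by (simp add: power_law_beta_moment)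
  qed
  have K: "(\<integral>t. (\<integral>s. k t s \<partial>?U) \<partial>?U) = real n * Beta (real n) (a + 1) * (real n / (2 * real n + a))"
  proof -
    have "(\<integral>t. (\<integral>s. k t s \<partial>?U) \<partial>?U) = (\<integral>t. t powr (real n + a) * (real n * Beta (real n) (a + 1)) \<partial>?U)"
    proof (rule integral_cong_AE)
      show "AE t in ?U. (\<integral>s. k t s \<partial>?U) = t powr (real n + a) * (real n * Beta (real n) (a + 1))"
        using AE_power_law by eventually_elim (rule inner, auto)
      show "(\<lambda>t. \<integral>s. k t s \<partial>?U) \<in> borel_measurable ?U"
        using U.borel_measurable_lebesgue_integral[of "\<lambda>t s. k t s" ?U] k_meas by simp
    qed simp
    also have "\<dots> = (real n / (real n + (real n + a))) * (real n * Beta (real n) (a + 1))"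
      using n a by (simp add: power_law_powr_moment)
    finally show ?thesis by (simp add: algebra_simps)
  qed
  have K': "(\<integral>t. (\<integral>s. k s t \<partial>?U) \<partial>?U) = (\<integral>t. (\<integral>s. k t s \<partial>?U) \<partial>?U)"
    by (rule UU.Fubini_integral[OF kU])
  have i1: "integrable ?U (\<lambda>t. (\<integral>s. k t s \<partial>?U))"
    by (rule UU.integrable_fst[OF kU])
  have i2: "integrable ?U (\<lambda>t. (\<integral>s. k s t \<partial>?U))"
    by (rule UU.integrable_snd[OF kU])
  have "(\<integral>t. (\<integral>s. \<bar>t - s\<bar> powr a \<partial>?U) \<partial>?U) = (\<integral>t. (\<integral>s. k t s \<partial>?U) + (\<integral>s. k s t \<partial>?U) \<partial>?U)"
  proof (rule integral_cong_AE)
    show "AE t in ?U. (\<integral>s. \<bar>t - s\<bar> powr a \<partial>?U) = (\<integral>s. k t s \<partial>?U) + (\<integral>s. k s t \<partial>?U)"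
      using AE_power_law
    proof eventually_elim
      case (elim t)
      have "(\<integral>s. \<bar>t - s\<bar> powr a \<partial>?U) = (\<integral>s. k t s + k s t \<partial>?U)"
      proof (rule integral_cong_AE)
        show "AE s in ?U. \<bar>t - s\<bar> powr a = k t s + k s t"
          using AE_power_law by eventually_elim (use elim a in \<open>auto simp: k_def\<close>)
      qed auto
      then show ?case using k_int by simp
    qed
    show "(\<lambda>t. (\<integral>s. k t s \<partial>?U) + (\<integral>s. k s t \<partial>?U)) \<in> borel_measurable ?U"
      using i1 i2 by simp
    have "(\<lambda>(t, s). \<bar>t - s\<bar> powr a) \<in> borel_measurable (?U \<Otimes>\<^sub>M ?U)" by measurable
    then show "(\<lambda>t. \<integral>s. \<bar>t - s\<bar> powr a \<partial>?U) \<in> borel_measurable ?U"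
      by (rule U.borel_measurable_lebesgue_integral)
  qed
  also have "\<dots> = 2 * (real n * Beta (real n) (a + 1) * (real n / (2 * real n + a)))"
    using i1 i2 K K' by simp
  finally show ?thesis by simp
qed

text \<open>Log-convexity of Gamma: the slope of ln Gamma over [n+1, n+1+a] lies between its slopes
  over [n, n+1] and over [n+1+a, n+2+a], and these are ln n and ln (n+1+a) by the functional
  equation.\<close>

lemma Gamma_ratio_bounds:
  fixes a :: real
  assumes n: "1 \<le> n" and a: "1 \<le> a" "a \<le> 2"
  shows "real n powr a \<le> Gamma (real n + 1 + a) / Gamma (real n + 1)"
    and "Gamma (real n + 1 + a) / Gamma (real n + 1) \<le> (real n + 3) powr a"
proof -
  define f where "f = (ln \<circ> Gamma :: real \<Rightarrow> real)"
  have cv: "convex_on {0<..} f" unfolding f_def by (rule log_convex_Gamma_real)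
  have G1: "f (x + 1) = f x + ln x" if "0 < x" for x
  proof -
    have "Gamma (x + 1) = x * Gamma x" using that by (intro Gamma_plus1) (auto elim!: nonpos_Ints_cases')
    moreover have "Gamma x \<noteq> 0" using Gamma_real_pos[OF that] by linarith
    ultimately show ?thesis using that by (simp add: f_def ln_mult)
  qed
  have R: "f (real n + 1 + a) - f (real n + 1) = ln (Gamma (real n + 1 + a) / Gamma (real n + 1))"
    using n a Gamma_real_pos[of "real n + 1 + a"] Gamma_real_pos[of "real n + 1"]
    by (simp add: f_def ln_div del: Gamma_real_pos)
  have Rp: "0 < Gamma (real n + 1 + a) / Gamma (real n + 1)"
    using n a by (simp add: Gamma_real_pos)
  have "(f (real n) - f (real n + 1)) / (real n - (real n + 1)) \<le> (f (real n) - f (real n + 1 + a)) / (real n - (real n + 1 + a))"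
       "(f (real n) - f (real n + 1 + a)) / (real n - (real n + 1 + a)) \<le> (f (real n + 1) - f (real n + 1 + a)) / (real n + 1 - (real n + 1 + a))"
    by (rule convex_on_slope_le[OF cv]; use n a in simp)+
  then have "ln (real n) \<le> (f (real n + 1 + a) - f (real n + 1)) / a"
    using G1[of "real n"] n a by (simp add: field_simps)
  then have "a * ln (real n) \<le> ln (Gamma (real n + 1 + a) / Gamma (real n + 1))"
    using R a by (simp add: field_simps)
  then show "real n powr a \<le> Gamma (real n + 1 + a) / Gamma (real n + 1)"
    using Rp n by (simp add: powr_def) (metis exp_le_cancel_iff exp_ln)
  have "(f (real n + 1) - f (real n + 1 + a)) / (real n + 1 - (real n + 1 + a)) \<le> (f (real n + 1) - f (real n + 1 + a + 1)) / (real n + 1 - (real n + 1 + a + 1))"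
       "(f (real n + 1) - f (real n + 1 + a + 1)) / (real n + 1 - (real n + 1 + a + 1)) \<le> (f (real n + 1 + a) - f (real n + 1 + a + 1)) / (real n + 1 + a - (real n + 1 + a + 1))"
    by (rule convex_on_slope_le[OF cv]; use n a in simp)+
  then have "(f (real n + 1 + a) - f (real n + 1)) / a \<le> ln (real n + 1 + a)"
    using G1[of "real n + 1 + a"] n a by (simp add: field_simps)
  also have "\<dots> \<le> ln (real n + 3)" using n a by simp
  finally have "ln (Gamma (real n + 1 + a) / Gamma (real n + 1)) \<le> a * ln (real n + 3)"
    using R a by (simp add: field_simps)
  then show "Gamma (real n + 1 + a) / Gamma (real n + 1) \<le> (real n + 3) powr a"
    using Rp n by (simp add: powr_def) (metis exp_le_cancel_iff exp_ln)
qed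

text \<open>In terms of Gamma, \<open>real n * Beta (real n) (a + 1)\<close> is
  \<open>Gamma (a + 1) / R\<close> with the ratio \<open>R\<close> just bounded. So the main factor
  is \<open>q\<close>, within 6/n of 1, and (n + a)/(2n + a) is within 1/n of 1/2; together this
  gives 7. For \<open>a = 2 * H\<close> the limit is the square of \<open>c_const H\<close>.\<close>

lemma scaled_beta_asymp:
  fixes a :: real
  assumes n: "1 \<le> n" and a: "1 \<le> a" "a \<le> 2"
  shows "\<bar>real n powr a * (real n * Beta (real n) (a + 1) * ((real n + a) / (2 * real n + a))) - Gamma (a + 1) / 2\<bar>
     \<le> 7 * Gamma (a + 1) / real n"
proof -
  define R where "R = Gamma (real n + 1 + a) / Gamma (real n + 1)"
  define q where "q = real n powr a / R"
  have Rp: "0 < R" unfolding R_def using n a by (simp add: Gamma_real_pos)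
  have n0: "0 < real n" using n by simp
  have R: "real n powr a \<le> R" "R \<le> (real n + 3) powr a"
    unfolding R_def by (rule Gamma_ratio_bounds[OF n a])+
  have "q \<le> 1" unfolding q_def using R(1) Rp by simp
  \<comment> \<open>The upper bound on \<open>R\<close> and \<open>a \<le> 2\<close> reduce this to
    the square of n/(n+3), hence to (1 - u)^2 >= 1 - 2u.\<close>
  moreover have "1 - 6 / real n \<le> q"
  proof -
    have "real n / (real n + 3) = 1 - 3 / (real n + 3)" using n0 by (simp add: field_simps)
    moreover have "1 - 2 * u \<le> (1 - u)\<^sup>2" for u :: real by (simp add: power2_diff)
    ultimately have "1 - 2 * (3 / (real n + 3)) \<le> (real n / (real n + 3)) ^ 2" by metis
    moreover have "6 / (real n + 3) \<le> 6 / real n" using n0 by (intro divide_left_mono) auto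
    ultimately have "1 - 6 / real n \<le> (real n / (real n + 3)) ^ 2" by simp
    also have "\<dots> = (real n / (real n + 3)) powr 2" using n0 by (simp add: powr_numeral)
    also have "\<dots> \<le> (real n / (real n + 3)) powr a" using n0 a by (intro powr_mono') auto
    also have "\<dots> = real n powr a / (real n + 3) powr a" using n0 by (simp add: powr_divide)
    also have "\<dots> \<le> q" unfolding q_def using R(2) Rp n0
      by (intro divide_left_mono) auto
    finally show ?thesis .
  qed
  ultimately have q: "\<bar>q - 1\<bar> \<le> 6 / real n" by simp
  have "Gamma (real n + 1) = real n * Gamma (real n)"
    using n0 by (intro Gamma_plus1) (auto elim!: nonpos_Ints_cases')
  then have "real n * Beta (real n) (a + 1) = Gamma (a + 1) / R"
    using n0 a by (simp add: Beta_def R_def add_ac)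
  then have eq: "real n powr a * (real n * Beta (real n) (a + 1) * ((real n + a) / (2 * real n + a)))
     = Gamma (a + 1) * (q * ((real n + a) / (2 * real n + a)))"
    by (simp add: q_def)
  have h: "(real n + a) / (2 * real n + a) = 1 / 2 + a / 2 / (2 * real n + a)"
    using n0 a by (simp add: field_simps)
  have h2: "0 \<le> a / 2 / (2 * real n + a)" "a / 2 / (2 * real n + a) \<le> 1 / real n"
  proof -
    have "a * real n \<le> 2 * real n" using a by (intro mult_right_mono) auto
    then have "a * real n \<le> a * 2 + real n * 4" using n0 a by linarith
    then show "a / 2 / (2 * real n + a) \<le> 1 / real n" using n0 a by (simp add: field_simps)
  qed (use n0 a in auto)
  have h3: "\<bar>(real n + a) / (2 * real n + a)\<bar> \<le> 1" using n0 a by (simp add: field_simps)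
  have "\<bar>q * ((real n + a) / (2 * real n + a)) - 1 / 2\<bar>
     = \<bar>(q - 1) * ((real n + a) / (2 * real n + a)) + a / 2 / (2 * real n + a)\<bar>"
    unfolding left_diff_distrib using h by simp
  also have "\<dots> \<le> \<bar>q - 1\<bar> * \<bar>(real n + a) / (2 * real n + a)\<bar> + 1 / real n"
    by (rule order_trans[OF abs_triangle_ineq add_mono[OF eq_refl[OF abs_mult] ord_eq_le_trans[OF abs_of_nonneg[OF h2(1)] h2(2)]]])
  also have "\<dots> \<le> 6 / real n * 1 + 1 / real n"
    using q h3 by (intro add_mono mult_mono) auto
  finally have *: "\<bar>q * ((real n + a) / (2 * real n + a)) - 1 / 2\<bar> \<le> 7 / real n" by simp
  have G: "0 < Gamma (a + 1)" using a by (simp add: Gamma_real_pos)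
  have "\<bar>Gamma (a + 1) * (q * ((real n + a) / (2 * real n + a))) - Gamma (a + 1) / 2\<bar>
     = Gamma (a + 1) * \<bar>q * ((real n + a) / (2 * real n + a)) - 1 / 2\<bar>"
  proof -
    have "Gamma (a + 1) * Q - Gamma (a + 1) / 2 = Gamma (a + 1) * (Q - 1 / 2)" for Q
      by (simp add: right_diff_distrib)
    then show ?thesis using G by (simp only: abs_mult abs_of_pos)
  qed
  also have "\<dots> \<le> Gamma (a + 1) * (7 / real n)" using * G by (intro mult_left_mono) auto
  finally show ?thesis unfolding eq by simp
qed

text \<open>For \<open>a = 2 * H\<close> the inner bracket is the variance of the weighted sum of
  the increments B_1 - B_(i/m). As m grows, its two sums become Beta integrals b and 2nb/(2n+a), and
  b minus half of the second is b(n+a)/(2n+a), the quantity treated by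
  \<open>scaled_beta_asymp\<close>.\<close>

lemma grid_variance_asymp:
  fixes a :: real
  assumes n: "1 \<le> n" and m: "1 \<le> m" and a: "1 \<le> a" "a \<le> 2"
  shows "\<bar>real n powr a * ((\<Sum>i=1..m. grid_weight n m i * (1 - real i / real m) powr a)
      - (\<Sum>i=1..m. grid_weight n m i * (\<Sum>j=1..m. grid_weight n m j * \<bar>real i / real m - real j / real m\<bar> powr a)) / 2)
      - Gamma (a + 1) / 2\<bar> \<le> 7 * Gamma (a + 1) / real n + 4 * (real n)\<^sup>2 / real m"
proof -
  let ?U = "power_law n"
  let ?w = "grid_weight n m"
  interpret U: prob_space ?U by (rule prob_space_power_law[OF n])
  have m0: "0 < real m" using m by simp
  define \<phi> where "\<phi> t = (\<integral>s. \<bar>t - s\<bar> powr a \<partial>?U)" for t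
  have "(\<lambda>(t, s). \<bar>t - s\<bar> powr a) \<in> borel_measurable (borel \<Otimes>\<^sub>M ?U)" by measurable
  then have [measurable]: "\<phi> \<in> borel_measurable borel"
    unfolding \<phi>_def[abs_def] by (rule U.borel_measurable_lebesgue_integral)
  have le1: "\<bar>t - s\<bar> powr a \<le> 1" if "0 \<le> t" "t \<le> 1" "0 \<le> s" "s \<le> 1" for t s :: real
    using that a by (intro powr_le1) auto
  have ip: "integrable ?U (\<lambda>s. \<bar>t - s\<bar> powr a)" if "0 \<le> t" "t \<le> 1" for t
    by (rule U.integrable_const_bound[where B = 1])
      (use AE_power_law in eventually_elim, use le1 that in auto)
  have \<phi>01: "0 \<le> \<phi> t" "\<phi> t \<le> 1" if "0 \<le> t" "t \<le> 1" for t
    using ip[OF that] unfolding \<phi>_def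
    by (auto intro!: U.integral_le_const AE_mp[OF AE_power_law AE_I2] le1 that integral_nonneg_AE)
  \<comment> \<open>Needed to discretize the double sum one variable at a time: 2/m for the inner
    sum and, by this bound, another 2/m for the outer one.\<close>
  have \<phi>_lip: "\<bar>\<phi> t - \<phi> t'\<bar> \<le> 2 * \<bar>t - t'\<bar>" if t: "0 \<le> t" "t \<le> 1" "0 \<le> t'" "t' \<le> 1" for t t'
  proof -
    have "\<bar>\<phi> t - \<phi> t'\<bar> = \<bar>\<integral>s. \<bar>t - s\<bar> powr a - \<bar>t' - s\<bar> powr a \<partial>?U\<bar>"
      unfolding \<phi>_def using ip t by simp
    also have "\<dots> \<le> (\<integral>s. \<bar>\<bar>t - s\<bar> powr a - \<bar>t' - s\<bar> powr a\<bar> \<partial>?U)" by (rule integral_abs_bound)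
    also have "\<dots> \<le> 2 * \<bar>t - t'\<bar>"
    proof (rule U.integral_le_const)
      show "AE s in ?U. \<bar>\<bar>t - s\<bar> powr a - \<bar>t' - s\<bar> powr a\<bar> \<le> 2 * \<bar>t - t'\<bar>"
        using AE_power_law
      proof eventually_elim
        case (elim s)
        have "\<bar>\<bar>t - s\<bar> powr a - \<bar>t' - s\<bar> powr a\<bar> \<le> 2 * \<bar>\<bar>t - s\<bar> - \<bar>t' - s\<bar>\<bar>"
          using elim t a by (intro powr_lipschitz_01) auto
        also have "\<dots> \<le> 2 * \<bar>t - t'\<bar>" using abs_triangle_ineq3[of "t - s" "t' - s"] by simp
        finally show ?case .
      qed
    qed (use ip t in auto)
    finally show ?thesis .
  qed
  define S1 where "S1 = (\<Sum>i=1..m. ?w i * (1 - real i / real m) powr a)"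
  define D where "D i = (\<Sum>j=1..m. ?w j * \<bar>real i / real m - real j / real m\<bar> powr a)" for i
  define S2 where "S2 = (\<Sum>i=1..m. ?w i * D i)"
  have b1: "\<bar>S1 - (\<integral>t. (1 - t) powr a \<partial>?U)\<bar> \<le> 2 / real m"
    unfolding S1_def
  proof (rule grid_sum_approx[OF n m, where C = 1])
    fix t :: real assume t: "0 < t" "t \<le> 1"
    show "\<bar>(1 - t) powr a\<bar> \<le> 1" using t a by (auto intro!: powr_le1)
    have "\<bar>(1 - real (nat \<lceil>real m * t\<rceil>) / real m) powr a - (1 - t) powr a\<bar> \<le> 2 * \<bar>(1 - real (nat \<lceil>real m * t\<rceil>) / real m) - (1 - t)\<bar>"
      using grid_index[OF t m] t a by (intro powr_lipschitz_01) auto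
    also have "\<dots> \<le> 2 / real m" using grid_index[OF t m] by simp
    finally show "\<bar>(1 - real (nat \<lceil>real m * t\<rceil>) / real m) powr a - (1 - t) powr a\<bar> \<le> 2 / real m" .
  qed simp
  have Dphi: "\<bar>D i - \<phi> (real i / real m)\<bar> \<le> 2 / real m" if i: "i \<in> {1..m}" for i
    unfolding D_def \<phi>_def
  proof (rule grid_sum_approx[OF n m, where C = 1])
    have im: "0 \<le> real i / real m" "real i / real m \<le> 1" using i m0 by auto
    fix t :: real assume t: "0 < t" "t \<le> 1"
    show "\<bar>\<bar>real i / real m - t\<bar> powr a\<bar> \<le> 1" using t im le1 by auto
    have "\<bar>\<bar>real i / real m - real (nat \<lceil>real m * t\<rceil>) / real m\<bar> powr a - \<bar>real i / real m - t\<bar> powr a\<bar>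
      \<le> 2 * \<bar>\<bar>real i / real m - real (nat \<lceil>real m * t\<rceil>) / real m\<bar> - \<bar>real i / real m - t\<bar>\<bar>"
    proof (rule powr_lipschitz_01[OF _ _ _ _ a])
      have y0: "0 \<le> real (nat \<lceil>real m * t\<rceil>) / real m" by (intro divide_nonneg_nonneg of_nat_0_le_iff)
      then show "\<bar>real i / real m - real (nat \<lceil>real m * t\<rceil>) / real m\<bar> \<le> 1"
        using grid_index(4)[OF t m] im by linarith
      show "\<bar>real i / real m - t\<bar> \<le> 1" using t im by linarith
    qed simp_all
    also have "\<dots> \<le> 2 * (1 / real m)" using grid_index[OF t m] by (intro mult_left_mono) auto
    finally show "\<bar>\<bar>real i / real m - real (nat \<lceil>real m * t\<rceil>) / real m\<bar> powr a - \<bar>real i / real m - t\<bar> powr a\<bar> \<le> 2 / real m"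
      by simp
  qed simp
  have b2: "\<bar>S2 - (\<integral>t. \<phi> t \<partial>?U)\<bar> \<le> 4 / real m"
    unfolding S2_def
  proof (rule grid_sum_approx[OF n m, where C = 1])
    fix t :: real assume t: "0 < t" "t \<le> 1"
    show "\<bar>\<phi> t\<bar> \<le> 1" using \<phi>01[of t] t by simp
    let ?i = "nat \<lceil>real m * t\<rceil>"
    have "\<bar>\<phi> (real ?i / real m) - \<phi> t\<bar> \<le> 2 * \<bar>real ?i / real m - t\<bar>"
      using grid_index[OF t m] t by (intro \<phi>_lip) auto
    also have "\<dots> \<le> 2 * (1 / real m)" using grid_index[OF t m] by (intro mult_left_mono) auto
    finally show "\<bar>D ?i - \<phi> t\<bar> \<le> 4 / real m"
      using Dphi[OF grid_index(1)[OF t m]] by simp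
  qed simp
  define b where "b = real n * Beta (real n) (a + 1)"
  have I1: "(\<integral>t. (1 - t) powr a \<partial>?U) = b" unfolding b_def using n a by (intro power_law_beta_moment) auto
  have I2: "(\<integral>t. \<phi> t \<partial>?U) = b * (2 * real n / (2 * real n + a))"
    unfolding b_def \<phi>_def using n a by (intro power_law_abs_diff_moment) auto
  have lim: "b - b * (2 * real n / (2 * real n + a)) / 2 = b * ((real n + a) / (2 * real n + a))"
    using n a by (simp add: field_simps)
  \<comment> \<open>Mesh errors: 2/m for the single sum and half of 4/m for the double sum.\<close>
  have e: "\<bar>(S1 - S2 / 2) - b * ((real n + a) / (2 * real n + a))\<bar> \<le> 4 / real m"
  proof -
    define X where "X = b * (2 * real n / (2 * real n + a))"
    have "\<bar>S1 - b\<bar> \<le> 2 / real m" "\<bar>S2 - X\<bar> \<le> 4 / real m" using b1 b2 unfolding I1 I2 X_def .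
    moreover have "(4 / real m) / 2 = 2 / real m" "4 / real m = 2 / real m + 2 / real m" by simp_all
    ultimately have "\<bar>(S1 - S2 / 2) - (b - X / 2)\<bar> \<le> 4 / real m" by linarith
    then show ?thesis unfolding lim[symmetric] X_def .
  qed
  have na: "real n powr a \<le> (real n)\<^sup>2"
    using powr_mono[of a 2 "real n"] n a by (simp add: powr_numeral)
  have "\<bar>real n powr a * (S1 - S2 / 2) - real n powr a * (b * ((real n + a) / (2 * real n + a)))\<bar>
     = real n powr a * \<bar>(S1 - S2 / 2) - b * ((real n + a) / (2 * real n + a))\<bar>"
    by (simp only: right_diff_distrib[symmetric] abs_mult) simp
  also have "\<dots> \<le> (real n)\<^sup>2 * (4 / real m)" using e na by (intro mult_mono) auto
  finally have "\<bar>real n powr a * (S1 - S2 / 2) - real n powr a * (b * ((real n + a) / (2 * real n + a)))\<bar> \<le> 4 * (real n)\<^sup>2 / real m"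
    by (simp add: mult.commute)
  note A = this
  have tri: "\<bar>x - z\<bar> \<le> \<bar>x - y\<bar> + \<bar>y - z\<bar>" for x y z :: real
    using abs_triangle_ineq[of "x - y" "y - z"] by simp
  have "\<bar>real n powr a * (S1 - S2 / 2) - Gamma (a + 1) / 2\<bar> \<le> 4 * (real n)\<^sup>2 / real m + 7 * Gamma (a + 1) / real n"
    by (rule order_trans[OF tri add_mono[OF A scaled_beta_asymp[OF n a, folded b_def]]])
  then have "\<bar>real n powr a * (S1 - S2 / 2) - Gamma (a + 1) / 2\<bar> \<le> 7 * Gamma (a + 1) / real n + 4 * (real n)\<^sup>2 / real m"
    by (simp only: add.commute)
  then show ?thesis unfolding S1_def S2_def D_def .
qed

text \<open>The mean of 1 - t under \<open>power_law n\<close> is 1/(n+1), and right endpoints only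
  lower the sum, so no error in \<open>m\<close> appears. Combined with the prefactor n^H this
  produces the rate n^(H-1).\<close>

lemma sum_grid_weight_complement_le:
  assumes n: "1 \<le> n" and m: "1 \<le> m"
  shows "(\<Sum>i=1..m. grid_weight n m i * (1 - real i / real m)) \<le> 1 / real n"
proof -
  interpret U: prob_space "power_law n" by (rule prob_space_power_law[OF n])
  have "(\<Sum>i=1..m. grid_weight n m i * (1 - real i / real m)) = (\<integral>t. 1 - real (nat \<lceil>real m * t\<rceil>) / real m \<partial>power_law n)"
    using integral_grid_index[OF n m, of "\<lambda>i. 1 - real i / real m"] by simp
  also have "\<dots> \<le> (\<integral>t. 1 - t \<partial>power_law n)"
  proof (rule integral_mono_AE)
    show "AE t in power_law n. 1 - real (nat \<lceil>real m * t\<rceil>) / real m \<le> 1 - t"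
      using AE_power_law by eventually_elim (use grid_index(2) m in auto)
    show "integrable (power_law n) (\<lambda>t. 1 - real (nat \<lceil>real m * t\<rceil>) / real m)"
    proof (rule U.integrable_const_bound[where B = 1])
      show "AE t in power_law n. norm (1 - real (nat \<lceil>real m * t\<rceil>) / real m) \<le> 1"
        using AE_power_law
      proof eventually_elim
        case (elim t)
        have "0 \<le> real (nat \<lceil>real m * t\<rceil>) / real m" by (intro divide_nonneg_nonneg of_nat_0_le_iff)
        then show ?case using grid_index(4)[of t m] elim m unfolding real_norm_def by linarith
      qed
    qed measurable
    show "integrable (power_law n) (\<lambda>t. 1 - t)"
      by (rule U.integrable_const_bound[where B = 1]) (use AE_power_law in eventually_elim, auto)
  qed
  also have "\<dots> = 1 - (\<integral>t. t powr 1 \<partial>power_law n)"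
  proof -
    have i: "integrable (power_law n) (\<lambda>t. t powr 1)"
      by (rule U.integrable_const_bound[where B = 1]) (use AE_power_law in eventually_elim, auto)
    have "(\<integral>t. 1 - t \<partial>power_law n) = (\<integral>t. 1 - t powr 1 \<partial>power_law n)"
      by (rule integral_cong_AE) (auto intro!: AE_mp[OF AE_power_law AE_I2])
    then show ?thesis using i U.prob_space by simp
  qed
  also have "\<dots> = 1 / (real n + 1)" using n by (subst power_law_powr_moment) (auto simp: field_simps)
  also have "\<dots> \<le> 1 / real n" using n by (simp add: field_simps)
  finally show ?thesis .
qed

lemma iexp_lipschitz: "cmod (iexp a - iexp b) \<le> \<bar>a - b\<bar>"
proof -
  have "iexp a - iexp b = iexp b * (iexp (a - b) - 1)"
    by (simp add: right_diff_distrib exp_add[symmetric] of_real_diff)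
  then have "cmod (iexp a - iexp b) = cmod (iexp (a - b) - 1)" by (simp add: norm_mult)
  also have "\<dots> \<le> \<bar>a - b\<bar>" using iexp_approx1[of "a - b" 0] by simp
  finally show ?thesis .
qed

section \<open>Fractional Brownian motion\<close>

lemma (in prob_space) gaussian_rv_moments:
  assumes "gaussian_rv M X"
  shows "X \<in> borel_measurable M" "integrable M X" "integrable M (\<lambda>\<omega>. (X \<omega>)\<^sup>2)"
proof -
  show [measurable]: "X \<in> borel_measurable M" using assms by (simp add: gaussian_rv_def)
  consider \<mu> where "AE \<omega> in M. X \<omega> = \<mu>" | \<mu> \<sigma> where "0 < \<sigma>" "distributed M lborel X (normal_density \<mu> \<sigma>)"
    using assms by (auto simp: gaussian_rv_def)
  then have "integrable M X \<and> integrable M (\<lambda>\<omega>. (X \<omega>)\<^sup>2)"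
  proof cases
    case (1 \<mu>)
    have "integrable M X \<longleftrightarrow> integrable M (\<lambda>_. \<mu>)" by (rule integrable_cong_AE) (use 1 in auto)
    moreover have "integrable M (\<lambda>\<omega>. (X \<omega>)\<^sup>2) \<longleftrightarrow> integrable M (\<lambda>_. \<mu>\<^sup>2)"
      by (rule integrable_cong_AE) (use 1 in auto)
    ultimately show ?thesis by simp
  next
    case (2 \<mu> \<sigma>)
    have i1: "integrable lborel (\<lambda>x. normal_density \<mu> \<sigma> x * x)"
      by (rule integrable_normal_moment_nz_1) fact
    have i2: "integrable lborel (\<lambda>x. normal_density \<mu> \<sigma> x * (x - \<mu>) ^ 2)"
      by (rule integrable_normal_moment) fact
    have "integrable lborel (\<lambda>x. normal_density \<mu> \<sigma> x * (x - \<mu>) ^ 2 + 2 * \<mu> * (normal_density \<mu> \<sigma> x * x) - \<mu>\<^sup>2 * normal_density \<mu> \<sigma> x)"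
      using i1 i2 2(1) by (intro Bochner_Integration.integrable_add Bochner_Integration.integrable_diff integrable_mult_right) auto
    moreover have "(\<lambda>x. normal_density \<mu> \<sigma> x * (x - \<mu>) ^ 2 + 2 * \<mu> * (normal_density \<mu> \<sigma> x * x) - \<mu>\<^sup>2 * normal_density \<mu> \<sigma> x)
       = (\<lambda>x. normal_density \<mu> \<sigma> x * x\<^sup>2)"
      by (simp add: fun_eq_iff power2_eq_square algebra_simps)
    ultimately have i3: "integrable lborel (\<lambda>x. normal_density \<mu> \<sigma> x * x\<^sup>2)" by simp
    show ?thesis
      using distributed_integrable[OF 2(2), of "\<lambda>x. x"] distributed_integrable[OF 2(2), of "\<lambda>x. x\<^sup>2"] i1 i3 by simp
  qed
  then show "integrable M X" "integrable M (\<lambda>\<omega>. (X \<omega>)\<^sup>2)" by auto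
qed

text \<open>The constant case is included: a centred constant is almost surely 0, and the formula
  for the characteristic function then holds with variance 0. So that formula can be applied to
  linear combinations without checking that they are nondegenerate.\<close>

lemma (in prob_space) centered_gaussian_rv:
  assumes X: "gaussian_rv M X" and mean: "expectation X = 0"
  shows "0 < \<sigma> \<Longrightarrow> expectation (\<lambda>\<omega>. (X \<omega>)\<^sup>2) = \<sigma>\<^sup>2 \<Longrightarrow> distributed M lborel X (normal_density 0 \<sigma>)"
    and "(\<integral>\<omega>. iexp (X \<omega>) \<partial>M) = complex_of_real (exp (- expectation (\<lambda>\<omega>. (X \<omega>)\<^sup>2) / 2))"
proof -
  note [measurable] = gaussian_rv_moments(1)[OF X]
  consider (const) "AE \<omega> in M. X \<omega> = 0" | (normal) s where "0 < s" "distributed M lborel X (normal_density 0 s)"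
    "expectation (\<lambda>\<omega>. (X \<omega>)\<^sup>2) = s\<^sup>2"
  proof -
    consider \<mu> where "AE \<omega> in M. X \<omega> = \<mu>" | \<mu> s where "0 < s" "distributed M lborel X (normal_density \<mu> s)"
      using X by (auto simp: gaussian_rv_def)
    then show ?thesis
    proof cases
      case (1 \<mu>)
      then have "expectation X = expectation (\<lambda>_. \<mu>)" by (intro integral_cong_AE) auto
      then have "\<mu> = 0" using mean by (simp add: prob_space)
      then show ?thesis using 1 const by simp
    next
      case (2 \<mu> s)
      then have "\<mu> = 0" using normal_distributed_expectation[OF 2] mean by simp
      moreover have "expectation (\<lambda>\<omega>. (X \<omega>)\<^sup>2) = s\<^sup>2"
        using normal_distributed_variance[OF 2] mean by simp
      ultimately show ?thesis using 2 normal by simp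
    qed
  qed
  note cs = this
  {
    assume s: "0 < \<sigma>" "expectation (\<lambda>\<omega>. (X \<omega>)\<^sup>2) = \<sigma>\<^sup>2"
    show "distributed M lborel X (normal_density 0 \<sigma>)"
    proof (cases rule: cs)
      case const
      then have "expectation (\<lambda>\<omega>. (X \<omega>)\<^sup>2) = expectation (\<lambda>_. 0)" by (intro integral_cong_AE) auto
      then show ?thesis using s by simp
    next
      case (normal s')
      then have "s' = \<sigma>" using s by (metis less_imp_le power2_eq_imp_eq)
      then show ?thesis using normal by simp
    qed
  }
  show "(\<integral>\<omega>. iexp (X \<omega>) \<partial>M) = complex_of_real (exp (- expectation (\<lambda>\<omega>. (X \<omega>)\<^sup>2) / 2))"
  proof (cases rule: cs)
    case const
    then have "expectation (\<lambda>\<omega>. (X \<omega>)\<^sup>2) = expectation (\<lambda>_. 0)" by (intro integral_cong_AE) auto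
    moreover have "(\<integral>\<omega>. iexp (X \<omega>) \<partial>M) = (\<integral>\<omega>. 1 \<partial>M)" by (intro integral_cong_AE) (use const in auto)
    ultimately show ?thesis by (simp add: prob_space)
  next
    case (normal s)
    have "distributed M lborel (\<lambda>\<omega>. (X \<omega> - 0) / s) std_normal_density"
      using normal normal_standard_normal_convert[of s X 0] by simp
    then have "distr M borel (\<lambda>\<omega>. X \<omega> / s) = std_normal_distribution"
      using distributed_distr_eq_density by (metis (no_types, lifting) diff_zero distr_cong sets_lborel)
    then have "char (distr M borel (\<lambda>\<omega>. X \<omega> / s)) s = complex_of_real (exp (- s\<^sup>2 / 2))"
      by (simp add: char_std_normal_distribution)
    moreover have "char (distr M borel (\<lambda>\<omega>. X \<omega> / s)) s = (\<integral>\<omega>. iexp (X \<omega>) \<partial>M)"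
      using normal(1) unfolding char_def by (subst integral_distr) auto
    ultimately show ?thesis using normal by simp
  qed
qed

lemma (in prob_space) square_integrable_mult:
  fixes X Y :: "'a \<Rightarrow> real"
  assumes [measurable]: "X \<in> borel_measurable M" "Y \<in> borel_measurable M"
    and "integrable M (\<lambda>\<omega>. (X \<omega>)\<^sup>2)" "integrable M (\<lambda>\<omega>. (Y \<omega>)\<^sup>2)"
  shows "integrable M (\<lambda>\<omega>. X \<omega> * Y \<omega>)"
proof (rule Bochner_Integration.integrable_bound)
  show "integrable M (\<lambda>\<omega>. (X \<omega>)\<^sup>2 + (Y \<omega>)\<^sup>2)" using assms by simp
  show "AE \<omega> in M. norm (X \<omega> * Y \<omega>) \<le> norm ((X \<omega>)\<^sup>2 + (Y \<omega>)\<^sup>2)"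
  proof (rule AE_I2)
    fix \<omega>
    have "2 * \<bar>X \<omega> * Y \<omega>\<bar> \<le> (X \<omega>)\<^sup>2 + (Y \<omega>)\<^sup>2"
      using zero_le_power2[of "\<bar>X \<omega>\<bar> - \<bar>Y \<omega>\<bar>"] by (simp add: power2_diff abs_mult)
    then show "norm (X \<omega> * Y \<omega>) \<le> norm ((X \<omega>)\<^sup>2 + (Y \<omega>)\<^sup>2)" by simp
  qed
qed simp

text \<open>Two uses of Gamma(x+1) = x Gamma(x) turn H(2H-1)Gamma(2H-1) into half of Gamma(2H+1),
  and at H = 1/2 the latter is half of Gamma(2) = 1. This is the form in which the variance
  asymptotics deliver the constant.\<close>

lemma c_const_sq:
  assumes "1 / 2 \<le> H" "H < 1"
  shows "(c_const H)\<^sup>2 = Gamma (2 * H + 1) / 2" and "0 < c_const H"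
proof -
  have G: "0 < Gamma (2 * H + 1)" using assms by (simp add: Gamma_real_pos)
  show sq: "(c_const H)\<^sup>2 = Gamma (2 * H + 1) / 2"
  proof (cases "H = 1 / 2")
    case True
    have "Gamma (2::real) = 1" using Gamma_fact[of 1, where 'a = real] by simp
    moreover have "2 * H + 1 = 2" using True by simp
    ultimately have "Gamma (2 * H + 1) = 1" by (simp only:)
    then show ?thesis unfolding \<open>Gamma (2 * H + 1) = 1\<close> c_const_def using True by (simp add: power_divide)
  next
    case False
    then have H: "1 / 2 < H" using assms by simp
    have "Gamma (2 * H + 1) = 2 * H * Gamma (2 * H)"
      using H by (intro Gamma_plus1) (auto elim!: nonpos_Ints_cases')
    also have "Gamma (2 * H) = (2 * H - 1) * Gamma (2 * H - 1)"
    proof -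
      have "Gamma (2 * H - 1 + 1) = (2 * H - 1) * Gamma (2 * H - 1)"
        using H by (intro Gamma_plus1) (auto elim!: nonpos_Ints_cases')
      then show ?thesis by simp
    qed
    finally have "H * (2 * H - 1) * Gamma (2 * H - 1) = Gamma (2 * H + 1) / 2" by simp
    then show ?thesis using False G by (simp add: c_const_def)
  qed
  have "0 \<le> c_const H"
    using assms Gamma_real_nonneg[of "2 * H - 1"] by (simp add: c_const_def)
  then show "0 < c_const H" using sq G by (cases "c_const H = 0") auto
qed

section \<open>The linear span of the process\<close>

locale fbm = prob_space P for P :: "'a measure" +
  fixes H :: real and B :: "real \<Rightarrow> 'a \<Rightarrow> real"
  assumes H: "1 / 2 \<le> H" "H < 1" and fbm: "fractional_brownian_motion P H B"
begin

text \<open>A vector space of centred Gaussian variables: the characteristic function of each member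
  depends on its second moment only, so statements about joint laws reduce to covariances.\<close>

definition lin :: "('a \<Rightarrow> real) set" where
  "lin = {L. \<exists>J c. finite J \<and> J \<subseteq> {0..} \<and> L = (\<lambda>\<omega>. \<Sum>t\<in>J. c t * B t \<omega>)}"

lemma lin_gaussian: "L \<in> lin \<Longrightarrow> gaussian_rv P L"
  using fbm unfolding lin_def fractional_brownian_motion_def gaussian_process_def by blast

lemma lin_B: "0 \<le> t \<Longrightarrow> B t \<in> lin"
  unfolding lin_def by (intro CollectI exI[of _ "{t}"] exI[of _ "\<lambda>_. 1"]) auto

lemma lin_scale: "L \<in> lin \<Longrightarrow> (\<lambda>\<omega>. r * L \<omega>) \<in> lin"
proof -
  assume "L \<in> lin"
  then obtain J c where "finite J" "J \<subseteq> {0..}" "L = (\<lambda>\<omega>. \<Sum>t\<in>J. c t * B t \<omega>)"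
    unfolding lin_def by blast
  then show ?thesis unfolding lin_def
    by (intro CollectI exI[of _ J] exI[of _ "\<lambda>t. r * c t"]) (auto simp: sum_distrib_left mult.assoc)
qed

lemma lin_add:
  assumes "L \<in> lin" "L' \<in> lin"
  shows "(\<lambda>\<omega>. L \<omega> + L' \<omega>) \<in> lin"
proof -
  obtain J c where J: "finite J" "J \<subseteq> {0..}" "L = (\<lambda>\<omega>. \<Sum>t\<in>J. c t * B t \<omega>)"
    using assms(1) unfolding lin_def by blast
  obtain J' c' where J': "finite J'" "J' \<subseteq> {0..}" "L' = (\<lambda>\<omega>. \<Sum>t\<in>J'. c' t * B t \<omega>)"
    using assms(2) unfolding lin_def by blast
  have e: "(\<Sum>t\<in>K. d t * B t \<omega>) = (\<Sum>t\<in>J \<union> J'. (if t \<in> K then d t else 0) * B t \<omega>)"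
    if "K \<subseteq> J \<union> J'" for K d \<omega>
    using that J(1) J'(1) by (intro sum.mono_neutral_cong_left) auto
  have "(\<lambda>\<omega>. L \<omega> + L' \<omega>) = (\<lambda>\<omega>. \<Sum>t\<in>J \<union> J'. ((if t \<in> J then c t else 0) + (if t \<in> J' then c' t else 0)) * B t \<omega>)"
    unfolding J(3) J'(3) by (subst e[of J], simp, subst e[of J'], simp) (simp add: sum.distrib distrib_right)
  then show ?thesis using J J' unfolding lin_def
    by (intro CollectI exI[of _ "J \<union> J'"] exI[of _ "\<lambda>t. (if t \<in> J then c t else 0) + (if t \<in> J' then c' t else 0)"]) auto
qed

lemma lin_diff: "L \<in> lin \<Longrightarrow> L' \<in> lin \<Longrightarrow> (\<lambda>\<omega>. L \<omega> - L' \<omega>) \<in> lin"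
  using lin_add[of L "\<lambda>\<omega>. (-1) * L' \<omega>"] lin_scale[of L' "-1"] by simp

lemma lin_sum:
  assumes "finite I" "\<And>i. i \<in> I \<Longrightarrow> L i \<in> lin"
  shows "(\<lambda>\<omega>. \<Sum>i\<in>I. L i \<omega>) \<in> lin"
  using assms
proof (induction I rule: finite_induct)
  case empty
  show ?case unfolding lin_def by (intro CollectI exI[of _ "{}"] exI[of _ "\<lambda>_. 0"]) auto
next
  case (insert i I)
  then show ?case using lin_add[of "L i" "\<lambda>\<omega>. \<Sum>i\<in>I. L i \<omega>"] by simp
qed

lemma lin_measurable: "L \<in> lin \<Longrightarrow> L \<in> borel_measurable P"
  by (rule gaussian_rv_moments[OF lin_gaussian])

lemma lin_integrable: "L \<in> lin \<Longrightarrow> integrable P L"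
  by (rule gaussian_rv_moments[OF lin_gaussian])

lemma lin_integrable_mult: "L \<in> lin \<Longrightarrow> L' \<in> lin \<Longrightarrow> integrable P (\<lambda>\<omega>. L \<omega> * L' \<omega>)"
  by (intro square_integrable_mult gaussian_rv_moments lin_gaussian)

lemma lin_integrable_sq: "L \<in> lin \<Longrightarrow> integrable P (\<lambda>\<omega>. (L \<omega>)\<^sup>2)"
  by (rule gaussian_rv_moments[OF lin_gaussian])

lemma lin_mean: "L \<in> lin \<Longrightarrow> expectation L = 0"
proof -
  assume "L \<in> lin"
  then obtain J c where J: "finite J" "J \<subseteq> {0..}" "L = (\<lambda>\<omega>. \<Sum>t\<in>J. c t * B t \<omega>)"
    unfolding lin_def by blast
  have "expectation L = (\<Sum>t\<in>J. c t * expectation (B t))"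
    unfolding J(3) using J(2) lin_integrable[OF lin_B] by (subst Bochner_Integration.integral_sum) auto
  also have "\<dots> = 0" using J(2) fbm unfolding fractional_brownian_motion_def
    by (intro sum.neutral) auto
  finally show ?thesis .
qed

lemma lin_char: "L \<in> lin \<Longrightarrow> (\<integral>\<omega>. iexp (L \<omega>) \<partial>P) = complex_of_real (exp (- expectation (\<lambda>\<omega>. (L \<omega>)\<^sup>2) / 2))"
  by (rule centered_gaussian_rv(2)[OF lin_gaussian lin_mean])

lemma lin_normal:
  "L \<in> lin \<Longrightarrow> 0 < \<sigma> \<Longrightarrow> expectation (\<lambda>\<omega>. (L \<omega>)\<^sup>2) = \<sigma>\<^sup>2 \<Longrightarrow> distributed P lborel L (normal_density 0 \<sigma>)"
  by (rule centered_gaussian_rv(1)[OF lin_gaussian lin_mean])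

lemma lin_add_sq:
  assumes "L \<in> lin" "L' \<in> lin"
  shows "expectation (\<lambda>\<omega>. (L \<omega> + L' \<omega>)\<^sup>2)
    = expectation (\<lambda>\<omega>. (L \<omega>)\<^sup>2) + expectation (\<lambda>\<omega>. (L' \<omega>)\<^sup>2) + 2 * expectation (\<lambda>\<omega>. L \<omega> * L' \<omega>)"
proof -
  have "expectation (\<lambda>\<omega>. (L \<omega> + L' \<omega>)\<^sup>2) = expectation (\<lambda>\<omega>. (L \<omega>)\<^sup>2 + (L' \<omega>)\<^sup>2 + 2 * (L \<omega> * L' \<omega>))"
    by (simp add: power2_sum mult.assoc)
  then show ?thesis using assms by (simp add: lin_integrable_sq lin_integrable_mult)
qed

lemma lin_diff_sq:
  assumes "L \<in> lin" "L' \<in> lin"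
  shows "expectation (\<lambda>\<omega>. (L \<omega> - L' \<omega>)\<^sup>2)
    = expectation (\<lambda>\<omega>. (L \<omega>)\<^sup>2) + expectation (\<lambda>\<omega>. (L' \<omega>)\<^sup>2) - 2 * expectation (\<lambda>\<omega>. L \<omega> * L' \<omega>)"
proof -
  have "expectation (\<lambda>\<omega>. (L \<omega> - L' \<omega>)\<^sup>2) = expectation (\<lambda>\<omega>. (L \<omega>)\<^sup>2 + (L' \<omega>)\<^sup>2 - 2 * (L \<omega> * L' \<omega>))"
    by (simp add: power2_diff mult.assoc)
  then show ?thesis using assms by (simp add: lin_integrable_sq lin_integrable_mult)
qed

lemma cov_B:
  assumes "0 \<le> s" "0 \<le> t"
  shows "expectation (\<lambda>\<omega>. B s \<omega> * B t \<omega>) = (t powr (2 * H) + s powr (2 * H) - \<bar>t - s\<bar> powr (2 * H)) / 2"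
  using fbm assms unfolding fractional_brownian_motion_def by auto

lemma var_B: "0 \<le> t \<Longrightarrow> expectation (\<lambda>\<omega>. (B t \<omega>)\<^sup>2) = t powr (2 * H)"
  using cov_B[of t t] by (simp add: power2_eq_square)

lemma var_increment:
  assumes "0 \<le> s" "0 \<le> t"
  shows "expectation (\<lambda>\<omega>. (B s \<omega> - B t \<omega>)\<^sup>2) = \<bar>s - t\<bar> powr (2 * H)"
  using assms by (simp add: lin_diff_sq lin_B var_B cov_B abs_minus_commute[of t s] field_simps)

text \<open>Here \<open>H \<ge> 1 / 2\<close> enters: powers of 1 - t with exponent 2H are traded
  for 1 - t, whose grid average is at most 1/n.\<close>

lemma hurst_powr: "0 \<le> x \<Longrightarrow> x \<le> 1 \<Longrightarrow> x powr (2 * H) \<le> x" "0 \<le> x \<Longrightarrow> x \<le> 1 \<Longrightarrow> 1 - x powr (2 * H) \<le> 2 * (1 - x)"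
proof -
  show "0 \<le> x \<Longrightarrow> x \<le> 1 \<Longrightarrow> x powr (2 * H) \<le> x"
    using powr_mono'[of 1 "2 * H" x] H by simp
  show "0 \<le> x \<Longrightarrow> x \<le> 1 \<Longrightarrow> 1 - x powr (2 * H) \<le> 2 * (1 - x)"
    using powr_lipschitz_01[of 1 x "2 * H"] H by simp
qed

lemma lin_sum_scale:
  "(\<And>i. i \<in> I \<Longrightarrow> L i \<in> lin) \<Longrightarrow> finite I \<Longrightarrow> (\<lambda>\<omega>. \<Sum>i\<in>I. p i * L i \<omega>) \<in> lin"
  by (intro lin_sum lin_scale)

lemma lin_sum_mult:
  assumes "finite I" "finite J" "\<And>i. i \<in> I \<Longrightarrow> L i \<in> lin" "\<And>j. j \<in> J \<Longrightarrow> L' j \<in> lin"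
  shows "expectation (\<lambda>\<omega>. (\<Sum>i\<in>I. p i * L i \<omega>) * (\<Sum>j\<in>J. q j * L' j \<omega>))
    = (\<Sum>i\<in>I. p i * (\<Sum>j\<in>J. q j * expectation (\<lambda>\<omega>. L i \<omega> * L' j \<omega>)))"
proof -
  have "(\<Sum>i\<in>I. p i * L i \<omega>) * (\<Sum>j\<in>J. q j * L' j \<omega>) = (\<Sum>i\<in>I. \<Sum>j\<in>J. p i * (q j * (L i \<omega> * L' j \<omega>)))" for \<omega>
    by (simp add: sum_product mult_ac)
  then show ?thesis
    using assms by (simp add: Bochner_Integration.integral_sum Bochner_Integration.integrable_sum lin_integrable_mult sum_distrib_left)
qed

lemma lin_mult_le_one:
  assumes "L \<in> lin" "L' \<in> lin" "expectation (\<lambda>\<omega>. (L \<omega>)\<^sup>2) \<le> 1" "expectation (\<lambda>\<omega>. (L' \<omega>)\<^sup>2) \<le> 1"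
  shows "expectation (\<lambda>\<omega>. L \<omega> * L' \<omega>) \<le> 1"
proof -
  have "0 \<le> expectation (\<lambda>\<omega>. (L \<omega> - L' \<omega>)\<^sup>2)" by (intro integral_nonneg_AE) auto
  then show ?thesis using lin_diff_sq[OF assms(1,2)] assms(3,4) by linarith
qed

text \<open>Minkowski's inequality in L^2 for variables of norm at most 1, read off from the
  expanded square.\<close>

lemma lin_sum_sq_le:
  assumes I: "finite I" and L: "\<And>i. i \<in> I \<Longrightarrow> L i \<in> lin" and p: "\<And>i. i \<in> I \<Longrightarrow> 0 \<le> p i"
    and 1: "\<And>i. i \<in> I \<Longrightarrow> expectation (\<lambda>\<omega>. (L i \<omega>)\<^sup>2) \<le> 1"
  shows "expectation (\<lambda>\<omega>. (\<Sum>i\<in>I. p i * L i \<omega>)\<^sup>2) \<le> (\<Sum>i\<in>I. p i)\<^sup>2"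
proof -
  have "expectation (\<lambda>\<omega>. (\<Sum>i\<in>I. p i * L i \<omega>)\<^sup>2) = (\<Sum>i\<in>I. p i * (\<Sum>j\<in>I. p j * expectation (\<lambda>\<omega>. L i \<omega> * L j \<omega>)))"
    unfolding power2_eq_square by (rule lin_sum_mult) (use I L in auto)
  also have "\<dots> \<le> (\<Sum>i\<in>I. p i * (\<Sum>j\<in>I. p j * 1))"
    by (intro sum_mono mult_left_mono lin_mult_le_one L p 1)
  also have "\<dots> = (\<Sum>i\<in>I. p i)\<^sup>2" by (simp add: power2_eq_square sum_distrib_right)
  finally show ?thesis .
qed

section \<open>Regression of the process on \<open>B 1\<close>\<close>

definition rho :: "real \<Rightarrow> real" where
  "rho t = (1 + t powr (2 * H) - (1 - t) powr (2 * H)) / 2"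

text \<open>For t in [0,1], \<open>rho t\<close> is the covariance of B_t and B_1, and B_1 has
  variance 1; so this is what the orthogonal projection of B_t onto B_1 leaves over, the Y_t of the
  overview.\<close>

definition resid :: "real \<Rightarrow> 'a \<Rightarrow> real" where
  "resid t \<omega> = B t \<omega> - rho t * B 1 \<omega>"

lemma rho_bounds:
  assumes "0 \<le> t" "t \<le> 1"
  shows "0 \<le> 1 - rho t" "1 - rho t \<le> 3 / 2 * (1 - t)" "rho t \<le> 1" "- 1 \<le> rho t"
proof -
  have "0 \<le> t powr (2 * H)" "t powr (2 * H) \<le> 1" "0 \<le> (1 - t) powr (2 * H)" "(1 - t) powr (2 * H) \<le> 1 - t"
    "1 - t powr (2 * H) \<le> 2 * (1 - t)"
    using assms H hurst_powr(1)[of "1 - t"] hurst_powr(2)[of t] by (auto intro!: powr_le1)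
  then show "0 \<le> 1 - rho t" "1 - rho t \<le> 3 / 2 * (1 - t)" "rho t \<le> 1" "- 1 \<le> rho t"
    using assms unfolding rho_def by argo+
qed

lemma var_B1: "expectation (\<lambda>\<omega>. (B 1 \<omega>)\<^sup>2) = 1"
  by (simp add: var_B)

lemma resid_lin: "0 \<le> t \<Longrightarrow> resid t \<in> lin"
  unfolding resid_def[abs_def] by (intro lin_diff lin_scale lin_B) auto

lemma resid_orth:
  assumes "0 \<le> t" "t \<le> 1"
  shows "expectation (\<lambda>\<omega>. B 1 \<omega> * resid t \<omega>) = 0"
proof -
  have "expectation (\<lambda>\<omega>. B 1 \<omega> * resid t \<omega>) = expectation (\<lambda>\<omega>. B 1 \<omega> * B t \<omega> - rho t * (B 1 \<omega>)\<^sup>2)"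
    by (simp add: resid_def algebra_simps power2_eq_square)
  also have "\<dots> = 0"
    using assms by (simp add: lin_integrable_mult lin_integrable_sq lin_B cov_B var_B1 rho_def abs_minus_commute[of t 1] add.commute)
  finally show ?thesis .
qed

text \<open>Pythagoras: B_1 - B_t is (1 - rho(t)) B_1 minus the residual, and these two parts are
  orthogonal. So the residual has no more variance than the increment, which has (1 -
  t)^(2H).\<close>

lemma resid_var:
  assumes "0 \<le> t" "t \<le> 1"
  shows "expectation (\<lambda>\<omega>. (resid t \<omega>)\<^sup>2) \<le> 1 - t"
proof -
  have "(1 - t) powr (2 * H) = expectation (\<lambda>\<omega>. (B 1 \<omega> - B t \<omega>)\<^sup>2)"
    using assms by (simp add: var_increment)
  also have "\<dots> = expectation (\<lambda>\<omega>. ((1 - rho t) * B 1 \<omega> - resid t \<omega>)\<^sup>2)"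
    by (simp add: resid_def algebra_simps)
  also have "\<dots> = expectation (\<lambda>\<omega>. ((1 - rho t) * B 1 \<omega>)\<^sup>2) + expectation (\<lambda>\<omega>. (resid t \<omega>)\<^sup>2)
      - 2 * expectation (\<lambda>\<omega>. (1 - rho t) * B 1 \<omega> * resid t \<omega>)"
    using assms by (intro lin_diff_sq lin_scale lin_B resid_lin) auto
  also have "\<dots> = (1 - rho t)\<^sup>2 + expectation (\<lambda>\<omega>. (resid t \<omega>)\<^sup>2)"
    using assms by (simp add: power_mult_distrib var_B1 resid_orth mult.assoc)
  finally have "expectation (\<lambda>\<omega>. (resid t \<omega>)\<^sup>2) \<le> (1 - t) powr (2 * H)" by simp
  also have "\<dots> \<le> 1 - t" using assms by (intro hurst_powr) auto
  finally show ?thesis .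
qed

section \<open>Riemann sums of the functional and of its linear part\<close>

definition quad_grid :: "nat \<Rightarrow> nat \<Rightarrow> 'a \<Rightarrow> real" where
  "quad_grid n m \<omega> = real n powr H / 2 *
     (\<Sum>i=1..m. grid_weight n m i * ((B 1 \<omega>)\<^sup>2 - (B (real i / real m) \<omega>)\<^sup>2))"

text \<open>A discretization of the X_n of the overview. It is suggested by B_1^2 - B_t^2 = 2 B_1
  (B_1 - B_t) - (B_1 - B_t)^2, whose first term, weighted with n^H / 2, gives B_1 times this
  variable.\<close>

definition lin_grid :: "nat \<Rightarrow> nat \<Rightarrow> 'a \<Rightarrow> real" where
  "lin_grid n m \<omega> = (\<Sum>i=1..m. (real n powr H * grid_weight n m i) * (B 1 \<omega> - B (real i / real m) \<omega>))"

lemma lin_grid_lin: "lin_grid n m \<in> lin"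
  unfolding lin_grid_def[abs_def] by (intro lin_sum_scale lin_diff lin_B) auto

lemma grid01: "i \<in> {1..m} \<Longrightarrow> 0 \<le> real i / real m" "i \<in> {1..m} \<Longrightarrow> real i / real m \<le> 1"
  by auto

lemma cov_increments:
  assumes "0 \<le> s" "s \<le> 1" "0 \<le> t" "t \<le> 1"
  shows "expectation (\<lambda>\<omega>. (B 1 \<omega> - B t \<omega>) * (B 1 \<omega> - B s \<omega>))
    = ((1 - t) powr (2 * H) + (1 - s) powr (2 * H) - \<bar>t - s\<bar> powr (2 * H)) / 2"
proof -
  have "expectation (\<lambda>\<omega>. ((B 1 \<omega> - B t \<omega>) - (B 1 \<omega> - B s \<omega>))\<^sup>2) = expectation (\<lambda>\<omega>. (B s \<omega> - B t \<omega>)\<^sup>2)"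
    by (intro Bochner_Integration.integral_cong) auto
  then show ?thesis
    using lin_diff_sq[of "\<lambda>\<omega>. B 1 \<omega> - B t \<omega>" "\<lambda>\<omega>. B 1 \<omega> - B s \<omega>"] assms
    by (simp add: lin_diff lin_B var_increment abs_minus_commute[of s t])
qed

text \<open>The bound involves \<open>t\<close> alone, uniformly in \<open>s\<close>, because the
  two terms that contain \<open>s\<close> nearly cancel as t tends to 1. This asymmetry makes the
  covariance of a late member of the sequence with a fixed one small.\<close>

lemma cov_increments_le:
  assumes "0 \<le> s" "s \<le> 1" "0 \<le> t" "t \<le> 1"
  shows "\<bar>expectation (\<lambda>\<omega>. (B 1 \<omega> - B t \<omega>) * (B 1 \<omega> - B s \<omega>))\<bar> \<le> 2 * (1 - t)"
proof -
  have "\<bar>(1 - s) powr (2 * H) - \<bar>t - s\<bar> powr (2 * H)\<bar> \<le> 2 * \<bar>(1 - s) - \<bar>t - s\<bar>\<bar>"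
    using assms H by (intro powr_lipschitz_01) auto
  also have "\<bar>(1 - s) - \<bar>t - s\<bar>\<bar> \<le> 1 - t" using assms by linarith
  finally have "\<bar>(1 - s) powr (2 * H) - \<bar>t - s\<bar> powr (2 * H)\<bar> \<le> 2 * (1 - t)" by simp
  moreover have "(1 - t) powr (2 * H) \<le> 1 - t" "0 \<le> (1 - t) powr (2 * H)" using assms by (auto intro!: hurst_powr)
  ultimately show ?thesis unfolding cov_increments[OF assms] using assms(4) by argo
qed

lemma powr_H_div: "1 \<le> n \<Longrightarrow> real n powr H * (1 / real n) = real n powr (H - 1)"
  by (simp add: powr_diff)

text \<open>Averaging \<open>cov_increments_le\<close> over the first grid gives 1/n, while the
  second grid contributes only its total mass 1. The bound vanishes as \<open>n\<close> grows with
  \<open>n'\<close> fixed, which is all that the orthogonality argument asks for.\<close>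

lemma lin_grid_cov_le:
  assumes "1 \<le> n" "1 \<le> m" "1 \<le> n'" "1 \<le> m'"
  shows "\<bar>expectation (\<lambda>\<omega>. lin_grid n m \<omega> * lin_grid n' m' \<omega>)\<bar> \<le> 2 * real n' powr H * real n powr (H - 1)"
proof -
  let ?E = "\<lambda>i j. expectation (\<lambda>\<omega>. (B 1 \<omega> - B (real i / real m) \<omega>) * (B 1 \<omega> - B (real j / real m') \<omega>))"
  have eq: "expectation (\<lambda>\<omega>. lin_grid n m \<omega> * lin_grid n' m' \<omega>)
     = (\<Sum>i=1..m. (real n powr H * grid_weight n m i) * (\<Sum>j=1..m'. (real n' powr H * grid_weight n' m' j) * ?E i j))"
    unfolding lin_grid_def by (intro lin_sum_mult lin_diff lin_B) auto
  have "\<bar>expectation (\<lambda>\<omega>. lin_grid n m \<omega> * lin_grid n' m' \<omega>)\<bar> \<le> (\<Sum>i=1..m. (real n powr H * grid_weight n m i) * (\<Sum>j=1..m'. (real n' powr H * grid_weight n' m' j) * (2 * (1 - real i / real m))))"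
    unfolding eq
  proof (rule order_trans[OF sum_abs sum_mono])
    fix i assume i: "i \<in> {1..m}"
    have "\<bar>\<Sum>j=1..m'. (real n' powr H * grid_weight n' m' j) * ?E i j\<bar>
       \<le> (\<Sum>j=1..m'. (real n' powr H * grid_weight n' m' j) * (2 * (1 - real i / real m)))"
    proof (rule order_trans[OF sum_abs sum_mono])
      fix j assume j: "j \<in> {1..m'}"
      have "\<bar>?E i j\<bar> \<le> 2 * (1 - real i / real m)" by (intro cov_increments_le grid01 i j)
      then show "\<bar>(real n' powr H * grid_weight n' m' j) * ?E i j\<bar> \<le> (real n' powr H * grid_weight n' m' j) * (2 * (1 - real i / real m))"
        using grid_weight_nonneg[of j n' m'] j unfolding abs_mult by (intro mult_mono) auto
    qed
    then show "\<bar>(real n powr H * grid_weight n m i) * (\<Sum>j=1..m'. (real n' powr H * grid_weight n' m' j) * ?E i j)\<bar>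
      \<le> (real n powr H * grid_weight n m i) * (\<Sum>j=1..m'. (real n' powr H * grid_weight n' m' j) * (2 * (1 - real i / real m)))"
      using grid_weight_nonneg[of i n m] i unfolding abs_mult[of "real n powr H * grid_weight n m i"] by (intro mult_mono) auto
  qed
  also have "\<dots> = (\<Sum>i=1..m. 2 * real n' powr H * real n powr H * (grid_weight n m i * (1 - real i / real m)))"
  proof (rule sum.cong[OF refl])
    fix i
    have "(\<Sum>j=1..m'. (real n' powr H * grid_weight n' m' j) * (2 * (1 - real i / real m))) = real n' powr H * (2 * (1 - real i / real m))"
      by (simp only: sum_distrib_right[symmetric] sum_distrib_left[symmetric] sum_grid_weight[OF assms(3,4)] mult_1_right)
    then show "(real n powr H * grid_weight n m i) * (\<Sum>j=1..m'. (real n' powr H * grid_weight n' m' j) * (2 * (1 - real i / real m)))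
      = 2 * real n' powr H * real n powr H * (grid_weight n m i * (1 - real i / real m))"
      by (simp only: mult_ac)
  qed
  also have "\<dots> = 2 * real n' powr H * real n powr H * (\<Sum>i=1..m. grid_weight n m i * (1 - real i / real m))"
    by (simp only: sum_distrib_left)
  also have "\<dots> \<le> 2 * real n' powr H * real n powr H * (1 / real n)"
    using sum_grid_weight_complement_le[OF assms(1,2)] by (intro mult_left_mono) auto
  finally show ?thesis using powr_H_div[OF assms(1)] by (simp only: mult.assoc)
qed

text \<open>After expansion by \<open>cov_increments\<close> the two one-point terms give equal
  sums, because the weights add up to 1. What remains is the expression of
  \<open>grid_variance_asymp\<close> at \<open>a = 2 * H\<close>.\<close>

lemma lin_grid_var:
  assumes "1 \<le> n" "1 \<le> m"
  shows "\<bar>expectation (\<lambda>\<omega>. (lin_grid n m \<omega>)\<^sup>2) - (c_const H)\<^sup>2\<bar> \<le> 7 * Gamma (2 * H + 1) / real n + 4 * (real n)\<^sup>2 / real m"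
proof -
  let ?w = "grid_weight n m"
  let ?p = "\<lambda>i. (1 - real i / real m) powr (2 * H)"
  let ?d = "\<lambda>i j. \<bar>real i / real m - real j / real m\<bar> powr (2 * H)"
  let ?N = "real n powr H"
  let ?P = "\<Sum>j=1..m. ?w j * ?p j"
  let ?D = "\<lambda>i. \<Sum>j=1..m. ?w j * ?d i j"
  have "expectation (\<lambda>\<omega>. (lin_grid n m \<omega>)\<^sup>2)
    = (\<Sum>i=1..m. (?N * ?w i) * (\<Sum>j=1..m. (?N * ?w j) * expectation (\<lambda>\<omega>. (B 1 \<omega> - B (real i / real m) \<omega>) * (B 1 \<omega> - B (real j / real m) \<omega>))))"
    unfolding lin_grid_def power2_eq_square by (intro lin_sum_mult lin_diff lin_B) auto
  also have "\<dots> = (\<Sum>i=1..m. (?N * ?w i) * (\<Sum>j=1..m. (?N * ?w j) * ((?p i + ?p j - ?d i j) / 2)))"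
    by (intro sum.cong refl arg_cong2[where f = "(*)"] cov_increments grid01)
  also have "\<dots> = (\<Sum>i=1..m. (?N * ?w i) * (?N / 2 * (?p i + ?P - ?D i)))"
  proof (intro sum.cong refl arg_cong2[where f = "(*)"])
    fix i
    have "(\<Sum>j=1..m. (?N * ?w j) * ((?p i + ?p j - ?d i j) / 2)) = (\<Sum>j=1..m. ?N / 2 * (?p i * ?w j + ?w j * ?p j - ?w j * ?d i j))"
      by (intro sum.cong) (auto simp: algebra_simps add_divide_distrib diff_divide_distrib)
    also have "\<dots> = ?N / 2 * (?p i * (\<Sum>j=1..m. ?w j) + ?P - ?D i)"
      by (simp only: sum_distrib_left[symmetric] sum.distrib sum_subtractf)
    finally show "(\<Sum>j=1..m. (?N * ?w j) * ((?p i + ?p j - ?d i j) / 2)) = ?N / 2 * (?p i + ?P - ?D i)"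
      using sum_grid_weight[OF assms] by simp
  qed
  also have "\<dots> = (\<Sum>i=1..m. ?N * ?N / 2 * (?w i * ?p i + ?P * ?w i - ?w i * ?D i))"
    by (intro sum.cong) (auto simp: algebra_simps)
  also have "\<dots> = ?N * ?N / 2 * (?P + ?P * (\<Sum>i=1..m. ?w i) - (\<Sum>i=1..m. ?w i * ?D i))"
    by (simp only: sum_distrib_left[symmetric] sum.distrib sum_subtractf)
  also have "\<dots> = real n powr (2 * H) * (?P - (\<Sum>i=1..m. ?w i * ?D i) / 2)"
    using sum_grid_weight[OF assms] by (simp add: powr_add[symmetric] field_simps)
  finally show ?thesis
    using grid_variance_asymp[OF assms, of "2 * H"] H c_const_sq(1)[OF H] by simp
qed

section \<open>The discretized functional\<close>

text \<open>This and the next two definitions are the alpha, beta and gamma of the overview,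
  discretized: the coefficients of B_1^2, of B_1 and of 1 once the projection onto B_1 is inserted.
  In \<open>lin_coeff\<close> the factor 2 of the mixed term has cancelled the 1/2 of the
  prefactor.\<close>

definition quad_coeff :: "nat \<Rightarrow> nat \<Rightarrow> real" where
  "quad_coeff n m = real n powr H / 2 * (\<Sum>i=1..m. grid_weight n m i * (1 - (rho (real i / real m))\<^sup>2))"

definition lin_coeff :: "nat \<Rightarrow> nat \<Rightarrow> 'a \<Rightarrow> real" where
  "lin_coeff n m \<omega> = (\<Sum>i=1..m. (- (real n powr H) * grid_weight n m i * rho (real i / real m)) * resid (real i / real m) \<omega>)"

definition remainder :: "nat \<Rightarrow> nat \<Rightarrow> 'a \<Rightarrow> real" where
  "remainder n m \<omega> = (\<Sum>i=1..m. (- (real n powr H / 2) * grid_weight n m i) * (resid (real i / real m) \<omega>)\<^sup>2)"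

lemma quad_grid_decomp:
  "quad_grid n m \<omega> = quad_coeff n m * (B 1 \<omega>)\<^sup>2 + lin_coeff n m \<omega> * B 1 \<omega> + remainder n m \<omega>"
proof -
  have "grid_weight n m i * ((B 1 \<omega>)\<^sup>2 - (B (real i / real m) \<omega>)\<^sup>2)
      = grid_weight n m i * (1 - (rho (real i / real m))\<^sup>2) * (B 1 \<omega>)\<^sup>2
      - 2 * (grid_weight n m i * rho (real i / real m) * resid (real i / real m) \<omega>) * B 1 \<omega>
      - grid_weight n m i * (resid (real i / real m) \<omega>)\<^sup>2" for i
    by (simp add: resid_def power2_eq_square algebra_simps)
  then have "quad_grid n m \<omega> = real n powr H / 2 * ((\<Sum>i=1..m. grid_weight n m i * (1 - (rho (real i / real m))\<^sup>2)) * (B 1 \<omega>)\<^sup>2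
      - 2 * (\<Sum>i=1..m. grid_weight n m i * rho (real i / real m) * resid (real i / real m) \<omega>) * B 1 \<omega>
      - (\<Sum>i=1..m. grid_weight n m i * (resid (real i / real m) \<omega>)\<^sup>2))"
    unfolding quad_grid_def by (simp only: sum_subtractf sum_distrib_right[symmetric] sum_distrib_left[symmetric])
  moreover have "lin_coeff n m \<omega> = - (real n powr H) * (\<Sum>i=1..m. grid_weight n m i * rho (real i / real m) * resid (real i / real m) \<omega>)"
    unfolding lin_coeff_def sum_distrib_left by (simp only: mult.assoc)
  moreover have "remainder n m \<omega> = - (real n powr H / 2) * (\<Sum>i=1..m. grid_weight n m i * (resid (real i / real m) \<omega>)\<^sup>2)"
    unfolding remainder_def sum_distrib_left by (simp only: mult.assoc)
  ultimately show ?thesis unfolding quad_coeff_def by (simp add: algebra_simps)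
qed

lemma sum_rho_le:
  assumes "1 \<le> n" "1 \<le> m"
  shows "0 \<le> real n powr H * (\<Sum>i=1..m. grid_weight n m i * (1 - rho (real i / real m)))"
    and "real n powr H * (\<Sum>i=1..m. grid_weight n m i * (1 - rho (real i / real m))) \<le> 3 / 2 * real n powr (H - 1)"
proof -
  show "0 \<le> real n powr H * (\<Sum>i=1..m. grid_weight n m i * (1 - rho (real i / real m)))"
    by (intro mult_nonneg_nonneg sum_nonneg grid_weight_nonneg rho_bounds grid01) auto
  have "(\<Sum>i=1..m. grid_weight n m i * (1 - rho (real i / real m))) \<le> (\<Sum>i=1..m. grid_weight n m i * (3 / 2 * (1 - real i / real m)))"
    by (intro sum_mono mult_left_mono grid_weight_nonneg rho_bounds grid01) auto
  also have "\<dots> = 3 / 2 * (\<Sum>i=1..m. grid_weight n m i * (1 - real i / real m))"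
    by (simp only: sum_distrib_left mult.left_commute)
  also have "\<dots> \<le> 3 / 2 * (1 / real n)" using sum_grid_weight_complement_le[OF assms] by (intro mult_left_mono) auto
  finally have "real n powr H * (\<Sum>i=1..m. grid_weight n m i * (1 - rho (real i / real m))) \<le> real n powr H * (3 / 2 * (1 / real n))"
    by (intro mult_left_mono) auto
  then show "real n powr H * (\<Sum>i=1..m. grid_weight n m i * (1 - rho (real i / real m))) \<le> 3 / 2 * real n powr (H - 1)"
    using powr_H_div[OF assms(1)] by (simp only: mult.left_commute)
qed

lemma quad_coeff_bounds:
  assumes "1 \<le> n" "1 \<le> m"
  shows "\<bar>quad_coeff n m\<bar> \<le> 3 / 2 * real n powr (H - 1)"
proof -
  have pw: "0 \<le> 1 - (rho t)\<^sup>2" "1 - (rho t)\<^sup>2 \<le> 2 * (1 - rho t)" if t: "0 \<le> t" "t \<le> 1" for t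
  proof -
    have "1 - (rho t)\<^sup>2 = (1 - rho t) * (1 + rho t)" by (simp add: power2_eq_square algebra_simps)
    then show "0 \<le> 1 - (rho t)\<^sup>2" using rho_bounds[OF t] by simp
    have "(1 - rho t) * (1 + rho t) \<le> (1 - rho t) * 2" using rho_bounds[OF t] by (intro mult_left_mono) auto
    then show "1 - (rho t)\<^sup>2 \<le> 2 * (1 - rho t)" using \<open>1 - (rho t)\<^sup>2 = _\<close> by simp
  qed
  have nn: "0 \<le> quad_coeff n m" unfolding quad_coeff_def
    by (intro mult_nonneg_nonneg sum_nonneg grid_weight_nonneg pw grid01) auto
  have "quad_coeff n m \<le> real n powr H / 2 * (\<Sum>i=1..m. grid_weight n m i * (2 * (1 - rho (real i / real m))))"
    unfolding quad_coeff_def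
    by (intro mult_left_mono sum_mono grid_weight_nonneg pw grid01) auto
  also have "\<dots> = real n powr H * (\<Sum>i=1..m. grid_weight n m i * (1 - rho (real i / real m)))"
    unfolding mult.left_commute[of _ 2] sum_distrib_left[symmetric] by simp
  also note sum_rho_le(2)[OF assms]
  finally show ?thesis using nn by (simp only: abs_of_nonneg)
qed

lemma integrable_remainder: "integrable P (remainder n m)"
  unfolding remainder_def[abs_def]
  by (intro Bochner_Integration.integrable_sum integrable_mult_right lin_integrable_sq resid_lin) auto

text \<open>The remainder is never positive, so its L^1 norm is an expectation, linear in the
  variances of the residuals.\<close>

lemma remainder_bound:
  assumes "1 \<le> n" "1 \<le> m"
  shows "expectation (\<lambda>\<omega>. \<bar>remainder n m \<omega>\<bar>) \<le> 1 / 2 * real n powr (H - 1)"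
proof -
  have "remainder n m \<omega> \<le> 0" for \<omega>
    unfolding remainder_def using grid_weight_nonneg
    by (intro sum_nonpos) (auto intro!: mult_nonneg_nonneg)
  then have "expectation (\<lambda>\<omega>. \<bar>remainder n m \<omega>\<bar>) = expectation (\<lambda>\<omega>. - remainder n m \<omega>)" by simp
  also have "\<dots> = (\<Sum>i=1..m. (real n powr H / 2 * grid_weight n m i) * expectation (\<lambda>\<omega>. (resid (real i / real m) \<omega>)\<^sup>2))"
  proof -
    have eq: "- remainder n m \<omega> = (\<Sum>i=1..m. (real n powr H / 2 * grid_weight n m i) * (resid (real i / real m) \<omega>)\<^sup>2)" for \<omega>
      unfolding remainder_def by (simp add: sum_negf)
    show ?thesis
      unfolding eq using lin_integrable_sq[OF resid_lin] by (subst Bochner_Integration.integral_sum) auto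
  qed
  also have "\<dots> \<le> (\<Sum>i=1..m. (real n powr H / 2 * grid_weight n m i) * (1 - real i / real m))"
    using grid_weight_nonneg by (intro sum_mono mult_left_mono resid_var grid01) auto
  also have "\<dots> = real n powr H / 2 * (\<Sum>i=1..m. grid_weight n m i * (1 - real i / real m))"
    by (simp only: sum_distrib_left mult.assoc)
  also have "\<dots> \<le> real n powr H / 2 * (1 / real n)"
    using sum_grid_weight_complement_le[OF assms] by (intro mult_left_mono) auto
  finally show ?thesis using powr_H_div[OF assms(1)] by simp
qed

lemma lin_coeff_lin: "lin_coeff n m \<in> lin"
  unfolding lin_coeff_def[abs_def] by (intro lin_sum_scale resid_lin) auto

text \<open>Both variables equal the same weighted sum -b of residuals up to a correction:
  \<open>\<kappa> * B 1\<close> for \<open>lin_grid\<close> and \<open>d\<close> for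
  \<open>lin_coeff\<close>. Both corrections have L^2 norm at most \<open>\<kappa>\<close>, of order
  n^(H-1). This carries the variance asymptotics of \<open>lin_grid\<close> over to the coefficient
  that is used in the conditioning.\<close>

lemma lin_coeff_var:
  assumes "1 \<le> n" "1 \<le> m"
  shows "\<bar>expectation (\<lambda>\<omega>. (lin_coeff n m \<omega>)\<^sup>2) - expectation (\<lambda>\<omega>. (lin_grid n m \<omega>)\<^sup>2)\<bar>
    \<le> 3 / 2 * real n powr (H - 1) * (4 + expectation (\<lambda>\<omega>. (lin_grid n m \<omega>)\<^sup>2))"
proof -
  let ?w = "\<lambda>i. real n powr H * grid_weight n m i"
  let ?r = "\<lambda>i. rho (real i / real m)"
  let ?Y = "\<lambda>i. resid (real i / real m)"
  define \<kappa> where "\<kappa> = real n powr H * (\<Sum>i=1..m. grid_weight n m i * (1 - ?r i))"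
  define K where "K = 3 / 2 * real n powr (H - 1)"
  have \<kappa>: "0 \<le> \<kappa>" "\<kappa> \<le> K" unfolding \<kappa>_def K_def by (rule sum_rho_le[OF assms])+
  have K0: "0 < K" using assms by (simp add: K_def)
  have "real n powr (H - 1) \<le> real n powr 0" using assms H by (intro powr_mono) auto
  then have K2: "K \<le> 3 / 2" using assms by (simp add: K_def)
  define b where "b \<omega> = (\<Sum>i=1..m. ?w i * ?Y i \<omega>)" for \<omega>
  define d where "d \<omega> = (\<Sum>i=1..m. (?w i * (1 - ?r i)) * ?Y i \<omega>)" for \<omega>
  have b_lin: "b \<in> lin" unfolding b_def[abs_def] by (intro lin_sum_scale resid_lin) auto
  have d_lin: "d \<in> lin" unfolding d_def[abs_def] by (intro lin_sum_scale resid_lin) auto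
  have kap: "(\<Sum>i=1..m. ?w i * (1 - ?r i)) = \<kappa>" unfolding \<kappa>_def by (simp only: sum_distrib_left mult.assoc)
  have e1: "lin_grid n m \<omega> = \<kappa> * B 1 \<omega> - b \<omega>" for \<omega>
  proof -
    have "?w i * (B 1 \<omega> - B (real i / real m) \<omega>) = (?w i * (1 - ?r i)) * B 1 \<omega> - ?w i * ?Y i \<omega>" for i
      by (simp add: resid_def algebra_simps)
    then show ?thesis unfolding lin_grid_def b_def kap[symmetric] by (simp only: sum_subtractf sum_distrib_right)
  qed
  have e2: "lin_coeff n m \<omega> = d \<omega> - b \<omega>" for \<omega>
    unfolding lin_coeff_def d_def b_def sum_subtractf[symmetric] by (intro sum.cong) (auto simp: algebra_simps)
  have Ed: "expectation (\<lambda>\<omega>. (d \<omega>)\<^sup>2) \<le> \<kappa>\<^sup>2"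
    unfolding d_def kap[symmetric]
  proof (rule lin_sum_sq_le)
    fix i assume i: "i \<in> {1..m}"
    show "?Y i \<in> lin" by (intro resid_lin) auto
    show "0 \<le> ?w i * (1 - ?r i)" using i by (intro mult_nonneg_nonneg grid_weight_nonneg rho_bounds grid01) auto
    show "expectation (\<lambda>\<omega>. (?Y i \<omega>)\<^sup>2) \<le> 1"
      using resid_var[of "real i / real m"] grid01[OF i] by linarith
  qed simp
  have Eb1: "expectation (\<lambda>\<omega>. B 1 \<omega> * b \<omega>) = 0"
  proof -
    have "expectation (\<lambda>\<omega>. B 1 \<omega> * b \<omega>) = expectation (\<lambda>\<omega>. \<Sum>i=1..m. ?w i * (B 1 \<omega> * ?Y i \<omega>))"
      unfolding b_def sum_distrib_left by (simp only: mult.left_commute)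
    also have "\<dots> = (\<Sum>i=1..m. ?w i * expectation (\<lambda>\<omega>. B 1 \<omega> * ?Y i \<omega>))"
      using lin_integrable_mult[OF lin_B resid_lin] by (subst Bochner_Integration.integral_sum) auto
    also have "\<dots> = 0" by (intro sum.neutral ballI) (simp add: resid_orth)
    finally show ?thesis .
  qed
  have v: "expectation (\<lambda>\<omega>. (lin_grid n m \<omega>)\<^sup>2) = \<kappa>\<^sup>2 + expectation (\<lambda>\<omega>. (b \<omega>)\<^sup>2)"
  proof -
    have "expectation (\<lambda>\<omega>. (lin_grid n m \<omega>)\<^sup>2)
      = expectation (\<lambda>\<omega>. (\<kappa> * B 1 \<omega>)\<^sup>2) + expectation (\<lambda>\<omega>. (b \<omega>)\<^sup>2) - 2 * expectation (\<lambda>\<omega>. \<kappa> * B 1 \<omega> * b \<omega>)"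
      unfolding e1 by (intro lin_diff_sq lin_scale lin_B b_lin) auto
    then show ?thesis by (simp add: power_mult_distrib var_B1 mult.assoc Eb1)
  qed
  have Eb0: "0 \<le> expectation (\<lambda>\<omega>. (b \<omega>)\<^sup>2)" by (intro integral_nonneg_AE) auto
  have Ed0: "0 \<le> expectation (\<lambda>\<omega>. (d \<omega>)\<^sup>2)" by (intro integral_nonneg_AE) auto
  have \<kappa>2: "\<kappa>\<^sup>2 \<le> K * K" using \<kappa> unfolding power2_eq_square by (intro mult_mono) auto
  have KK: "K * K \<le> K * (3 / 2)" using K0 K2 by (intro mult_left_mono) auto
  have s: "expectation (\<lambda>\<omega>. (lin_coeff n m \<omega>)\<^sup>2)
      = expectation (\<lambda>\<omega>. (d \<omega>)\<^sup>2) + expectation (\<lambda>\<omega>. (b \<omega>)\<^sup>2) - 2 * expectation (\<lambda>\<omega>. d \<omega> * b \<omega>)"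
    unfolding e2 by (intro lin_diff_sq d_lin b_lin)
  \<comment> \<open>Cauchy-Schwarz with a weight, from the squares of \<open>d + K * b\<close> and
    \<open>d - K * b\<close>. The weight \<open>K\<close> is the bound on the norm of
    \<open>d\<close>; the inequality is kept multiplied by \<open>K\<close>, which is cancelled at
    the end.\<close>
  have cross: "\<bar>2 * expectation (\<lambda>\<omega>. d \<omega> * b \<omega>)\<bar> \<le> K * (1 + expectation (\<lambda>\<omega>. (b \<omega>)\<^sup>2))"
  proof -
    have KE: "expectation (\<lambda>\<omega>. d \<omega> * (K * b \<omega>)) = K * expectation (\<lambda>\<omega>. d \<omega> * b \<omega>)"
      by (simp add: mult.left_commute)
    have Kb: "expectation (\<lambda>\<omega>. (K * b \<omega>)\<^sup>2) = K * K * expectation (\<lambda>\<omega>. (b \<omega>)\<^sup>2)"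
      unfolding power_mult_distrib power2_eq_square[of K] by (rule integral_mult_right_zero)
    have "0 \<le> expectation (\<lambda>\<omega>. (d \<omega> + K * b \<omega>)\<^sup>2)" "0 \<le> expectation (\<lambda>\<omega>. (d \<omega> - K * b \<omega>)\<^sup>2)"
      by (intro integral_nonneg_AE; auto)+
    then have "\<bar>2 * (K * expectation (\<lambda>\<omega>. d \<omega> * b \<omega>))\<bar> \<le> expectation (\<lambda>\<omega>. (d \<omega>)\<^sup>2) + K * K * expectation (\<lambda>\<omega>. (b \<omega>)\<^sup>2)"
      unfolding lin_add_sq[OF d_lin lin_scale[OF b_lin]] lin_diff_sq[OF d_lin lin_scale[OF b_lin]] KE Kb by linarith
    also have "\<dots> \<le> K * K + K * K * expectation (\<lambda>\<omega>. (b \<omega>)\<^sup>2)" using Ed \<kappa>2 by linarith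
    finally have "K * \<bar>2 * expectation (\<lambda>\<omega>. d \<omega> * b \<omega>)\<bar> \<le> K * (K * (1 + expectation (\<lambda>\<omega>. (b \<omega>)\<^sup>2)))"
      using K0 by (simp add: abs_mult algebra_simps)
    then show ?thesis using K0 by (simp only: mult_le_cancel_left_pos)
  qed
  \<comment> \<open>The 4 is 3/2 + 3/2 + 1: twice \<open>K * K \<le> K * (3 / 2)\<close>, for the
    second moment of \<open>d\<close> and for the square of \<open>\<kappa>\<close>, and the 1 of
    the cross term.\<close>
  have "\<bar>expectation (\<lambda>\<omega>. (lin_coeff n m \<omega>)\<^sup>2) - expectation (\<lambda>\<omega>. (lin_grid n m \<omega>)\<^sup>2)\<bar>
     \<le> K * (3 / 2) + K * (3 / 2) + K * (1 + expectation (\<lambda>\<omega>. (b \<omega>)\<^sup>2))"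
    unfolding s v using cross Ed \<kappa>2 KK Ed0 zero_le_power2[of \<kappa>] by linarith
  also have "\<dots> = K * (4 + expectation (\<lambda>\<omega>. (b \<omega>)\<^sup>2))" by (simp add: algebra_simps)
  also have "\<dots> \<le> K * (4 + expectation (\<lambda>\<omega>. (lin_grid n m \<omega>)\<^sup>2))"
    unfolding v using K0 by (intro mult_left_mono) auto
  finally show ?thesis unfolding K_def .
qed

text \<open>A linear combination of residuals is orthogonal to B_1, and its sum with a multiple of
  B_1 lies in \<open>lin\<close>; so the characteristic function of that sum splits. Independence is
  proved for the whole residual vector because the remainder is quadratic in it.\<close>

lemma grid_independence:
  "distr P borel (B 1) \<Otimes>\<^sub>M distr P (borel \<Otimes>\<^sub>M borel) (\<lambda>\<omega>. (lin_coeff n m \<omega>, remainder n m \<omega>))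
    = distr P (borel \<Otimes>\<^sub>M (borel \<Otimes>\<^sub>M borel)) (\<lambda>\<omega>. (B 1 \<omega>, (lin_coeff n m \<omega>, remainder n m \<omega>)))"
proof -
  let ?Y = "\<lambda>i. resid (real i / real m)"
  let ?J = "{1..m}"
  define g where "g y = ((\<Sum>i=1..m. (- (real n powr H) * grid_weight n m i * rho (real i / real m)) * y i),
     (\<Sum>i=1..m. (- (real n powr H / 2) * grid_weight n m i) * (y i)\<^sup>2))" for y :: "nat \<Rightarrow> real"
  have gY: "g (\<lambda>i\<in>?J. ?Y i \<omega>) = (lin_coeff n m \<omega>, remainder n m \<omega>)" for \<omega>
    by (simp add: g_def lin_coeff_def remainder_def)
  have "distr P borel (B 1) \<Otimes>\<^sub>M distr P (borel \<Otimes>\<^sub>M borel) (\<lambda>\<omega>. g (\<lambda>i\<in>?J. ?Y i \<omega>))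
    = distr P (borel \<Otimes>\<^sub>M (borel \<Otimes>\<^sub>M borel)) (\<lambda>\<omega>. (B 1 \<omega>, g (\<lambda>i\<in>?J. ?Y i \<omega>)))"
  proof (rule indep_vector_of_char_factorization)
    show "B 1 \<in> borel_measurable P" by (intro lin_measurable lin_B) auto
    show "?Y j \<in> borel_measurable P" for j by (intro lin_measurable resid_lin) auto
    show "g \<in> Pi\<^sub>M ?J (\<lambda>_. borel) \<rightarrow>\<^sub>M borel \<Otimes>\<^sub>M borel"
      unfolding g_def[abs_def] by measurable
    fix s :: real and r :: "nat \<Rightarrow> real"
    define S where "S \<omega> = (\<Sum>j\<in>?J. r j * ?Y j \<omega>)" for \<omega>
    have S_lin: "S \<in> lin" unfolding S_def[abs_def] by (intro lin_sum_scale resid_lin) auto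
    have sB: "(\<lambda>\<omega>. s * B 1 \<omega>) \<in> lin" by (intro lin_scale lin_B) auto
    have orth: "expectation (\<lambda>\<omega>. s * B 1 \<omega> * S \<omega>) = 0"
    proof -
      have "expectation (\<lambda>\<omega>. s * B 1 \<omega> * S \<omega>) = expectation (\<lambda>\<omega>. \<Sum>j\<in>?J. s * r j * (B 1 \<omega> * ?Y j \<omega>))"
        unfolding S_def sum_distrib_left by (simp only: mult_ac)
      also have "\<dots> = (\<Sum>j\<in>?J. s * r j * expectation (\<lambda>\<omega>. B 1 \<omega> * ?Y j \<omega>))"
        using lin_integrable_mult[OF lin_B resid_lin] by (subst Bochner_Integration.integral_sum) auto
      also have "\<dots> = 0" by (intro sum.neutral ballI) (simp add: resid_orth)
      finally show ?thesis .
    qed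
    have "(\<integral>\<omega>. iexp (s * B 1 \<omega>) * iexp (S \<omega>) \<partial>P) = (\<integral>\<omega>. iexp (s * B 1 \<omega> + S \<omega>) \<partial>P)"
      by (simp add: exp_add[symmetric] distrib_left)
    also have "\<dots> = complex_of_real (exp (- expectation (\<lambda>\<omega>. (s * B 1 \<omega> + S \<omega>)\<^sup>2) / 2))"
      by (rule lin_char[OF lin_add[OF sB S_lin]])
    also have "expectation (\<lambda>\<omega>. (s * B 1 \<omega> + S \<omega>)\<^sup>2) = expectation (\<lambda>\<omega>. (s * B 1 \<omega>)\<^sup>2) + expectation (\<lambda>\<omega>. (S \<omega>)\<^sup>2)"
      using lin_add_sq[OF sB S_lin] orth by simp
    also have "complex_of_real (exp (- (expectation (\<lambda>\<omega>. (s * B 1 \<omega>)\<^sup>2) + expectation (\<lambda>\<omega>. (S \<omega>)\<^sup>2)) / 2))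
       = complex_of_real (exp (- expectation (\<lambda>\<omega>. (s * B 1 \<omega>)\<^sup>2) / 2)) * complex_of_real (exp (- expectation (\<lambda>\<omega>. (S \<omega>)\<^sup>2) / 2))"
      by (simp only: of_real_mult[symmetric] exp_add[symmetric]) (simp add: add_divide_distrib diff_divide_distrib)
    also have "\<dots> = (\<integral>\<omega>. iexp (s * B 1 \<omega>) \<partial>P) * (\<integral>\<omega>. iexp (S \<omega>) \<partial>P)"
      by (simp only: lin_char[OF sB] lin_char[OF S_lin])
    finally show "(\<integral>\<omega>. iexp (s * B 1 \<omega>) * iexp (\<Sum>j\<in>?J. r j * ?Y j \<omega>) \<partial>P)
       = (\<integral>\<omega>. iexp (s * B 1 \<omega>) \<partial>P) * (\<integral>\<omega>. iexp (\<Sum>j\<in>?J. r j * ?Y j \<omega>) \<partial>P)"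
      unfolding S_def .
  qed simp
  then show ?thesis unfolding gY .
qed

section \<open>Total variation bound for the Riemann sums\<close>

lemma B1_std_normal: "distributed P lborel (B 1) std_normal_density"
  using lin_normal[OF lin_B, of 1 1] var_B1 by simp

lemma lin_grid_var_cubic:
  assumes n: "1 \<le> n" and m: "n ^ 3 \<le> m"
  shows "\<bar>expectation (\<lambda>\<omega>. (lin_grid n m \<omega>)\<^sup>2) - (c_const H)\<^sup>2\<bar> \<le> (7 * Gamma (2 * H + 1) + 4) * real n powr (H - 1)"
proof -
  have n0: "0 < real n" using n by simp
  have nm: "real n ^ 3 \<le> real m" using m by (metis of_nat_le_iff of_nat_power)
  have n3: "0 < real n ^ 3" using n0 by simp
  have m1: "1 \<le> m" using n m by (metis le_trans one_le_power)
  have "(real n)\<^sup>2 / real m \<le> (real n)\<^sup>2 / real n ^ 3"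
    using nm n3 less_le_trans[OF n3 nm] by (intro divide_left_mono mult_pos_pos) auto
  also have "\<dots> = 1 / real n" using n0 by (simp add: power2_eq_square power3_eq_cube)
  finally have a: "4 * (real n)\<^sup>2 / real m \<le> 4 * (1 / real n)" by simp
  have x: "1 / real n \<le> real n powr (H - 1)"
    using powr_mono[of "-1" "H - 1" "real n"] n H by (simp add: powr_minus_divide)
  have G: "0 < Gamma (2 * H + 1)" using H by (simp add: Gamma_real_pos)
  have "7 * Gamma (2 * H + 1) / real n + 4 * (real n)\<^sup>2 / real m \<le> (7 * Gamma (2 * H + 1) + 4) * (1 / real n)"
    using a by (simp add: add_divide_distrib)
  also have "\<dots> \<le> (7 * Gamma (2 * H + 1) + 4) * real n powr (H - 1)"
    using x G by (intro mult_left_mono) auto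
  finally show ?thesis using lin_grid_var[OF n m1] by linarith
qed

text \<open>The expectation of \<open>f\<close> at \<open>c_const H\<close> times a product of two
  independent standard normal variables. The outer variable \<open>x\<close> stands for B_1, here
  without absolute value.\<close>

definition limit_law :: "(real \<Rightarrow> real) \<Rightarrow> real" where
  "limit_law f = (\<integral>x. (\<integral>y. f (c_const H * x * y) * std_normal_density y \<partial>lborel) * std_normal_density x \<partial>lborel)"

lemma limit_law_01:
  assumes [measurable]: "f \<in> borel_measurable borel" and f: "\<And>x. 0 \<le> f x" "\<And>x. f x \<le> 1"
  shows "0 \<le> limit_law f" "limit_law f \<le> 1"
proof -
  have m: "(\<lambda>x. \<integral>y. f (c_const H * x * y) * std_normal_density y \<partial>lborel) \<in> borel_measurable borel" by measurable
  have i: "0 \<le> (\<integral>y. f (c_const H * x * y) * std_normal_density y \<partial>lborel)"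
    "(\<integral>y. f (c_const H * x * y) * std_normal_density y \<partial>lborel) \<le> 1" for x
    by (rule std_normal_integral_01; use f in auto)+
  show "0 \<le> limit_law f" unfolding limit_law_def by (rule std_normal_integral_01(1)[OF m i])
  show "limit_law f \<le> 1" unfolding limit_law_def by (rule std_normal_integral_01(2)[OF m i])
qed

text \<open>The bound is uniform in \<open>m\<close> and over all measurable tests, so that
  \<open>m\<close> may later tend to infinity for fixed \<open>n\<close>. The argument gives the
  exponent (H-1)/2, and \<open>n \<ge> 1\<close> allows passing to the stated one.\<close>

lemma quad_grid_tv:
  "\<exists>k. \<forall>n\<ge>1. \<forall>m\<ge>n ^ 3. \<forall>f\<in>borel_measurable borel. (\<forall>x. 0 \<le> f x \<and> f x \<le> 1) \<longrightarrow>
    \<bar>expectation (\<lambda>\<omega>. f (quad_grid n m \<omega>)) - limit_law f\<bar> \<le> k * real n powr (- (1 - H) / 15)"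
proof -
  define G where "G = Gamma (2 * H + 1)"
  define c where "c = c_const H"
  have G: "0 < G" using H by (simp add: G_def Gamma_real_pos)
  have c: "0 < c" using c_const_sq(2)[OF H] by (simp add: c_def)
  \<comment> \<open>Chosen so that the variance of \<open>lin_coeff\<close> is within
    \<open>C * x\<close> of c^2. The first summand pays for the passage from
    \<open>lin_grid\<close>, whose variance is at most c^2 + 7G + 4; the second is the error for
    \<open>lin_grid\<close> itself.\<close>
  define C where "C = 3 / 2 * (4 + (c\<^sup>2 + (7 * G + 4))) + (7 * G + 4)"
  have C0: "0 < C" using G by (simp add: C_def add_pos_nonneg)
  \<comment> \<open>\<open>D * x < 1\<close> means that \<open>C * x\<close> is below half of c^2,
    which keeps the variance of \<open>lin_coeff\<close> above c^2 / 2. Otherwise the trivial bound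
    1 is at most \<open>D * x\<close>.\<close>
  define D where "D = 2 * C / c\<^sup>2"
  have D0: "0 < D" using C0 c by (simp add: D_def)
  \<comment> \<open>\<open>D\<close> serves the trivial case. In the other case 2/c comes from
    \<open>c / 2 \<le> \<sigma>\<close>, and 5000 is 2500 times 3/2 + 1/2, the constants for
    \<open>quad_coeff\<close> and \<open>remainder\<close>.\<close>
  define k where "k = D + (2 / c + 5000 + 2500 * (C / c\<^sup>2))"
  have "\<bar>expectation (\<lambda>\<omega>. f (quad_grid n m \<omega>)) - limit_law f\<bar> \<le> k * real n powr (- (1 - H) / 15)"
    if n: "1 \<le> n" and m: "n ^ 3 \<le> m" and f[measurable]: "f \<in> borel_measurable borel" and f01: "\<And>x. 0 \<le> f x" "\<And>x. f x \<le> 1"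
    for n m and f :: "real \<Rightarrow> real"
  proof -
    have n0: "0 < real n" "1 \<le> real n" using n by auto
    have m1: "1 \<le> m" using n m by (metis le_trans one_le_power)
    define x where "x = real n powr (H - 1)"
    \<comment> \<open>The square root of \<open>x\<close>, which equates the orders of
      \<open>\<epsilon>\<close> and \<open>x / \<epsilon>\<close>.\<close>
    define \<epsilon> where "\<epsilon> = real n powr ((H - 1) / 2)"
    have \<epsilon>0: "0 < \<epsilon>" using n0 by (simp add: \<epsilon>_def)
    have x0: "0 < x" using n0 by (simp add: x_def)
    have x\<epsilon>: "x = \<epsilon> * \<epsilon>" using n0 by (simp add: x_def \<epsilon>_def powr_add[symmetric])
    have "real n powr (H - 1) \<le> real n powr ((H - 1) / 2)" using n0 H by (intro powr_mono) auto
    then have xle: "x \<le> \<epsilon>" by (simp add: x_def \<epsilon>_def)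
    have "real n powr ((H - 1) / 2) \<le> real n powr (- (1 - H) / 15)" using n0 H by (intro powr_mono) auto
    then have \<epsilon>le: "\<epsilon> \<le> real n powr (- (1 - H) / 15)" by (simp add: \<epsilon>_def)
    have x1: "x \<le> 1" using powr_mono[of "H - 1" 0 "real n"] n0 H by (simp add: x_def)
    have k0: "0 \<le> k" using D0 c C0 by (simp add: k_def)
    define v where "v = expectation (\<lambda>\<omega>. (lin_grid n m \<omega>)\<^sup>2)"
    define s where "s = expectation (\<lambda>\<omega>. (lin_coeff n m \<omega>)\<^sup>2)"
    define g where "g = 7 * G + 4"
    define T where "T = 3 / 2 * x * (4 + (c\<^sup>2 + g))"
    have v: "\<bar>v - c\<^sup>2\<bar> \<le> g * x"
      using lin_grid_var_cubic[OF n m] by (simp add: v_def c_def G_def x_def g_def)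
    have "g * x \<le> g" using x1 G mult_left_mono[of x 1 g] by (simp add: g_def)
    then have vle: "v \<le> c\<^sup>2 + g" using v by linarith
    have "\<bar>s - v\<bar> \<le> 3 / 2 * x * (4 + v)"
      using lin_coeff_var[OF n m1] by (simp add: s_def v_def x_def)
    also have "\<dots> \<le> T" unfolding T_def using vle x0 by (intro mult_left_mono) auto
    finally have "\<bar>s - c\<^sup>2\<bar> \<le> T + g * x" using v by linarith
    then have s: "\<bar>s - c\<^sup>2\<bar> \<le> C * x" by (simp add: C_def T_def g_def algebra_simps)
    have "\<bar>expectation (\<lambda>\<omega>. f (quad_grid n m \<omega>)) - limit_law f\<bar> \<le> k * \<epsilon>"
    proof (cases "1 \<le> D * x")
      case True
      have [measurable]: "quad_grid n m \<in> borel_measurable P"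
        unfolding quad_grid_def[abs_def] by (intro borel_measurable_times borel_measurable_sum borel_measurable_diff borel_measurable_power borel_measurable_const lin_measurable lin_B) auto
      have "0 \<le> expectation (\<lambda>\<omega>. f (quad_grid n m \<omega>))" using f01 by (intro integral_nonneg_AE) auto
      moreover have "expectation (\<lambda>\<omega>. f (quad_grid n m \<omega>)) \<le> 1"
        using f01 by (intro integral_le_const integrable_const_bound[where B = 1]) auto
      moreover have "0 \<le> limit_law f" "limit_law f \<le> 1" by (rule limit_law_01; use f01 in auto)+
      moreover have "D * x \<le> D * \<epsilon>" using xle D0 by (intro mult_left_mono) auto
      moreover have "D * \<epsilon> \<le> k * \<epsilon>" using \<epsilon>0 c C0 by (intro mult_right_mono) (auto simp: k_def)
      ultimately show ?thesis using True by linarith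
    next
      case False
      then have "C * x < c\<^sup>2 / 2" using c by (simp add: D_def field_simps)
      then have s_lb: "c\<^sup>2 / 2 < s" using s by linarith
      have s0: "0 < s" using s_lb zero_le_power2[of c] by linarith
      define \<sigma> where "\<sigma> = sqrt s"
      have \<sigma>0: "0 < \<sigma>" and \<sigma>s: "\<sigma>\<^sup>2 = s" using s0 by (auto simp: \<sigma>_def)
      have \<sigma>c: "c / 2 \<le> \<sigma>"
      proof (rule power2_le_imp_le)
        have "(c / 2)\<^sup>2 = c\<^sup>2 / 4" by (simp add: power_divide)
        then show "(c / 2)\<^sup>2 \<le> \<sigma>\<^sup>2" using s_lb \<sigma>s zero_le_power2[of c] by linarith
      qed (use \<sigma>0 in simp)
      \<comment> \<open>From variance to standard deviation: the difference of the squares is the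
        difference times \<open>\<sigma> + c\<close>, and this factor is at least
        \<open>c\<close>.\<close>
      have q: "\<bar>\<sigma> / c - 1\<bar> \<le> C / c\<^sup>2 * x"
      proof -
        have "\<bar>\<sigma> - c\<bar> * c \<le> \<bar>\<sigma> - c\<bar> * (\<sigma> + c)" using \<sigma>0 by (intro mult_left_mono) auto
        also have "\<dots> = \<bar>(\<sigma> - c) * (\<sigma> + c)\<bar>" using \<sigma>0 c by (simp add: abs_mult)
        also have "(\<sigma> - c) * (\<sigma> + c) = s - c\<^sup>2" using \<sigma>s by (simp add: power2_eq_square algebra_simps)
        finally have "\<bar>\<sigma> - c\<bar> * c \<le> C * x" using s by linarith
        moreover have "\<bar>\<sigma> / c - 1\<bar> = \<bar>\<sigma> - c\<bar> * c / c\<^sup>2"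
        proof -
          have "\<sigma> / c - 1 = (\<sigma> - c) / c" using c by (simp add: field_simps)
          then have "\<bar>\<sigma> / c - 1\<bar> = \<bar>\<sigma> - c\<bar> / c" using c by simp
          then show ?thesis using c by (simp add: power2_eq_square)
        qed
        ultimately show ?thesis using c by (simp add: divide_right_mono)
      qed
      have \<beta>: "distributed P lborel (lin_coeff n m) (normal_density 0 \<sigma>)"
        by (rule lin_normal[OF lin_coeff_lin \<sigma>0]) (simp add: \<sigma>s s_def)
      have "\<bar>expectation (\<lambda>\<omega>. f (quad_coeff n m * (B 1 \<omega>)\<^sup>2 + lin_coeff n m \<omega> * B 1 \<omega> + remainder n m \<omega>)) - limit_law f\<bar>
        \<le> \<epsilon> / \<sigma> + 2500 * (\<bar>quad_coeff n m\<bar> + expectation (\<lambda>\<omega>. \<bar>remainder n m \<omega>\<bar>)) / \<epsilon> + 2500 * \<bar>\<sigma> / c - 1\<bar>"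
        unfolding limit_law_def c_def[symmetric]
        by (rule std_normal_affine_quadratic_comparison[OF B1_std_normal \<beta> \<sigma>0 integrable_remainder grid_independence f f01 \<epsilon>0 c])
      also have "\<dots> \<le> 2 / c * \<epsilon> + 5000 * \<epsilon> + 2500 * (C / c\<^sup>2) * \<epsilon>"
      proof (intro add_mono)
        have "\<epsilon> / \<sigma> \<le> \<epsilon> / (c / 2)" using \<sigma>c c \<epsilon>0 \<sigma>0 by (intro divide_left_mono) auto
        then show "\<epsilon> / \<sigma> \<le> 2 / c * \<epsilon>" by (simp add: mult.commute)
        have "\<bar>quad_coeff n m\<bar> + expectation (\<lambda>\<omega>. \<bar>remainder n m \<omega>\<bar>) \<le> 2 * x"
          using quad_coeff_bounds[OF n m1] remainder_bound[OF n m1] by (simp add: x_def)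
        then have "2500 * (\<bar>quad_coeff n m\<bar> + expectation (\<lambda>\<omega>. \<bar>remainder n m \<omega>\<bar>)) / \<epsilon> \<le> 2500 * (2 * x) / \<epsilon>"
          using \<epsilon>0 by (intro divide_right_mono mult_left_mono) auto
        also have "\<dots> = 5000 * \<epsilon>" using \<epsilon>0 by (simp add: x\<epsilon>)
        finally show "2500 * (\<bar>quad_coeff n m\<bar> + expectation (\<lambda>\<omega>. \<bar>remainder n m \<omega>\<bar>)) / \<epsilon> \<le> 5000 * \<epsilon>" .
        have "C / c\<^sup>2 * x \<le> C / c\<^sup>2 * \<epsilon>" using xle C0 by (intro mult_left_mono) auto
        then show "2500 * \<bar>\<sigma> / c - 1\<bar> \<le> 2500 * (C / c\<^sup>2) * \<epsilon>" using q by simp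
      qed
      also have "\<dots> = (k - D) * \<epsilon>" by (simp add: k_def algebra_simps)
      also have "\<dots> \<le> k * \<epsilon>" using D0 \<epsilon>0 by (intro mult_right_mono) auto
      finally show ?thesis by (simp only: quad_grid_decomp)
    qed
    also have "\<dots> \<le> k * real n powr (- (1 - H) / 15)" using \<epsilon>le k0 by (intro mult_left_mono) auto
    finally show ?thesis .
  qed
  then show ?thesis by blast
qed

text \<open>B_1^2 - B_t^2 - 2 B_1 (B_1 - B_t) is minus the square of the increment. So the
  difference has one sign, and its L^1 norm is n^H / 2 times an average of increment
  variances.\<close>

lemma quad_grid_product:
  assumes "1 \<le> n" "1 \<le> m"
  shows "integrable P (\<lambda>\<omega>. quad_grid n m \<omega> - B 1 \<omega> * lin_grid n m \<omega>)"
    and "expectation (\<lambda>\<omega>. \<bar>quad_grid n m \<omega> - B 1 \<omega> * lin_grid n m \<omega>\<bar>) \<le> real n powr (H - 1)"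
proof -
  let ?w = "grid_weight n m"
  let ?D = "\<lambda>i \<omega>. B 1 \<omega> - B (real i / real m) \<omega>"
  have eq: "quad_grid n m \<omega> - B 1 \<omega> * lin_grid n m \<omega> = (\<Sum>i=1..m. (- (real n powr H / 2 * ?w i)) * (?D i \<omega>)\<^sup>2)" for \<omega>
  proof -
    have "real n powr H / 2 * (?w i * ((B 1 \<omega>)\<^sup>2 - (B (real i / real m) \<omega>)\<^sup>2)) - B 1 \<omega> * ((real n powr H * ?w i) * ?D i \<omega>)
      = (- (real n powr H / 2 * ?w i)) * (?D i \<omega>)\<^sup>2" for i
      by (simp add: power2_eq_square field_simps)
    then show ?thesis unfolding quad_grid_def lin_grid_def sum_distrib_left sum_subtractf[symmetric] by (simp only:)
  qed
  have D_lin: "?D i \<in> lin" for i by (intro lin_diff lin_B) auto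
  show "integrable P (\<lambda>\<omega>. quad_grid n m \<omega> - B 1 \<omega> * lin_grid n m \<omega>)"
    unfolding eq by (intro Bochner_Integration.integrable_sum integrable_mult_right lin_integrable_sq D_lin)
  have np: "(\<Sum>i=1..m. (- (real n powr H / 2 * ?w i)) * (?D i \<omega>)\<^sup>2) \<le> 0" for \<omega>
    using grid_weight_nonneg by (intro sum_nonpos) (auto intro!: mult_nonneg_nonneg)
  have "expectation (\<lambda>\<omega>. \<bar>quad_grid n m \<omega> - B 1 \<omega> * lin_grid n m \<omega>\<bar>)
     = expectation (\<lambda>\<omega>. \<Sum>i=1..m. (real n powr H / 2 * ?w i) * (?D i \<omega>)\<^sup>2)"
    unfolding eq abs_of_nonpos[OF np] by (simp add: sum_negf)
  also have "\<dots> = (\<Sum>i=1..m. (real n powr H / 2 * ?w i) * expectation (\<lambda>\<omega>. (?D i \<omega>)\<^sup>2))"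
    using lin_integrable_sq[OF D_lin] by (subst Bochner_Integration.integral_sum) auto
  also have "\<dots> \<le> (\<Sum>i=1..m. (real n powr H / 2 * ?w i) * (1 - real i / real m))"
  proof (intro sum_mono mult_left_mono)
    fix i assume i: "i \<in> {1..m}"
    show "expectation (\<lambda>\<omega>. (?D i \<omega>)\<^sup>2) \<le> 1 - real i / real m"
      using grid01[OF i] hurst_powr(1)[of "1 - real i / real m"] by (simp add: var_increment)
    show "0 \<le> real n powr H / 2 * ?w i" using i grid_weight_nonneg by auto
  qed
  also have "\<dots> = real n powr H / 2 * (\<Sum>i=1..m. ?w i * (1 - real i / real m))"
    by (simp only: sum_distrib_left mult.assoc)
  also have "\<dots> \<le> real n powr H / 2 * (1 / real n)"
    using sum_grid_weight_complement_le[OF assms] by (intro mult_left_mono) auto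
  also have "\<dots> \<le> real n powr H * (1 / real n)" by (intro mult_right_mono) auto
  finally show "expectation (\<lambda>\<omega>. \<bar>quad_grid n m \<omega> - B 1 \<omega> * lin_grid n m \<omega>\<bar>) \<le> real n powr (H - 1)"
    using powr_H_div[OF assms(1)] by simp
qed

section \<open>Mixing of the linear part\<close>

text \<open>The mesh \<open>1 / n ^ 3\<close> makes the discretization errors, of order \<open>n ^ 2 / m\<close> and \<open>(n / m) powr H\<close>, vanish.\<close>

definition cubic_grid :: "nat \<Rightarrow> 'a \<Rightarrow> real" where
  "cubic_grid n = lin_grid (Suc n) (Suc n ^ 3)"

lemma cubic_grid_lin: "cubic_grid n \<in> lin"
  unfolding cubic_grid_def by (rule lin_grid_lin)

lemma powr_H_minus_1_null: "(\<lambda>n. real (Suc n) powr (H - 1)) \<longlonglongrightarrow> 0"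
  by (rule tendsto_neg_powr[OF _ filterlim_compose[OF filterlim_real_sequentially filterlim_Suc]]) (use H in simp)

lemma cubic_grid_var: "(\<lambda>n. expectation (\<lambda>\<omega>. (cubic_grid n \<omega>)\<^sup>2)) \<longlonglongrightarrow> (c_const H)\<^sup>2"
proof (rule LIM_zero_cancel, rule tendsto_rabs_zero_cancel, rule real_tendsto_sandwich[OF _ _ tendsto_const])
  show "(\<lambda>n. (7 * Gamma (2 * H + 1) + 4) * real (Suc n) powr (H - 1)) \<longlonglongrightarrow> 0"
    using tendsto_mult_left[OF powr_H_minus_1_null] by simp
  show "\<forall>\<^sub>F n in sequentially. \<bar>expectation (\<lambda>\<omega>. (cubic_grid n \<omega>)\<^sup>2) - (c_const H)\<^sup>2\<bar> \<le> (7 * Gamma (2 * H + 1) + 4) * real (Suc n) powr (H - 1)"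
    unfolding cubic_grid_def by (intro always_eventually allI lin_grid_var_cubic) auto
qed simp

lemma cubic_grid_cov: "(\<lambda>n. expectation (\<lambda>\<omega>. cubic_grid n \<omega> * cubic_grid k \<omega>)) \<longlonglongrightarrow> 0"
proof (rule tendsto_rabs_zero_cancel, rule real_tendsto_sandwich[OF _ _ tendsto_const])
  show "(\<lambda>n. 2 * real (Suc k) powr H * real (Suc n) powr (H - 1)) \<longlonglongrightarrow> 0"
    using tendsto_mult_left[OF powr_H_minus_1_null] by simp
  show "\<forall>\<^sub>F n in sequentially. \<bar>expectation (\<lambda>\<omega>. cubic_grid n \<omega> * cubic_grid k \<omega>)\<bar> \<le> 2 * real (Suc k) powr H * real (Suc n) powr (H - 1)"
    unfolding cubic_grid_def by (intro always_eventually allI lin_grid_cov_le) auto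
qed simp

text \<open>The phase \<open>\<theta>\<close> treats cosine and sine at once; the sine of a centred
  Gaussian variable has mean 0, so only the factor \<open>cos \<theta>\<close> survives.\<close>

lemma lin_cos:
  assumes L: "L \<in> lin"
  shows "expectation (\<lambda>\<omega>. cos (L \<omega> + \<theta>)) = cos \<theta> * exp (- expectation (\<lambda>\<omega>. (L \<omega>)\<^sup>2) / 2)"
proof -
  note [measurable] = lin_measurable[OF L]
  have i: "integrable P (\<lambda>\<omega>. iexp \<theta> * iexp (L \<omega>))"
    by (rule integrable_const_bound[where B = 1]) (auto simp: norm_mult)
  have "expectation (\<lambda>\<omega>. cos (L \<omega> + \<theta>)) = expectation (\<lambda>\<omega>. Re (iexp \<theta> * iexp (L \<omega>)))"
    by (intro Bochner_Integration.integral_cong) (auto simp: cis_conv_exp[symmetric] cis_mult add.commute)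
  also have "\<dots> = Re (\<integral>\<omega>. iexp \<theta> * iexp (L \<omega>) \<partial>P)" by (rule integral_Re[OF i])
  also have "\<dots> = Re (iexp \<theta> * complex_of_real (exp (- expectation (\<lambda>\<omega>. (L \<omega>)\<^sup>2) / 2)))"
    by (simp only: integral_mult_right_zero lin_char[OF L])
  also have "\<dots> = cos \<theta> * exp (- expectation (\<lambda>\<omega>. (L \<omega>)\<^sup>2) / 2)"
    by (simp add: cis_conv_exp[symmetric])
  finally show ?thesis .
qed

text \<open>As n tends to infinity with k fixed, the sum and the difference of the n-th and the k-th
  variable have the same limiting variance. The product formula for cosines then makes the limit of
  the correlation proportional to (1 + cos(2 theta))/2 - (cos theta)^2, which is 0.\<close>

lemma cubic_grid_mixing_cos:
  assumes W: "W \<in> borel_measurable P" and bnd: "\<And>\<omega>. \<omega> \<in> space P \<Longrightarrow> \<bar>W \<omega>\<bar> \<le> D"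
  shows "(\<lambda>n. expectation (\<lambda>\<omega>. W \<omega> * cos (\<mu> * cubic_grid n \<omega> + \<theta>)))
    \<longlonglongrightarrow> cos \<theta> * exp (- (\<mu> * c_const H)\<^sup>2 / 2) * expectation W"
proof -
  let ?X = "\<lambda>n \<omega>. \<mu> * cubic_grid n \<omega>"
  have X_lin: "?X n \<in> lin" for n by (intro lin_scale cubic_grid_lin)
  have Xm[measurable]: "?X n \<in> borel_measurable P" for n by (intro lin_measurable X_lin)
  note [measurable] = W
  define v where "v n = expectation (\<lambda>\<omega>. (?X n \<omega>)\<^sup>2)" for n
  define e where "e n = exp (- v n / 2)" for n
  have v_lim: "v \<longlonglongrightarrow> (\<mu> * c_const H)\<^sup>2"
    unfolding v_def power_mult_distrib using tendsto_mult_left[OF cubic_grid_var] by simp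
  have e_lim: "e \<longlonglongrightarrow> exp (- (\<mu> * c_const H)\<^sup>2 / 2)"
    unfolding e_def by (intro tendsto_intros v_lim) simp
  have cov: "(\<lambda>n. expectation (\<lambda>\<omega>. ?X n \<omega> * ?X k \<omega>)) \<longlonglongrightarrow> 0" for k
  proof -
    have "expectation (\<lambda>\<omega>. ?X n \<omega> * ?X k \<omega>) = (\<mu> * \<mu>) * expectation (\<lambda>\<omega>. cubic_grid n \<omega> * cubic_grid k \<omega>)" for n
      by (subst integral_mult_right_zero[symmetric], rule Bochner_Integration.integral_cong) auto
    then show ?thesis using tendsto_mult_left[OF cubic_grid_cov, of "\<mu> * \<mu>"] by simp
  qed
  have sum_lim: "(\<lambda>n. expectation (\<lambda>\<omega>. (?X n \<omega> + ?X k \<omega>)\<^sup>2)) \<longlonglongrightarrow> (\<mu> * c_const H)\<^sup>2 + v k" for k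
    unfolding lin_add_sq[OF X_lin X_lin] v_def[symmetric]
    using tendsto_add[OF tendsto_add[OF v_lim tendsto_const[of "v k"]] tendsto_mult_left[OF cov[of k], of 2]] by simp
  have diff_lim: "(\<lambda>n. expectation (\<lambda>\<omega>. (?X n \<omega> - ?X k \<omega>)\<^sup>2)) \<longlonglongrightarrow> (\<mu> * c_const H)\<^sup>2 + v k" for k
    unfolding lin_diff_sq[OF X_lin X_lin] v_def[symmetric]
    using tendsto_diff[OF tendsto_add[OF v_lim tendsto_const[of "v k"]] tendsto_mult_left[OF cov[of k], of 2]] by simp
  define f where "f n \<omega> = cos (?X n \<omega> + \<theta>) - cos \<theta> * e n" for n \<omega>
  have e01: "\<bar>e n\<bar> \<le> 1" for n
    unfolding e_def v_def by (simp add: integral_nonneg_AE)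
  have f_bnd: "\<bar>f n \<omega>\<bar> \<le> 2" for n \<omega>
  proof -
    have "\<bar>cos \<theta> * e n\<bar> \<le> 1" using e01[of n] abs_cos_le_one[of \<theta>] by (simp add: abs_mult mult_le_one)
    then show ?thesis unfolding f_def using abs_cos_le_one[of "?X n \<omega> + \<theta>"] by linarith
  qed
  have fm[measurable]: "f n \<in> borel_measurable P" for n unfolding f_def[abs_def] by measurable
  have ic: "integrable P (\<lambda>\<omega>. cos (?X n \<omega> + \<theta>))" for n
    by (rule integrable_const_bound[where B = 1]) auto
  have Ecos: "expectation (\<lambda>\<omega>. cos (?X n \<omega> + \<theta>)) = cos \<theta> * e n" for n
    unfolding e_def v_def by (rule lin_cos[OF X_lin])
  have ff: "expectation (\<lambda>\<omega>. f n \<omega> * f k \<omega>)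
     = (exp (- expectation (\<lambda>\<omega>. (?X n \<omega> - ?X k \<omega>)\<^sup>2) / 2)
        + cos (2 * \<theta>) * exp (- expectation (\<lambda>\<omega>. (?X n \<omega> + ?X k \<omega>)\<^sup>2) / 2)) / 2 - (cos \<theta>)\<^sup>2 * e n * e k" for n k
  proof -
    have i1: "integrable P (\<lambda>\<omega>. cos ((?X n \<omega> - ?X k \<omega>) + 0))" "integrable P (\<lambda>\<omega>. cos ((?X n \<omega> + ?X k \<omega>) + 2 * \<theta>))"
      by (rule integrable_const_bound[where B = 1]; auto)+
    have "f n \<omega> * f k \<omega> = (cos ((?X n \<omega> - ?X k \<omega>) + 0) + cos ((?X n \<omega> + ?X k \<omega>) + 2 * \<theta>)) / 2
       - cos \<theta> * e k * cos (?X n \<omega> + \<theta>) - cos \<theta> * e n * cos (?X k \<omega> + \<theta>) + (cos \<theta>)\<^sup>2 * e n * e k" for \<omega>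
    proof -
      have "cos (?X n \<omega> + \<theta>) * cos (?X k \<omega> + \<theta>) = (cos ((?X n \<omega> + \<theta>) - (?X k \<omega> + \<theta>)) + cos ((?X n \<omega> + \<theta>) + (?X k \<omega> + \<theta>))) / 2"
        by (rule cos_times_cos)
      also have "(?X n \<omega> + \<theta>) - (?X k \<omega> + \<theta>) = (?X n \<omega> - ?X k \<omega>) + 0" by simp
      also have "(?X n \<omega> + \<theta>) + (?X k \<omega> + \<theta>) = (?X n \<omega> + ?X k \<omega>) + 2 * \<theta>" by simp
      finally show ?thesis unfolding f_def by (simp add: algebra_simps power2_eq_square)
    qed
    then have "expectation (\<lambda>\<omega>. f n \<omega> * f k \<omega>)
      = (expectation (\<lambda>\<omega>. cos ((?X n \<omega> - ?X k \<omega>) + 0)) + expectation (\<lambda>\<omega>. cos ((?X n \<omega> + ?X k \<omega>) + 2 * \<theta>))) / 2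
        - cos \<theta> * e k * expectation (\<lambda>\<omega>. cos (?X n \<omega> + \<theta>)) - cos \<theta> * e n * expectation (\<lambda>\<omega>. cos (?X k \<omega> + \<theta>)) + (cos \<theta>)\<^sup>2 * e n * e k"
      using i1 ic by (simp add: prob_space)
    also have "\<dots> = (exp (- expectation (\<lambda>\<omega>. (?X n \<omega> - ?X k \<omega>)\<^sup>2) / 2)
        + cos (2 * \<theta>) * exp (- expectation (\<lambda>\<omega>. (?X n \<omega> + ?X k \<omega>)\<^sup>2) / 2)) / 2 - (cos \<theta>)\<^sup>2 * e n * e k"
      unfolding Ecos lin_cos[OF lin_diff[OF X_lin X_lin]] lin_cos[OF lin_add[OF X_lin X_lin]]
      by (simp add: power2_eq_square algebra_simps)
    finally show ?thesis .
  qed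
  have "(\<lambda>n. expectation (\<lambda>\<omega>. W \<omega> * f n \<omega>)) \<longlonglongrightarrow> 0"
  proof (rule almost_orthogonal_imp_weakly_null[where C = 2 and D = D])
    fix k
    let ?c = "(\<mu> * c_const H)\<^sup>2"
    have "(\<lambda>n. expectation (\<lambda>\<omega>. f n \<omega> * f k \<omega>)) \<longlonglongrightarrow>
       (exp (- (?c + v k) / 2) + cos (2 * \<theta>) * exp (- (?c + v k) / 2)) / 2 - (cos \<theta>)\<^sup>2 * exp (- ?c / 2) * e k"
      unfolding ff by (intro tendsto_intros sum_lim diff_lim e_lim) auto
    moreover have "exp (- (?c + v k) / 2) = exp (- ?c / 2) * e k"
      unfolding e_def exp_add[symmetric] by (simp add: add_divide_distrib diff_divide_distrib)
    moreover have "cos (2 * \<theta>) = 2 * (cos \<theta>)\<^sup>2 - 1" by (rule cos_double_cos)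
    moreover have "(E * e k + (2 * q - 1) * (E * e k)) / 2 - q * E * e k = 0" for E q :: real
      by (simp add: field_simps)
    ultimately show "(\<lambda>n. expectation (\<lambda>\<omega>. f n \<omega> * f k \<omega>)) \<longlonglongrightarrow> 0"
      by (simp only:)
  qed (use f_bnd bnd in auto)
  moreover have "expectation (\<lambda>\<omega>. W \<omega> * f n \<omega>) = expectation (\<lambda>\<omega>. W \<omega> * cos (?X n \<omega> + \<theta>)) - cos \<theta> * e n * expectation W" for n
  proof -
    have iW: "integrable P W" by (rule integrable_const_bound[where B = D]) (use bnd in auto)
    have iWc: "integrable P (\<lambda>\<omega>. W \<omega> * cos (?X n \<omega> + \<theta>))"
      by (rule Bochner_Integration.integrable_bound[OF iW]) (auto simp: abs_mult intro!: mult_right_le_one_le)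
    have "W \<omega> * f n \<omega> = W \<omega> * cos (?X n \<omega> + \<theta>) - cos \<theta> * e n * W \<omega>" for \<omega>
      by (simp add: f_def algebra_simps)
    then show ?thesis using iW iWc by simp
  qed
  ultimately have "(\<lambda>n. expectation (\<lambda>\<omega>. W \<omega> * cos (?X n \<omega> + \<theta>)) - cos \<theta> * e n * expectation W) \<longlonglongrightarrow> 0" by simp
  from tendsto_add[OF this tendsto_mult_right[OF tendsto_mult_left[OF e_lim, of "cos \<theta>"], of "expectation W"]]
  show ?thesis by simp
qed

lemma cubic_grid_mixing:
  assumes W: "W \<in> borel_measurable P" and bnd: "\<And>\<omega>. \<omega> \<in> space P \<Longrightarrow> \<bar>W \<omega>\<bar> \<le> D"
  shows "(\<lambda>n. \<integral>\<omega>. complex_of_real (W \<omega>) * iexp (\<mu> * cubic_grid n \<omega>) \<partial>P)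
    \<longlonglongrightarrow> complex_of_real (exp (- (\<mu> * c_const H)\<^sup>2 / 2) * expectation W)"
proof -
  have [measurable]: "cubic_grid n \<in> borel_measurable P" for n by (intro lin_measurable cubic_grid_lin)
  note [measurable] = W
  let ?I = "\<lambda>n. \<integral>\<omega>. complex_of_real (W \<omega>) * iexp (\<mu> * cubic_grid n \<omega>) \<partial>P"
  have i: "integrable P (\<lambda>\<omega>. complex_of_real (W \<omega>) * iexp (\<mu> * cubic_grid n \<omega>))" for n
    by (rule integrable_const_bound[where B = D]) (use bnd in \<open>auto simp: norm_mult\<close>)
  have re: "Re (?I n) = expectation (\<lambda>\<omega>. W \<omega> * cos (\<mu> * cubic_grid n \<omega> + 0))" for n
    by (subst integral_Re[OF i, symmetric], rule Bochner_Integration.integral_cong) (auto simp: Re_exp)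
  \<comment> \<open>The sine is the cosine with phase - pi / 2.\<close>
  have im: "Im (?I n) = expectation (\<lambda>\<omega>. W \<omega> * cos (\<mu> * cubic_grid n \<omega> + (- (pi / 2))))" for n
    by (subst integral_Im[OF i, symmetric], rule Bochner_Integration.integral_cong) (auto simp: Im_exp cos_diff)
  have "(\<lambda>n. Complex (Re (?I n)) (Im (?I n))) \<longlonglongrightarrow> Complex (cos 0 * exp (- (\<mu> * c_const H)\<^sup>2 / 2) * expectation W) (cos (- (pi / 2)) * exp (- (\<mu> * c_const H)\<^sup>2 / 2) * expectation W)"
    unfolding re im by (intro tendsto_Complex cubic_grid_mixing_cos[OF W bnd])
  then show ?thesis by (simp add: complex_of_real_def)
qed

text \<open>On each level set of \<open>u\<close> the random factor is a constant \<open>y\<close>,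
  so mixing applies with the weight \<open>Z\<close> cut down to that set and with the frequency
  \<open>l * y\<close>. Finitely many such sets are summed.\<close>

lemma cubic_grid_mixing_simple:
  assumes Z[measurable]: "Z \<in> borel_measurable P" and bnd: "\<And>\<omega>. \<omega> \<in> space P \<Longrightarrow> \<bar>Z \<omega>\<bar> \<le> D"
    and u: "simple_function P u"
  shows "(\<lambda>n. \<integral>\<omega>. complex_of_real (Z \<omega>) * iexp (l * (u \<omega> * cubic_grid n \<omega>)) \<partial>P)
    \<longlonglongrightarrow> (\<integral>\<omega>. complex_of_real (Z \<omega> * exp (- (l * u \<omega> * c_const H)\<^sup>2 / 2)) \<partial>P)"
proof -
  have [measurable]: "cubic_grid n \<in> borel_measurable P" for n by (intro lin_measurable cubic_grid_lin)
  have um[measurable]: "u \<in> borel_measurable P" using u by (rule borel_measurable_simple_function)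
  have fin: "finite (u ` space P)" using u by (rule simple_functionD)
  define W where "W y \<omega> = Z \<omega> * indicator {y} (u \<omega>)" for y :: real and \<omega>
  have [measurable]: "W y \<in> borel_measurable P" for y unfolding W_def[abs_def] by measurable
  have Wb: "\<omega> \<in> space P \<Longrightarrow> \<bar>W y \<omega>\<bar> \<le> D" for y \<omega>
    using bnd[of \<omega>] by (auto simp: W_def split: split_indicator)
  have split: "h (u \<omega>) = (\<Sum>y\<in>u ` space P. indicator {y} (u \<omega>) * h y)" if "\<omega> \<in> space P" for h :: "real \<Rightarrow> complex" and \<omega>
  proof -
    have "(\<Sum>y\<in>u ` space P. indicator {y} (u \<omega>) * h y) = (\<Sum>y\<in>u ` space P. if u \<omega> = y then h y else 0)"
      by (intro sum.cong) (auto simp: indicator_def)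
    also have "\<dots> = h (u \<omega>)" using fin that by (simp add: sum.delta)
    finally show ?thesis by simp
  qed
  have i1: "integrable P (\<lambda>\<omega>. complex_of_real (W y \<omega>) * iexp (l * y * cubic_grid n \<omega>))" for y n
    by (rule integrable_const_bound[where B = D]) (use Wb in \<open>auto simp: norm_mult\<close>)
  have i2: "integrable P (\<lambda>\<omega>. complex_of_real (W y \<omega>))" for y
    by (rule integrable_const_bound[where B = D]) (use Wb in auto)
  have e1: "(\<integral>\<omega>. complex_of_real (Z \<omega>) * iexp (l * (u \<omega> * cubic_grid n \<omega>)) \<partial>P)
    = (\<Sum>y\<in>u ` space P. \<integral>\<omega>. complex_of_real (W y \<omega>) * iexp (l * y * cubic_grid n \<omega>) \<partial>P)" for n
  proof -
    have "(\<integral>\<omega>. complex_of_real (Z \<omega>) * iexp (l * (u \<omega> * cubic_grid n \<omega>)) \<partial>P)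
      = (\<integral>\<omega>. (\<Sum>y\<in>u ` space P. complex_of_real (W y \<omega>) * iexp (l * y * cubic_grid n \<omega>)) \<partial>P)"
    proof (rule Bochner_Integration.integral_cong[OF refl])
      fix \<omega> assume \<omega>: "\<omega> \<in> space P"
      have "complex_of_real (Z \<omega>) * iexp (l * (u \<omega> * cubic_grid n \<omega>))
        = (\<Sum>y\<in>u ` space P. indicator {y} (u \<omega>) * (complex_of_real (Z \<omega>) * iexp (l * (y * cubic_grid n \<omega>))))"
        by (rule split[OF \<omega>])
      also have "\<dots> = (\<Sum>y\<in>u ` space P. complex_of_real (W y \<omega>) * iexp (l * y * cubic_grid n \<omega>))"
        by (intro sum.cong) (auto simp: W_def indicator_def mult.assoc)
      finally show "complex_of_real (Z \<omega>) * iexp (l * (u \<omega> * cubic_grid n \<omega>))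
        = (\<Sum>y\<in>u ` space P. complex_of_real (W y \<omega>) * iexp (l * y * cubic_grid n \<omega>))" .
    qed
    then show ?thesis using i1 by (simp add: Bochner_Integration.integral_sum)
  qed
  have e2: "(\<integral>\<omega>. complex_of_real (Z \<omega> * exp (- (l * u \<omega> * c_const H)\<^sup>2 / 2)) \<partial>P)
    = (\<Sum>y\<in>u ` space P. complex_of_real (exp (- (l * y * c_const H)\<^sup>2 / 2) * expectation (W y)))"
  proof -
    have "(\<integral>\<omega>. complex_of_real (Z \<omega> * exp (- (l * u \<omega> * c_const H)\<^sup>2 / 2)) \<partial>P)
      = (\<integral>\<omega>. (\<Sum>y\<in>u ` space P. complex_of_real (exp (- (l * y * c_const H)\<^sup>2 / 2)) * complex_of_real (W y \<omega>)) \<partial>P)"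
    proof (rule Bochner_Integration.integral_cong[OF refl])
      fix \<omega> assume \<omega>: "\<omega> \<in> space P"
      have "complex_of_real (Z \<omega> * exp (- (l * u \<omega> * c_const H)\<^sup>2 / 2))
        = (\<Sum>y\<in>u ` space P. indicator {y} (u \<omega>) * complex_of_real (Z \<omega> * exp (- (l * y * c_const H)\<^sup>2 / 2)))"
        by (rule split[OF \<omega>])
      also have "\<dots> = (\<Sum>y\<in>u ` space P. complex_of_real (exp (- (l * y * c_const H)\<^sup>2 / 2)) * complex_of_real (W y \<omega>))"
        by (intro sum.cong) (auto simp: W_def indicator_def)
      finally show "complex_of_real (Z \<omega> * exp (- (l * u \<omega> * c_const H)\<^sup>2 / 2))
        = (\<Sum>y\<in>u ` space P. complex_of_real (exp (- (l * y * c_const H)\<^sup>2 / 2)) * complex_of_real (W y \<omega>))" .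
    qed
    also have "\<dots> = (\<Sum>y\<in>u ` space P. complex_of_real (exp (- (l * y * c_const H)\<^sup>2 / 2)) * (\<integral>\<omega>. complex_of_real (W y \<omega>) \<partial>P))"
      using i2 by (subst Bochner_Integration.integral_sum) (auto intro!: integrable_mult_right simp del: integral_complex_of_real)
    finally show ?thesis by (simp add: integral_complex_of_real)
  qed
  show ?thesis unfolding e1 e2
    by (intro tendsto_sum cubic_grid_mixing[where D = D]) (use Wb in auto)
qed

end

section \<open>Measurable versions and the pathwise integral\<close>

lemma (in complete_measure) borel_measurable_of_AE_eq:
  fixes f g :: "'a \<Rightarrow> real"
  assumes f[measurable]: "f \<in> borel_measurable M" and eq: "AE x in M. f x = g x"
  shows "g \<in> borel_measurable M"
proof (rule measurableI)
  fix A :: "real set" assume [measurable]: "A \<in> sets borel"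
  show "g -` A \<inter> space M \<in> sets M"
    by (rule in_sets_AE[where A = "f -` A \<inter> space M"]) (use eq in \<open>auto elim: eventually_mono\<close>)
qed simp

lemma integral_lebesgue_of_AE_eq:
  fixes f F :: "real \<Rightarrow> real"
  assumes F[measurable]: "F \<in> borel_measurable borel" and eq: "AE t in lborel. F t = f t"
  shows "(\<integral>t. f t \<partial>lebesgue) = (\<integral>t. F t \<partial>lborel)"
proof -
  have eq': "AE t in lebesgue. F t = f t" using eq by (rule AE_completion)
  have F': "F \<in> borel_measurable lebesgue" by (rule measurable_completion) simp
  have "(\<integral>t. f t \<partial>lebesgue) = (\<integral>t. F t \<partial>lebesgue)"
    using eq' by (intro integral_cong_AE completion.borel_measurable_of_AE_eq[OF F' eq'] F') auto
  then show ?thesis by (simp add: integral_completion)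
qed

locale measurable_fbm = fbm +
  assumes complete_generated: "completed_generated_by P {0..} B"
    and measurable_process: "measurable_process_01 P B"
begin

lemma process_subalgebra: "subalgebra P (process_sigma P {0..} B)"
  unfolding subalgebra_def
proof
  show "space (process_sigma P {0..} B) = space P" by (simp add: process_sigma_def space_measure_of_conv)
  have "(\<Union>t\<in>{0..}. {B t -` A \<inter> space P | A. A \<in> sets borel}) \<subseteq> sets P"
    using lin_measurable[OF lin_B] by (auto simp: measurable_sets)
  moreover from this have "(\<Union>t\<in>{0..}. {B t -` A \<inter> space P | A. A \<in> sets borel}) \<subseteq> Pow (space P)"
    using sets.space_closed by blast
  ultimately show "sets (process_sigma P {0..} B) \<subseteq> sets P"
    unfolding process_sigma_def by (simp add: sets.sigma_sets_subset)
qed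

text \<open>\<open>completed_generated_by\<close> equates sigma-algebras only, so a
  \<open>P\<close>-null set has to be shown null for the completed restriction too; this holds since
  its main part is a measurable subset of it. Completeness makes the pathwise integral measurable,
  because that integral is only almost surely equal to a measurable function.\<close>

lemma complete_P: "complete_measure P"
proof
  let ?R = "restr_to_subalg P (process_sigma P {0..} B)"
  have sets_P: "sets P = sets (completion ?R)"
    using complete_generated unfolding completed_generated_by_def .
  fix A N assume AN: "A \<subseteq> N" "N \<in> null_sets P"
  have N: "N \<in> sets (completion ?R)" using AN(2) sets_P by auto
  have mp: "main_part ?R N \<in> sets ?R" using N by simp
  have mp': "main_part ?R N \<in> sets (process_sigma P {0..} B)"
    using mp by (simp add: sets_restr_to_subalg[OF process_subalgebra])
  have sub: "main_part ?R N \<subseteq> N" using main_part_null_part_Un[OF N] by blast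
  have "emeasure (completion ?R) N = emeasure ?R (main_part ?R N)" using N by simp
  also have "\<dots> = emeasure P (main_part ?R N)" by (rule emeasure_restr_to_subalg[OF process_subalgebra mp'])
  also have "\<dots> \<le> emeasure P N" using sub AN(2) by (intro emeasure_mono) auto
  also have "\<dots> = 0" using AN(2) by auto
  finally have "N \<in> null_sets (completion ?R)" using N by auto
  then have "A \<in> sets (completion ?R)" using AN(1) by (rule completion.complete[rotated])
  then show "A \<in> sets P" using sets_P by simp
qed

text \<open>Independence of the extra variable is stated for the uncompleted sigma-algebra of the
  process. A weight that is measurable for the completion is therefore first replaced by such a
  version.\<close>

lemma process_measurable_version:
  assumes Z: "Z \<in> borel_measurable P"
  obtains Z0 :: "'a \<Rightarrow> real" where "Z0 \<in> borel_measurable (process_sigma P {0..} B)" "AE \<omega> in P. Z \<omega> = Z0 \<omega>"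
proof -
  let ?R = "restr_to_subalg P (process_sigma P {0..} B)"
  have sets_P: "sets P = sets (completion ?R)"
    using complete_generated unfolding completed_generated_by_def .
  have "Z \<in> borel_measurable (completion ?R)" using Z sets_P by (simp cong: measurable_cong_sets)
  from completion_ex_borel_measurable_real[OF this] obtain Z0
    where "Z0 \<in> borel_measurable ?R" "AE \<omega> in ?R. Z \<omega> = Z0 \<omega>" by blast
  then show ?thesis
    using that AE_restr_to_subalg[OF process_subalgebra] by (simp cong: measurable_cong_sets add: sets_restr_to_subalg[OF process_subalgebra])
qed

text \<open>Joint measurability is assumed up to null sets of the product. An exactly measurable
  version is picked, and Fubini's theorem records the exceptional set in both orders: for almost
  every time, and along almost every path.\<close>

lemma jointly_measurable_version:
  obtains G :: "real \<Rightarrow> 'a \<Rightarrow> real" where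
    "(\<lambda>(t, \<omega>). G t \<omega>) \<in> borel_measurable (borel \<Otimes>\<^sub>M P)"
    "AE t in lborel. t \<in> {0..1} \<longrightarrow> (AE \<omega> in P. B t \<omega> = G t \<omega>)"
    "AE \<omega> in P. AE t in lborel. t \<in> {0..1} \<longrightarrow> B t \<omega> = G t \<omega>"
proof -
  let ?L = "restrict_space lborel {0..1::real}"
  interpret L: sigma_finite_measure ?L
    by (rule sigma_finite_measure_restrict_space) (auto intro: sigma_finite_lborel)
  interpret LP: pair_sigma_finite ?L P ..
  obtain g where g: "g \<in> borel_measurable (?L \<Otimes>\<^sub>M P)" and ae: "AE z in ?L \<Otimes>\<^sub>M P. (case z of (t, \<omega>) \<Rightarrow> B t \<omega>) = g z"
    using completion_ex_borel_measurable_real measurable_process unfolding measurable_process_01_def by blast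
  obtain N where N: "N \<in> null_sets (?L \<Otimes>\<^sub>M P)" "{z \<in> space (?L \<Otimes>\<^sub>M P). \<not> (case z of (t, \<omega>) \<Rightarrow> B t \<omega>) = g z} \<subseteq> N"
    using ae unfolding eventually_ae_filter by blast
  have out: "B t \<omega> = g (t, \<omega>)" if "t \<in> {0..1}" "\<omega> \<in> space P" "(t, \<omega>) \<notin> N" for t \<omega>
  proof (rule ccontr)
    assume "B t \<omega> \<noteq> g (t, \<omega>)"
    then have "(t, \<omega>) \<in> {z \<in> space (?L \<Otimes>\<^sub>M P). \<not> (case z of (t, \<omega>) \<Rightarrow> B t \<omega>) = g z}"
      using that by (simp add: space_pair_measure space_restrict_space)
    then show False using N(2) that(3) by blast
  qed
  have aeN: "AE z in ?L \<Otimes>\<^sub>M P. z \<notin> N" using N(1) by (rule AE_not_in)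
  then have a1: "AE t in ?L. AE \<omega> in P. (t, \<omega>) \<notin> N" by (rule LP.AE_pair)
  moreover have "{z \<in> space (?L \<Otimes>\<^sub>M P). (fst z, snd z) \<notin> N} \<in> sets (?L \<Otimes>\<^sub>M P)"
  proof -
    have "{z \<in> space (?L \<Otimes>\<^sub>M P). (fst z, snd z) \<notin> N} = space (?L \<Otimes>\<^sub>M P) - N" by auto
    then show ?thesis using N(1) by auto
  qed
  ultimately have a2: "AE \<omega> in P. AE t in ?L. (t, \<omega>) \<notin> N" using LP.AE_commute[of "\<lambda>t \<omega>. (t, \<omega>) \<notin> N"] by simp
  have I: "{0..1::real} \<inter> space lborel \<in> sets lborel" by simp
  \<comment> \<open>Clamping \<open>t\<close> to [0,1] makes the version a function on the whole
    line without changing it on [0,1].\<close>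
  define G where "G t \<omega> = g (max 0 (min 1 t), \<omega>)" for t \<omega>
  have clamp: "(\<lambda>t. max 0 (min 1 t)) \<in> borel \<rightarrow>\<^sub>M ?L"
    by (rule measurable_restrict_space2) auto
  show ?thesis
  proof
    have "(\<lambda>z. g ((\<lambda>t. max 0 (min 1 t)) (fst z), snd z)) \<in> borel_measurable (borel \<Otimes>\<^sub>M P)"
      by (rule measurable_compose[OF _ g], rule measurable_Pair, rule measurable_compose[OF measurable_fst clamp], rule measurable_snd)
    then show "(\<lambda>(t, \<omega>). G t \<omega>) \<in> borel_measurable (borel \<Otimes>\<^sub>M P)"
      by (simp add: G_def split_beta')
    have eqG: "AE \<omega> in P. B t \<omega> = G t \<omega>" if t: "t \<in> {0..1}" and a: "AE \<omega> in P. (t, \<omega>) \<notin> N" for t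
      using a AE_space by eventually_elim (use out t in \<open>auto simp: G_def\<close>)
    have "AE t in lborel. t \<in> {0..1} \<longrightarrow> (AE \<omega> in P. (t, \<omega>) \<notin> N)"
      using a1 unfolding AE_restrict_space_iff[OF I] .
    then show "AE t in lborel. t \<in> {0..1} \<longrightarrow> (AE \<omega> in P. B t \<omega> = G t \<omega>)"
      by eventually_elim (use eqG in blast)
    have "AE \<omega> in P. AE t in lborel. t \<in> {0..1} \<longrightarrow> (t, \<omega>) \<notin> N"
      using a2 unfolding AE_restrict_space_iff[OF I] .
    then show "AE \<omega> in P. AE t in lborel. t \<in> {0..1} \<longrightarrow> B t \<omega> = G t \<omega>"
      using AE_space
    proof eventually_elim
      case (elim \<omega>)
      from elim(1) show ?case
        by eventually_elim (use out elim(2) in \<open>auto simp: G_def\<close>)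
    qed
  qed
qed

text \<open>The difference of squares is factored, and the inequality of means is used with weight
  \<open>q = d powr H\<close>: the difference has second moment at most q^2, the sum at most 4, and
  (q + 4q)/2 is at most 3q.\<close>

lemma squared_increment_L1:
  assumes "0 \<le> s" "s \<le> 1" "0 \<le> t" "t \<le> 1" "\<bar>s - t\<bar> \<le> d" "0 < d"
  shows "integrable P (\<lambda>\<omega>. (B s \<omega>)\<^sup>2 - (B t \<omega>)\<^sup>2)"
    and "expectation (\<lambda>\<omega>. \<bar>(B s \<omega>)\<^sup>2 - (B t \<omega>)\<^sup>2\<bar>) \<le> 3 * d powr H"
proof -
  show i: "integrable P (\<lambda>\<omega>. (B s \<omega>)\<^sup>2 - (B t \<omega>)\<^sup>2)"
    using assms by (intro Bochner_Integration.integrable_diff lin_integrable_sq lin_B)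
  define q where "q = d powr H"
  have q: "0 < q" using assms by (simp add: q_def)
  have sB: "B s \<in> lin" "B t \<in> lin" using assms by (auto intro: lin_B)
  have v1: "expectation (\<lambda>\<omega>. (B s \<omega>)\<^sup>2) \<le> 1" "expectation (\<lambda>\<omega>. (B t \<omega>)\<^sup>2) \<le> 1"
    using assms H by (auto simp: var_B intro!: powr_le1)
  have E1: "expectation (\<lambda>\<omega>. (B s \<omega> - B t \<omega>)\<^sup>2) \<le> q * q"
  proof -
    have "expectation (\<lambda>\<omega>. (B s \<omega> - B t \<omega>)\<^sup>2) \<le> d powr (2 * H)"
      using assms H by (simp add: var_increment powr_mono2)
    also have "\<dots> = q * q" by (simp add: q_def powr_add[symmetric])
    finally show ?thesis .
  qed
  have E2: "expectation (\<lambda>\<omega>. (B s \<omega> + B t \<omega>)\<^sup>2) \<le> 4"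
    using lin_add_sq[OF sB] lin_mult_le_one[OF sB v1] v1 by linarith
  have ii: "integrable P (\<lambda>\<omega>. (B s \<omega> - B t \<omega>)\<^sup>2)" "integrable P (\<lambda>\<omega>. (B s \<omega> + B t \<omega>)\<^sup>2)"
    by (intro lin_integrable_sq lin_diff lin_add sB)+
  have pw: "\<bar>(B s \<omega>)\<^sup>2 - (B t \<omega>)\<^sup>2\<bar> \<le> (1 / q * (B s \<omega> - B t \<omega>)\<^sup>2 + q * (B s \<omega> + B t \<omega>)\<^sup>2) / 2" for \<omega>
  proof -
    define a where "a = \<bar>B s \<omega> - B t \<omega>\<bar>"
    define b where "b = \<bar>B s \<omega> + B t \<omega>\<bar>"
    have "\<bar>(B s \<omega>)\<^sup>2 - (B t \<omega>)\<^sup>2\<bar> = a * b"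
      unfolding a_def b_def abs_mult[symmetric] by (simp add: power2_eq_square algebra_simps)
    moreover have "2 * (q * (a * b)) \<le> a\<^sup>2 + (q * b)\<^sup>2"
      using zero_le_power2[of "a - q * b"] by (simp add: power2_diff mult_ac)
    then have "2 * (q * (a * b)) / q \<le> (a\<^sup>2 + (q * b)\<^sup>2) / q" using q by (intro divide_right_mono) auto
    then have "2 * (a * b) \<le> 1 / q * a\<^sup>2 + q * b\<^sup>2"
      using q by (simp add: power_mult_distrib add_divide_distrib power2_eq_square[of q])
    moreover have "a\<^sup>2 = (B s \<omega> - B t \<omega>)\<^sup>2" "b\<^sup>2 = (B s \<omega> + B t \<omega>)\<^sup>2" by (simp_all add: a_def b_def)
    ultimately show ?thesis by simp
  qed
  have "expectation (\<lambda>\<omega>. \<bar>(B s \<omega>)\<^sup>2 - (B t \<omega>)\<^sup>2\<bar>)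
     \<le> expectation (\<lambda>\<omega>. (1 / q * (B s \<omega> - B t \<omega>)\<^sup>2 + q * (B s \<omega> + B t \<omega>)\<^sup>2) / 2)"
    by (rule integral_mono) (use i ii pw in auto)
  also have "\<dots> = (1 / q * expectation (\<lambda>\<omega>. (B s \<omega> - B t \<omega>)\<^sup>2) + q * expectation (\<lambda>\<omega>. (B s \<omega> + B t \<omega>)\<^sup>2)) / 2"
    using ii by simp
  also have "\<dots> \<le> (1 / q * (q * q) + q * 4) / 2"
    using E1 E2 q by (intro divide_right_mono add_mono mult_left_mono) auto
  also have "\<dots> \<le> 3 * q" using q by simp
  finally show "expectation (\<lambda>\<omega>. \<bar>(B s \<omega>)\<^sup>2 - (B t \<omega>)\<^sup>2\<bar>) \<le> 3 * d powr H" by (simp add: q_def)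
qed

text \<open>The regularity at hand is mean-square continuity of \<open>B\<close>, not continuity of
  its paths. The error of the Riemann sum is therefore estimated in L^1 of the product of
  \<open>power_law n\<close> and \<open>P\<close>, and Fubini's theorem turns this into an estimate
  for the pathwise integral.\<close>

lemma quad_fun_approx:
  assumes n: "1 \<le> n" and m: "1 \<le> m"
  shows "quad_fun H B n \<in> borel_measurable P"
    and "integrable P (\<lambda>\<omega>. quad_fun H B n \<omega> - quad_grid n m \<omega>)"
    and "expectation (\<lambda>\<omega>. \<bar>quad_fun H B n \<omega> - quad_grid n m \<omega>\<bar>) \<le> 3 * real n powr H * (1 / real m) powr H"
proof -
  let ?U = "power_law n"
  interpret U: prob_space ?U by (rule prob_space_power_law[OF n])
  interpret UP: pair_prob_space ?U P ..
  interpret C: complete_measure P by (rule complete_P)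
  have m0: "0 < real m" using m by simp
  obtain G where Gm: "(\<lambda>(t, \<omega>). G t \<omega>) \<in> borel_measurable (borel \<Otimes>\<^sub>M P)"
    and G1: "AE t in lborel. t \<in> {0..1} \<longrightarrow> (AE \<omega> in P. B t \<omega> = G t \<omega>)"
    and G2: "AE \<omega> in P. AE t in lborel. t \<in> {0..1} \<longrightarrow> B t \<omega> = G t \<omega>"
    by (rule jointly_measurable_version)
  have GmU: "(\<lambda>z. G (fst z) (snd z)) \<in> borel_measurable (?U \<Otimes>\<^sub>M P)"
    using Gm by (simp add: split_beta' cong: measurable_cong_sets sets_pair_measure_cong)
  have Gt: "(\<lambda>t. G t \<omega>) \<in> borel_measurable borel" if "\<omega> \<in> space P" for \<omega>
    using measurable_compose[OF measurable_Pair2'[OF that] Gm] by simp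
  have B1[measurable]: "B 1 \<in> borel_measurable P" by (intro lin_measurable lin_B) auto
  define \<tau> where "\<tau> t = real (nat \<lceil>real m * t\<rceil>) / real m" for t
  have BdU: "(\<lambda>z. B (\<tau> (fst z)) (snd z)) \<in> borel_measurable (?U \<Otimes>\<^sub>M P)"
  proof -
    have "(\<lambda>z. B (real i / real m) (snd z)) \<in> borel_measurable (?U \<Otimes>\<^sub>M P)" for i :: nat
      by (intro measurable_compose[OF measurable_snd] lin_measurable lin_B) auto
    from measurable_compose_countable[OF this, of "\<lambda>z. nat \<lceil>real m * fst z\<rceil>"]
    show ?thesis unfolding \<tau>_def by measurable
  qed
  \<comment> \<open>The error before integration over time. At time t the measurable version
    replaces \<open>B\<close>; at the grid points, which may be exceptional times for the version,
    \<open>B\<close> itself is kept.\<close>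
  define Q where "Q z = (B (\<tau> (fst z)) (snd z))\<^sup>2 - (G (fst z) (snd z))\<^sup>2" for z
  have QU: "Q \<in> borel_measurable (?U \<Otimes>\<^sub>M P)" unfolding Q_def[abs_def] using GmU BdU by measurable
  have U1: "AE t in ?U. AE \<omega> in P. B t \<omega> = G t \<omega>"
  proof -
    have "AE t in ?U. t \<in> {0..1} \<longrightarrow> (AE \<omega> in P. B t \<omega> = G t \<omega>)"
      using G1 unfolding power_law_def by (subst AE_density) auto
    then show ?thesis using AE_power_law by eventually_elim auto
  qed
  have Qt: "AE t in ?U. integrable P (\<lambda>\<omega>. Q (t, \<omega>)) \<and> expectation (\<lambda>\<omega>. \<bar>Q (t, \<omega>)\<bar>) \<le> 3 * (1 / real m) powr H"
    using U1 AE_power_law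
  proof eventually_elim
    case (elim t)
    have \<tau>: "0 \<le> \<tau> t" "\<tau> t \<le> 1" "\<bar>\<tau> t - t\<bar> \<le> 1 / real m"
      using grid_index[of t m] elim m unfolding \<tau>_def by auto
    note S = squared_increment_L1[OF \<tau>(1,2) _ _ \<tau>(3) divide_pos_pos[OF zero_less_one m0]]
    have Qm: "(\<lambda>\<omega>. Q (t, \<omega>)) \<in> borel_measurable P"
      by (rule measurable_compose[OF measurable_Pair1' QU]) simp
    have Bm: "(\<lambda>\<omega>. (B (\<tau> t) \<omega>)\<^sup>2 - (B t \<omega>)\<^sup>2) \<in> borel_measurable P"
      using \<tau> elim by (intro borel_measurable_diff borel_measurable_power lin_measurable lin_B) auto
    have eq: "AE \<omega> in P. Q (t, \<omega>) = (B (\<tau> t) \<omega>)\<^sup>2 - (B t \<omega>)\<^sup>2"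
      using elim(1) by eventually_elim (simp add: Q_def)
    have "integrable P (\<lambda>\<omega>. Q (t, \<omega>))"
      using S(1) elim integrable_cong_AE[OF Qm Bm eq] by auto
    moreover have "expectation (\<lambda>\<omega>. \<bar>Q (t, \<omega>)\<bar>) = expectation (\<lambda>\<omega>. \<bar>(B (\<tau> t) \<omega>)\<^sup>2 - (B t \<omega>)\<^sup>2\<bar>)"
      using Qm Bm eq by (intro integral_cong_AE) auto
    ultimately show ?case using S(2) elim by auto
  qed
  have Qabs_m: "(\<lambda>t. expectation (\<lambda>\<omega>. \<bar>Q (t, \<omega>)\<bar>)) \<in> borel_measurable ?U"
    using QU by (intro borel_measurable_lebesgue_integral) (simp add: split_beta')
  have Qabs_i: "integrable ?U (\<lambda>t. expectation (\<lambda>\<omega>. \<bar>Q (t, \<omega>)\<bar>))"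
    by (rule U.integrable_const_bound[where B = "3 * (1 / real m) powr H", OF _ Qabs_m])
      (use Qt in eventually_elim, auto)
  have Qi: "integrable (?U \<Otimes>\<^sub>M P) Q"
    by (rule UP.Fubini_integrable[OF QU]) (use Qabs_i Qt in auto)
  have Qi': "integrable (?U \<Otimes>\<^sub>M P) (case_prod (\<lambda>t \<omega>. Q (t, \<omega>)))" using Qi by simp
  have Qai: "integrable (?U \<Otimes>\<^sub>M P) (case_prod (\<lambda>t \<omega>. \<bar>Q (t, \<omega>)\<bar>))"
    using integrable_abs[OF Qi] by (simp add: split_beta')
  have Bd_i: "integrable ?U (\<lambda>t. (B 1 \<omega>)\<^sup>2 - (B (\<tau> t) \<omega>)\<^sup>2)" for \<omega>
  proof (rule U.integrable_const_bound[where B = "Max ((\<lambda>i. \<bar>(B 1 \<omega>)\<^sup>2 - (B (real i / real m) \<omega>)\<^sup>2\<bar>) ` {1..m})"])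
    show "AE t in ?U. norm ((B 1 \<omega>)\<^sup>2 - (B (\<tau> t) \<omega>)\<^sup>2) \<le> Max ((\<lambda>i. \<bar>(B 1 \<omega>)\<^sup>2 - (B (real i / real m) \<omega>)\<^sup>2\<bar>) ` {1..m})"
      using AE_power_law
    proof eventually_elim
      case (elim t)
      then have "nat \<lceil>real m * t\<rceil> \<in> {1..m}" using grid_index(1) m by blast
      then show ?case unfolding \<tau>_def real_norm_def
        by (intro Max_ge finite_imageI finite_atLeastAtMost) (rule image_eqI[OF refl])
    qed
    show "(\<lambda>t. (B 1 \<omega>)\<^sup>2 - (B (\<tau> t) \<omega>)\<^sup>2) \<in> borel_measurable ?U"
    proof -
      have "(\<lambda>t. (\<lambda>i::nat. (B 1 \<omega>)\<^sup>2 - (B (real i / real m) \<omega>)\<^sup>2) (nat \<lceil>real m * t\<rceil>)) \<in> borel_measurable ?U"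
        by measurable
      then show ?thesis unfolding \<tau>_def .
    qed
  qed
  have grid: "quad_grid n m \<omega> = real n powr H / 2 * (\<integral>t. (B 1 \<omega>)\<^sup>2 - (B (\<tau> t) \<omega>)\<^sup>2 \<partial>?U)" for \<omega>
    unfolding quad_grid_def \<tau>_def
    by (subst integral_grid_index[OF n m, of "\<lambda>i. (B 1 \<omega>)\<^sup>2 - (B (real i / real m) \<omega>)\<^sup>2"]) simp
  have qf: "AE \<omega> in P. quad_fun H B n \<omega> = real n powr H / 2 * (\<integral>t. (B 1 \<omega>)\<^sup>2 - (G t \<omega>)\<^sup>2 \<partial>?U)"
    using G2 AE_space
  proof eventually_elim
    case (elim \<omega>)
    note [measurable] = Gt[OF elim(2)]
    define F where "F t = indicator {0..1} t * (t ^ (n - 1) * ((B 1 \<omega>)\<^sup>2 - (G t \<omega>)\<^sup>2))" for t :: real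
    have [measurable]: "F \<in> borel_measurable borel" unfolding F_def[abs_def] by measurable
    have "(LINT t:{0..1}|lebesgue. t ^ (n - 1) * ((B 1 \<omega>)\<^sup>2 - (B t \<omega>)\<^sup>2))
       = (\<integral>t. indicator {0..1} t *\<^sub>R (t ^ (n - 1) * ((B 1 \<omega>)\<^sup>2 - (B t \<omega>)\<^sup>2)) \<partial>lebesgue)"
      by (simp add: set_lebesgue_integral_def)
    also have "\<dots> = (\<integral>t. F t \<partial>lborel)"
    proof (rule integral_lebesgue_of_AE_eq)
      show "AE t in lborel. F t = indicator {0..1} t *\<^sub>R (t ^ (n - 1) * ((B 1 \<omega>)\<^sup>2 - (B t \<omega>)\<^sup>2))"
        using elim(1) by eventually_elim (auto simp: F_def indicator_def)
    qed simp
    finally have 1: "(LINT t:{0..1}|lebesgue. t ^ (n - 1) * ((B 1 \<omega>)\<^sup>2 - (B t \<omega>)\<^sup>2)) = (\<integral>t. F t \<partial>lborel)" .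
    have "(\<integral>t. (B 1 \<omega>)\<^sup>2 - (G t \<omega>)\<^sup>2 \<partial>?U) = (\<integral>t. real n * F t \<partial>lborel)"
      by (subst integral_power_law) (auto simp: F_def mult_ac)
    then have 2: "(\<integral>t. (B 1 \<omega>)\<^sup>2 - (G t \<omega>)\<^sup>2 \<partial>?U) = real n * (\<integral>t. F t \<partial>lborel)" by simp
    have "real n powr (1 + H) = real n powr H * real n" using n by (simp add: powr_add)
    then show ?case unfolding quad_fun_def 1 2 by simp
  qed
  have GP: "(\<lambda>\<omega>. real n powr H / 2 * (\<integral>t. (B 1 \<omega>)\<^sup>2 - (G t \<omega>)\<^sup>2 \<partial>?U)) \<in> borel_measurable P"
  proof -
    have "(\<lambda>(\<omega>, t). G t \<omega>) \<in> borel_measurable (P \<Otimes>\<^sub>M ?U)"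
      using measurable_compose[OF measurable_pair_swap' GmU] by (simp add: split_beta')
    then have "(\<lambda>(\<omega>, t). (B 1 \<omega>)\<^sup>2 - (G t \<omega>)\<^sup>2) \<in> borel_measurable (P \<Otimes>\<^sub>M ?U)" by measurable
    from U.borel_measurable_lebesgue_integral[OF this] show ?thesis by simp
  qed
  show qm: "quad_fun H B n \<in> borel_measurable P"
    by (rule C.borel_measurable_of_AE_eq[OF GP]) (use qf in eventually_elim, simp)
  have diff: "AE \<omega> in P. quad_fun H B n \<omega> - quad_grid n m \<omega> = real n powr H / 2 * (\<integral>t. Q (t, \<omega>) \<partial>?U)"
    using qf UP.AE_integrable_snd[OF Qi']
  proof eventually_elim
    case (elim \<omega>)
    have eq: "(B 1 \<omega>)\<^sup>2 - (G t \<omega>)\<^sup>2 = ((B 1 \<omega>)\<^sup>2 - (B (\<tau> t) \<omega>)\<^sup>2) + Q (t, \<omega>)" for t by (simp add: Q_def)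
    have "(\<integral>t. (B 1 \<omega>)\<^sup>2 - (G t \<omega>)\<^sup>2 \<partial>?U) = (\<integral>t. (B 1 \<omega>)\<^sup>2 - (B (\<tau> t) \<omega>)\<^sup>2 \<partial>?U) + (\<integral>t. Q (t, \<omega>) \<partial>?U)"
      by (simp only: eq Bochner_Integration.integral_add[OF Bd_i elim(2)])
    then show ?case unfolding elim(1) grid by (simp add: algebra_simps)
  qed
  have Qs: "integrable P (\<lambda>\<omega>. \<integral>t. Q (t, \<omega>) \<partial>?U)" by (rule UP.integrable_snd[OF Qi'])
  have Qas: "integrable P (\<lambda>\<omega>. \<integral>t. \<bar>Q (t, \<omega>)\<bar> \<partial>?U)" by (rule UP.integrable_snd[OF Qai])
  have qgm: "quad_grid n m \<in> borel_measurable P"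
    unfolding quad_grid_def[abs_def]
    by (intro borel_measurable_times borel_measurable_sum borel_measurable_diff borel_measurable_power borel_measurable_const lin_measurable lin_B) auto
  have dm: "(\<lambda>\<omega>. quad_fun H B n \<omega> - quad_grid n m \<omega>) \<in> borel_measurable P" using qm qgm by simp
  show "integrable P (\<lambda>\<omega>. quad_fun H B n \<omega> - quad_grid n m \<omega>)"
    using integrable_cong_AE[OF dm _ diff] Qs by auto
  have "expectation (\<lambda>\<omega>. \<bar>quad_fun H B n \<omega> - quad_grid n m \<omega>\<bar>) = expectation (\<lambda>\<omega>. \<bar>real n powr H / 2 * (\<integral>t. Q (t, \<omega>) \<partial>?U)\<bar>)"
  proof (rule integral_cong_AE)
    show "AE \<omega> in P. \<bar>quad_fun H B n \<omega> - quad_grid n m \<omega>\<bar> = \<bar>real n powr H / 2 * (\<integral>t. Q (t, \<omega>) \<partial>?U)\<bar>"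
      using diff by eventually_elim (simp only:)
  qed (use dm Qs in auto)
  also have "\<dots> = real n powr H / 2 * expectation (\<lambda>\<omega>. \<bar>\<integral>t. Q (t, \<omega>) \<partial>?U\<bar>)" by (simp add: abs_mult)
  also have "\<dots> \<le> real n powr H / 2 * expectation (\<lambda>\<omega>. \<integral>t. \<bar>Q (t, \<omega>)\<bar> \<partial>?U)"
    using Qs Qas by (intro mult_left_mono integral_mono integral_abs_bound) auto
  also have "expectation (\<lambda>\<omega>. \<integral>t. \<bar>Q (t, \<omega>)\<bar> \<partial>?U) = (\<integral>t. expectation (\<lambda>\<omega>. \<bar>Q (t, \<omega>)\<bar>) \<partial>?U)"
    by (rule UP.Fubini_integral[OF Qai])
  also have "real n powr H / 2 * (\<integral>t. expectation (\<lambda>\<omega>. \<bar>Q (t, \<omega>)\<bar>) \<partial>?U) \<le> real n powr H / 2 * (3 * (1 / real m) powr H)"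
    using Qabs_i Qt by (intro mult_left_mono U.integral_le_const) auto
  also have "\<dots> \<le> 3 * real n powr H * (1 / real m) powr H" by simp
  finally show "expectation (\<lambda>\<omega>. \<bar>quad_fun H B n \<omega> - quad_grid n m \<omega>\<bar>) \<le> 3 * real n powr H * (1 / real m) powr H" .
qed

section \<open>Stable convergence of the functional\<close>

lemma quad_fun_product_L1:
  shows "integrable P (\<lambda>\<omega>. quad_fun H B (Suc n) \<omega> - B 1 \<omega> * cubic_grid n \<omega>)"
    and "(\<lambda>n. expectation (\<lambda>\<omega>. \<bar>quad_fun H B (Suc n) \<omega> - B 1 \<omega> * cubic_grid n \<omega>\<bar>)) \<longlonglongrightarrow> 0"
proof -
  let ?q = "\<lambda>n. quad_grid (Suc n) (Suc n ^ 3)"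
  have n: "1 \<le> Suc n" "1 \<le> Suc n ^ 3" for n by auto
  have i1: "integrable P (\<lambda>\<omega>. quad_fun H B (Suc n) \<omega> - ?q n \<omega>)" for n by (rule quad_fun_approx(2)[OF n])
  have i2: "integrable P (\<lambda>\<omega>. ?q n \<omega> - B 1 \<omega> * cubic_grid n \<omega>)" for n
    unfolding cubic_grid_def by (rule quad_grid_product(1)[OF n])
  have eq: "quad_fun H B (Suc n) \<omega> - B 1 \<omega> * cubic_grid n \<omega>
     = (quad_fun H B (Suc n) \<omega> - ?q n \<omega>) + (?q n \<omega> - B 1 \<omega> * cubic_grid n \<omega>)" for n \<omega> by simp
  show i: "integrable P (\<lambda>\<omega>. quad_fun H B (Suc n) \<omega> - B 1 \<omega> * cubic_grid n \<omega>)" for n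
    unfolding eq by (intro Bochner_Integration.integrable_add i1 i2)
  have bound: "expectation (\<lambda>\<omega>. \<bar>quad_fun H B (Suc n) \<omega> - B 1 \<omega> * cubic_grid n \<omega>\<bar>) \<le> 4 * real (Suc n) powr (H - 1)" for n
  proof -
    have N: "1 \<le> real (Suc n)" by simp
    have "expectation (\<lambda>\<omega>. \<bar>quad_fun H B (Suc n) \<omega> - B 1 \<omega> * cubic_grid n \<omega>\<bar>)
      \<le> expectation (\<lambda>\<omega>. \<bar>quad_fun H B (Suc n) \<omega> - ?q n \<omega>\<bar> + \<bar>?q n \<omega> - B 1 \<omega> * cubic_grid n \<omega>\<bar>)"
      by (rule integral_mono) (use i i1 i2 in auto)
    also have "\<dots> = expectation (\<lambda>\<omega>. \<bar>quad_fun H B (Suc n) \<omega> - ?q n \<omega>\<bar>) + expectation (\<lambda>\<omega>. \<bar>?q n \<omega> - B 1 \<omega> * cubic_grid n \<omega>\<bar>)"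
      using i1 i2 by simp
    also have "\<dots> \<le> 3 * real (Suc n) powr H * (1 / real (Suc n ^ 3)) powr H + real (Suc n) powr (H - 1)"
      using quad_fun_approx(3)[OF n, of n] quad_grid_product(2)[OF n, of n] unfolding cubic_grid_def by (rule add_mono)
    also have "(1 / real (Suc n ^ 3)) powr H = real (Suc n) powr (- 3 * H)"
    proof -
      have "1 / real (Suc n ^ 3) = real (Suc n) powr (- 3)"
        by (simp add: powr_minus powr_numeral inverse_eq_divide del: of_nat_Suc)
      then show ?thesis by (simp add: powr_powr del: of_nat_Suc)
    qed
    also have "3 * real (Suc n) powr H * real (Suc n) powr (- 3 * H) = 3 * real (Suc n) powr (- 2 * H)"
      by (simp add: mult.assoc powr_add[symmetric] del: of_nat_Suc)
    \<comment> \<open>The mesh error has exponent -2H, and -2H <= H - 1 because 3H >= 1.\<close>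
    also have "\<dots> \<le> 3 * real (Suc n) powr (H - 1)"
      using H N by (intro mult_left_mono powr_mono) auto
    finally show ?thesis by simp
  qed
  show "(\<lambda>n. expectation (\<lambda>\<omega>. \<bar>quad_fun H B (Suc n) \<omega> - B 1 \<omega> * cubic_grid n \<omega>\<bar>)) \<longlonglongrightarrow> 0"
  proof (rule real_tendsto_sandwich[OF _ _ tendsto_const])
    show "(\<lambda>n. 4 * real (Suc n) powr (H - 1)) \<longlonglongrightarrow> 0"
      using tendsto_mult_left[OF powr_H_minus_1_null, of 4] by simp
  qed (use bound in \<open>auto intro!: always_eventually integral_nonneg_AE\<close>)
qed

text \<open>B_1 is approximated in L^2 by simple functions, for which the limit is known. The
  approximation is uniform in \<open>n\<close> because the variances of \<open>cubic_grid n\<close>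
  are bounded, so the two limits can be interchanged.\<close>

lemma product_stable_limit:
  assumes Z[measurable]: "Z \<in> borel_measurable P" and bnd: "\<And>\<omega>. \<omega> \<in> space P \<Longrightarrow> \<bar>Z \<omega>\<bar> \<le> D"
  shows "(\<lambda>n. \<integral>\<omega>. complex_of_real (Z \<omega>) * iexp (l * (B 1 \<omega> * cubic_grid n \<omega>)) \<partial>P)
    \<longlonglongrightarrow> (\<integral>\<omega>. complex_of_real (Z \<omega> * exp (- (l * B 1 \<omega> * c_const H)\<^sup>2 / 2)) \<partial>P)"
proof -
  have Xm[measurable]: "cubic_grid n \<in> borel_measurable P" for n by (intro lin_measurable cubic_grid_lin)
  have B1_lin: "B 1 \<in> lin" by (rule lin_B) simp
  have B1[measurable]: "B 1 \<in> borel_measurable P" by (rule lin_measurable[OF B1_lin])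
  \<comment> \<open>The factor 2 in the bound on \<open>u i\<close> supplies the dominating function
    9 B_1^2 for convergence in L^2.\<close>
  obtain u where u: "\<And>i. simple_function P (u i)" and u_lim: "\<And>\<omega>. \<omega> \<in> space P \<Longrightarrow> (\<lambda>i. u i \<omega>) \<longlonglongrightarrow> B 1 \<omega>"
    and u_bnd: "\<And>i \<omega>. \<omega> \<in> space P \<Longrightarrow> dist (u i \<omega>) 0 \<le> 2 * dist (B 1 \<omega>) 0"
    using borel_measurable_implies_sequence_metric[OF B1, of 0] by blast
  have um[measurable]: "u i \<in> borel_measurable P" for i using u by (rule borel_measurable_simple_function)
  have dom: "(B 1 \<omega> - u i \<omega>)\<^sup>2 \<le> 9 * (B 1 \<omega>)\<^sup>2" if "\<omega> \<in> space P" for i \<omega>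
  proof -
    have "\<bar>B 1 \<omega> - u i \<omega>\<bar> \<le> 3 * \<bar>B 1 \<omega>\<bar>" using u_bnd[OF that, of i] by (simp add: dist_real_def)
    then have "\<bar>B 1 \<omega> - u i \<omega>\<bar>\<^sup>2 \<le> (3 * \<bar>B 1 \<omega>\<bar>)\<^sup>2" by (intro power_mono) auto
    then show ?thesis by (simp add: power_mult_distrib)
  qed
  have i9: "integrable P (\<lambda>\<omega>. 9 * (B 1 \<omega>)\<^sup>2)" using lin_integrable_sq[OF B1_lin] by simp
  have iq: "integrable P (\<lambda>\<omega>. (B 1 \<omega> - u i \<omega>)\<^sup>2)" for i
    by (rule Bochner_Integration.integrable_bound[OF i9]) (use dom in auto)
  have q_lim: "(\<lambda>i. expectation (\<lambda>\<omega>. (B 1 \<omega> - u i \<omega>)\<^sup>2)) \<longlonglongrightarrow> expectation (\<lambda>\<omega>. (0::real))"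
  proof (rule integral_dominated_convergence[OF _ _ i9])
    show "AE \<omega> in P. (\<lambda>i. (B 1 \<omega> - u i \<omega>)\<^sup>2) \<longlonglongrightarrow> 0"
    proof (rule AE_I2)
      fix \<omega> assume "\<omega> \<in> space P"
      from tendsto_power[OF tendsto_diff[OF tendsto_const[of "B 1 \<omega>"] u_lim[OF this]], of 2]
      show "(\<lambda>i. (B 1 \<omega> - u i \<omega>)\<^sup>2) \<longlonglongrightarrow> 0" by simp
    qed
  qed (use dom in auto)
  define D' where "D' = \<bar>D\<bar> + 1"
  have D': "0 < D'" "\<And>\<omega>. \<omega> \<in> space P \<Longrightarrow> \<bar>Z \<omega>\<bar> \<le> D'" using bnd by (force simp: D'_def)+
  let ?g = "\<lambda>x. exp (- (l * x * c_const H)\<^sup>2 / 2)"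
  have g1: "?g x \<le> 1" for x by simp
  define b where "b i = (\<integral>\<omega>. complex_of_real (Z \<omega> * ?g (u i \<omega>)) \<partial>P)" for i
  define a where "a = (\<integral>\<omega>. complex_of_real (Z \<omega> * ?g (B 1 \<omega>)) \<partial>P)"
  define A where "A n = (\<integral>\<omega>. complex_of_real (Z \<omega>) * iexp (l * (B 1 \<omega> * cubic_grid n \<omega>)) \<partial>P)" for n
  define Bn where "Bn i n = (\<integral>\<omega>. complex_of_real (Z \<omega>) * iexp (l * (u i \<omega> * cubic_grid n \<omega>)) \<partial>P)" for i n
  have b_lim: "b \<longlonglongrightarrow> a" unfolding b_def a_def
  proof (rule integral_dominated_convergence[where w = "\<lambda>_. D'"])
    show "AE \<omega> in P. (\<lambda>i. complex_of_real (Z \<omega> * ?g (u i \<omega>))) \<longlonglongrightarrow> complex_of_real (Z \<omega> * ?g (B 1 \<omega>))"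
      by (rule AE_I2) (intro tendsto_intros u_lim, auto)
    show "AE \<omega> in P. norm (complex_of_real (Z \<omega> * ?g (u i \<omega>))) \<le> D'" for i
    proof (rule AE_I2)
      fix \<omega> assume "\<omega> \<in> space P"
      then have "\<bar>Z \<omega>\<bar> * ?g (u i \<omega>) \<le> D' * 1" using D' g1 by (intro mult_mono) auto
      then show "norm (complex_of_real (Z \<omega> * ?g (u i \<omega>))) \<le> D'" by (simp add: norm_mult abs_mult)
    qed
  qed auto
  have v_bdd: "Bseq (\<lambda>n. expectation (\<lambda>\<omega>. (cubic_grid n \<omega>)\<^sup>2))"
    using cubic_grid_var by (rule convergent_imp_Bseq[OF convergentI])
  then obtain V where V0: "0 < V" and V': "\<forall>n. norm (expectation (\<lambda>\<omega>. (cubic_grid n \<omega>)\<^sup>2)) \<le> V"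
    unfolding Bseq_def by blast
  have V: "0 < V" "expectation (\<lambda>\<omega>. (cubic_grid n \<omega>)\<^sup>2) \<le> V" for n
    using V0 V'[rule_format, of n] by (auto simp: abs_le_iff)
  \<comment> \<open>The inequality of means with a free parameter \<open>\<kappa>\<close> takes the
    place of Cauchy-Schwarz: \<open>\<kappa>\<close> is made small first, and then \<open>i\<close>
    is chosen such that the second moment of B_1 - u_i is below its square.\<close>
  have close: "cmod (A n - Bn i n) \<le> D' * \<bar>l\<bar> * ((expectation (\<lambda>\<omega>. (B 1 \<omega> - u i \<omega>)\<^sup>2) / \<kappa> + \<kappa> * V) / 2)"
    if \<kappa>: "0 < \<kappa>" for n i \<kappa>
  proof -
    have iA: "integrable P (\<lambda>\<omega>. complex_of_real (Z \<omega>) * iexp (l * (B 1 \<omega> * cubic_grid n \<omega>)))"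
      by (rule integrable_const_bound[where B = D']) (use D' in \<open>auto simp: norm_mult\<close>)
    have iB: "integrable P (\<lambda>\<omega>. complex_of_real (Z \<omega>) * iexp (l * (u i \<omega> * cubic_grid n \<omega>)))"
      by (rule integrable_const_bound[where B = D']) (use D' in \<open>auto simp: norm_mult\<close>)
    have iX: "integrable P (\<lambda>\<omega>. (cubic_grid n \<omega>)\<^sup>2)" by (rule lin_integrable_sq[OF cubic_grid_lin])
    have iR: "integrable P (\<lambda>\<omega>. D' * \<bar>l\<bar> * (((B 1 \<omega> - u i \<omega>)\<^sup>2 / \<kappa> + \<kappa> * (cubic_grid n \<omega>)\<^sup>2) / 2))"
      using iq iX by (intro integrable_mult_right integrable_divide Bochner_Integration.integrable_add) auto
    have "cmod (A n - Bn i n) = cmod (\<integral>\<omega>. complex_of_real (Z \<omega>) * iexp (l * (B 1 \<omega> * cubic_grid n \<omega>))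
       - complex_of_real (Z \<omega>) * iexp (l * (u i \<omega> * cubic_grid n \<omega>)) \<partial>P)"
      unfolding A_def Bn_def using Bochner_Integration.integral_diff[OF iA iB] by (simp only:)
    also have "\<dots> \<le> (\<integral>\<omega>. D' * \<bar>l\<bar> * (((B 1 \<omega> - u i \<omega>)\<^sup>2 / \<kappa> + \<kappa> * (cubic_grid n \<omega>)\<^sup>2) / 2) \<partial>P)"
    proof (rule order_trans[OF integral_norm_bound integral_mono[OF _ iR]])
      show "integrable P (\<lambda>\<omega>. cmod (complex_of_real (Z \<omega>) * iexp (l * (B 1 \<omega> * cubic_grid n \<omega>))
       - complex_of_real (Z \<omega>) * iexp (l * (u i \<omega> * cubic_grid n \<omega>))))"
        by (intro integrable_norm Bochner_Integration.integrable_diff iA iB)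
      fix \<omega> assume \<omega>: "\<omega> \<in> space P"
      let ?d = "\<bar>B 1 \<omega> - u i \<omega>\<bar>" and ?x = "\<bar>cubic_grid n \<omega>\<bar>"
      have "cmod (complex_of_real (Z \<omega>) * iexp (l * (B 1 \<omega> * cubic_grid n \<omega>)) - complex_of_real (Z \<omega>) * iexp (l * (u i \<omega> * cubic_grid n \<omega>)))
        = \<bar>Z \<omega>\<bar> * cmod (iexp (l * (B 1 \<omega> * cubic_grid n \<omega>)) - iexp (l * (u i \<omega> * cubic_grid n \<omega>)))"
        by (simp only: right_diff_distrib[symmetric] norm_mult norm_of_real)
      also have "\<dots> \<le> D' * \<bar>l * (B 1 \<omega> * cubic_grid n \<omega>) - l * (u i \<omega> * cubic_grid n \<omega>)\<bar>"
        using D' \<omega> by (intro mult_mono iexp_lipschitz) auto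
      also have "\<bar>l * (B 1 \<omega> * cubic_grid n \<omega>) - l * (u i \<omega> * cubic_grid n \<omega>)\<bar> = \<bar>l\<bar> * (?d * ?x)"
        by (simp only: right_diff_distrib[symmetric] left_diff_distrib[symmetric] abs_mult)
      also have "D' * (\<bar>l\<bar> * (?d * ?x)) \<le> D' * (\<bar>l\<bar> * (((B 1 \<omega> - u i \<omega>)\<^sup>2 / \<kappa> + \<kappa> * (cubic_grid n \<omega>)\<^sup>2) / 2))"
      proof (intro mult_left_mono)
        have "2 * (\<kappa> * (?d * ?x)) \<le> ?d\<^sup>2 + (\<kappa> * ?x)\<^sup>2"
          using zero_le_power2[of "?d - \<kappa> * ?x"] by (simp add: power2_diff mult_ac)
        then have "2 * (\<kappa> * (?d * ?x)) / \<kappa> \<le> (?d\<^sup>2 + (\<kappa> * ?x)\<^sup>2) / \<kappa>" using \<kappa> by (intro divide_right_mono) auto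
        then have "2 * (?d * ?x) \<le> ?d\<^sup>2 / \<kappa> + \<kappa> * ?x\<^sup>2"
          using \<kappa> by (simp add: power_mult_distrib add_divide_distrib power2_eq_square[of \<kappa>])
        then show "?d * ?x \<le> ((B 1 \<omega> - u i \<omega>)\<^sup>2 / \<kappa> + \<kappa> * (cubic_grid n \<omega>)\<^sup>2) / 2" by simp
      qed (use D' in auto)
      finally show "cmod (complex_of_real (Z \<omega>) * iexp (l * (B 1 \<omega> * cubic_grid n \<omega>)) - complex_of_real (Z \<omega>) * iexp (l * (u i \<omega> * cubic_grid n \<omega>)))
        \<le> D' * \<bar>l\<bar> * (((B 1 \<omega> - u i \<omega>)\<^sup>2 / \<kappa> + \<kappa> * (cubic_grid n \<omega>)\<^sup>2) / 2)" by (simp only: mult.assoc)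
    qed
    also have "\<dots> = D' * \<bar>l\<bar> * ((expectation (\<lambda>\<omega>. (B 1 \<omega> - u i \<omega>)\<^sup>2) / \<kappa> + \<kappa> * expectation (\<lambda>\<omega>. (cubic_grid n \<omega>)\<^sup>2)) / 2)"
      using iq iX by simp
    also have "\<dots> \<le> D' * \<bar>l\<bar> * ((expectation (\<lambda>\<omega>. (B 1 \<omega> - u i \<omega>)\<^sup>2) / \<kappa> + \<kappa> * V) / 2)"
      using V(2)[of n] \<kappa> D' by (intro mult_left_mono divide_right_mono add_mono) auto
    finally show ?thesis .
  qed
  have "A \<longlonglongrightarrow> a"
  proof (rule LIMSEQ_I)
    fix \<epsilon> :: real assume \<epsilon>: "0 < \<epsilon>"
    \<comment> \<open>\<open>\<bar>l\<bar> + 1\<close> instead of \<open>\<bar>l\<bar>\<close> keeps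
      \<open>d\<close> positive when l = 0.\<close>
    define d where "d = D' * (\<bar>l\<bar> + 1) * (1 + V)"
    define \<kappa> where "\<kappa> = \<epsilon> / (3 * d)"
    have den: "0 < d" unfolding d_def using D' V by (intro mult_pos_pos) auto
    have \<kappa>: "0 < \<kappa>" using \<epsilon> den by (simp add: \<kappa>_def)
    have "\<forall>\<^sub>F i in sequentially. expectation (\<lambda>\<omega>. (B 1 \<omega> - u i \<omega>)\<^sup>2) < \<kappa>\<^sup>2"
      using q_lim \<kappa> by (intro order_tendstoD(2)[OF q_lim]) auto
    moreover have "\<forall>\<^sub>F i in sequentially. dist (b i) a < \<epsilon> / 3" using b_lim \<epsilon> by (intro tendstoD) auto
    ultimately have "\<forall>\<^sub>F i in sequentially. expectation (\<lambda>\<omega>. (B 1 \<omega> - u i \<omega>)\<^sup>2) < \<kappa>\<^sup>2 \<and> dist (b i) a < \<epsilon> / 3"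
      by (rule eventually_conj)
    then obtain i where i: "expectation (\<lambda>\<omega>. (B 1 \<omega> - u i \<omega>)\<^sup>2) < \<kappa>\<^sup>2" "dist (b i) a < \<epsilon> / 3"
      using eventually_happens'[OF sequentially_bot] by blast
    have "Bn i \<longlonglongrightarrow> b i" unfolding Bn_def b_def by (rule cubic_grid_mixing_simple[OF Z bnd u])
    then have "\<forall>\<^sub>F n in sequentially. dist (Bn i n) (b i) < \<epsilon> / 3" using \<epsilon> by (intro tendstoD) auto
    then obtain n0 where n0: "\<And>n. n0 \<le> n \<Longrightarrow> dist (Bn i n) (b i) < \<epsilon> / 3" unfolding eventually_sequentially by blast
    have "cmod (A n - Bn i n) \<le> \<epsilon> / 3" for n
    proof -
      have "cmod (A n - Bn i n) \<le> D' * \<bar>l\<bar> * ((expectation (\<lambda>\<omega>. (B 1 \<omega> - u i \<omega>)\<^sup>2) / \<kappa> + \<kappa> * V) / 2)" by (rule close[OF \<kappa>])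
      also have "\<dots> \<le> D' * (\<bar>l\<bar> + 1) * (\<kappa> * (1 + V))"
      proof (intro mult_mono)
        have "expectation (\<lambda>\<omega>. (B 1 \<omega> - u i \<omega>)\<^sup>2) / \<kappa> \<le> \<kappa>\<^sup>2 / \<kappa>" using i(1) \<kappa> by (intro divide_right_mono) auto
        also have "\<dots> = \<kappa>" by (simp add: power2_eq_square)
        finally have "(expectation (\<lambda>\<omega>. (B 1 \<omega> - u i \<omega>)\<^sup>2) / \<kappa> + \<kappa> * V) / 2 \<le> (\<kappa> + \<kappa> * V) / 2"
          by (intro divide_right_mono add_right_mono) simp_all
        also have "\<dots> \<le> \<kappa> * (1 + V)" using \<kappa> V mult_pos_pos[OF \<kappa> V(1)] by (simp add: distrib_left)
        finally show "(expectation (\<lambda>\<omega>. (B 1 \<omega> - u i \<omega>)\<^sup>2) / \<kappa> + \<kappa> * V) / 2 \<le> \<kappa> * (1 + V)" .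
        have "0 \<le> expectation (\<lambda>\<omega>. (B 1 \<omega> - u i \<omega>)\<^sup>2)" by (intro integral_nonneg_AE) auto
        then show "0 \<le> (expectation (\<lambda>\<omega>. (B 1 \<omega> - u i \<omega>)\<^sup>2) / \<kappa> + \<kappa> * V) / 2" using \<kappa> V by simp
      qed (use D' in auto)
      also have "\<dots> = d * \<kappa>" unfolding d_def by (simp only: mult_ac)
      also have "\<dots> = \<epsilon> / 3" unfolding \<kappa>_def using den by simp
      finally show ?thesis .
    qed
    then have "norm (A n - a) < \<epsilon>" if "n0 \<le> n" for n
    proof -
      have "A n - a = (A n - Bn i n) + (Bn i n - b i) + (b i - a)" by simp
      then have "norm (A n - a) \<le> norm (A n - Bn i n) + norm (Bn i n - b i) + norm (b i - a)"
        by (simp only:) (rule order_trans[OF norm_triangle_ineq add_right_mono[OF norm_triangle_ineq]])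
      then show ?thesis using \<open>\<And>n. cmod (A n - Bn i n) \<le> \<epsilon> / 3\<close>[of n] n0[OF that] i(2) by (simp add: dist_norm)
    qed
    then show "\<exists>no. \<forall>n\<ge>no. norm (A n - a) < \<epsilon>" by blast
  qed
  then show ?thesis unfolding A_def a_def .
qed

text \<open>The exponential is Lipschitz on the imaginary axis, so L^1 closeness to B_1 times
  \<open>cubic_grid n\<close> is enough. Passing to \<open>Suc n\<close> drops the index 0, which
  the estimates do not cover.\<close>

lemma quad_fun_stable_limit:
  assumes Z[measurable]: "Z \<in> borel_measurable P" and bnd: "\<And>\<omega>. \<omega> \<in> space P \<Longrightarrow> \<bar>Z \<omega>\<bar> \<le> D"
  shows "(\<lambda>n. \<integral>\<omega>. complex_of_real (Z \<omega>) * iexp (l * quad_fun H B n \<omega>) \<partial>P)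
    \<longlonglongrightarrow> (\<integral>\<omega>. complex_of_real (Z \<omega> * exp (- (l * B 1 \<omega> * c_const H)\<^sup>2 / 2)) \<partial>P)"
proof (rule LIMSEQ_imp_Suc)
  have [measurable]: "cubic_grid n \<in> borel_measurable P" for n by (intro lin_measurable cubic_grid_lin)
  have [measurable]: "B 1 \<in> borel_measurable P" by (intro lin_measurable lin_B) simp
  have [measurable]: "quad_fun H B (Suc n) \<in> borel_measurable P" for n by (rule quad_fun_approx(1)[where m = 1]) auto
  define D' where "D' = \<bar>D\<bar> + 1"
  have D': "0 < D'" "\<And>\<omega>. \<omega> \<in> space P \<Longrightarrow> \<bar>Z \<omega>\<bar> \<le> D'" using bnd by (force simp: D'_def)+
  let ?A = "\<lambda>n. \<integral>\<omega>. complex_of_real (Z \<omega>) * iexp (l * quad_fun H B (Suc n) \<omega>) \<partial>P"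
  let ?B = "\<lambda>n. \<integral>\<omega>. complex_of_real (Z \<omega>) * iexp (l * (B 1 \<omega> * cubic_grid n \<omega>)) \<partial>P"
  have close: "cmod (?A n - ?B n) \<le> D' * \<bar>l\<bar> * expectation (\<lambda>\<omega>. \<bar>quad_fun H B (Suc n) \<omega> - B 1 \<omega> * cubic_grid n \<omega>\<bar>)" for n
  proof -
    have iA: "integrable P (\<lambda>\<omega>. complex_of_real (Z \<omega>) * iexp (l * quad_fun H B (Suc n) \<omega>))"
      by (rule integrable_const_bound[where B = D']) (use D' in \<open>auto simp: norm_mult\<close>)
    have iB: "integrable P (\<lambda>\<omega>. complex_of_real (Z \<omega>) * iexp (l * (B 1 \<omega> * cubic_grid n \<omega>)))"
      by (rule integrable_const_bound[where B = D']) (use D' in \<open>auto simp: norm_mult\<close>)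
    have "cmod (?A n - ?B n) = cmod (\<integral>\<omega>. complex_of_real (Z \<omega>) * iexp (l * quad_fun H B (Suc n) \<omega>) - complex_of_real (Z \<omega>) * iexp (l * (B 1 \<omega> * cubic_grid n \<omega>)) \<partial>P)"
      using Bochner_Integration.integral_diff[OF iA iB] by (simp only:)
    also have "\<dots> \<le> (\<integral>\<omega>. D' * \<bar>l\<bar> * \<bar>quad_fun H B (Suc n) \<omega> - B 1 \<omega> * cubic_grid n \<omega>\<bar> \<partial>P)"
    proof (rule order_trans[OF integral_norm_bound integral_mono])
      show "integrable P (\<lambda>\<omega>. cmod (complex_of_real (Z \<omega>) * iexp (l * quad_fun H B (Suc n) \<omega>) - complex_of_real (Z \<omega>) * iexp (l * (B 1 \<omega> * cubic_grid n \<omega>))))"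
        by (intro integrable_norm Bochner_Integration.integrable_diff iA iB)
      show "integrable P (\<lambda>\<omega>. D' * \<bar>l\<bar> * \<bar>quad_fun H B (Suc n) \<omega> - B 1 \<omega> * cubic_grid n \<omega>\<bar>)"
        by (intro integrable_mult_right integrable_abs quad_fun_product_L1)
      fix \<omega> assume \<omega>: "\<omega> \<in> space P"
      have "cmod (complex_of_real (Z \<omega>) * iexp (l * quad_fun H B (Suc n) \<omega>) - complex_of_real (Z \<omega>) * iexp (l * (B 1 \<omega> * cubic_grid n \<omega>)))
        = \<bar>Z \<omega>\<bar> * cmod (iexp (l * quad_fun H B (Suc n) \<omega>) - iexp (l * (B 1 \<omega> * cubic_grid n \<omega>)))"
        by (simp only: right_diff_distrib[symmetric] norm_mult norm_of_real)
      also have "\<dots> \<le> D' * \<bar>l * quad_fun H B (Suc n) \<omega> - l * (B 1 \<omega> * cubic_grid n \<omega>)\<bar>"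
        using D' \<omega> by (intro mult_mono iexp_lipschitz) auto
      finally show "cmod (complex_of_real (Z \<omega>) * iexp (l * quad_fun H B (Suc n) \<omega>) - complex_of_real (Z \<omega>) * iexp (l * (B 1 \<omega> * cubic_grid n \<omega>)))
        \<le> D' * \<bar>l\<bar> * \<bar>quad_fun H B (Suc n) \<omega> - B 1 \<omega> * cubic_grid n \<omega>\<bar>"
        by (simp only: right_diff_distrib[symmetric] abs_mult mult.assoc)
    qed
    also have "\<dots> = D' * \<bar>l\<bar> * expectation (\<lambda>\<omega>. \<bar>quad_fun H B (Suc n) \<omega> - B 1 \<omega> * cubic_grid n \<omega>\<bar>)" by simp
    finally show ?thesis .
  qed
  have null: "(\<lambda>n. D' * \<bar>l\<bar> * expectation (\<lambda>\<omega>. \<bar>quad_fun H B (Suc n) \<omega> - B 1 \<omega> * cubic_grid n \<omega>\<bar>)) \<longlonglongrightarrow> 0"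
    using tendsto_mult_left[OF quad_fun_product_L1(2), of "D' * \<bar>l\<bar>"] unfolding mult_zero_right .
  have "(\<lambda>n. ?A n - ?B n) \<longlonglongrightarrow> 0"
    by (rule Lim_null_comparison[OF always_eventually[OF allI[OF close]] null])
  from tendsto_add[OF this product_stable_limit[OF Z bnd, of l]]
  show "?A \<longlonglongrightarrow> (\<integral>\<omega>. complex_of_real (Z \<omega> * exp (- (l * B 1 \<omega> * c_const H)\<^sup>2 / 2)) \<partial>P)"
    by (simp only: diff_add_cancel add_0)
qed

text \<open>For fixed \<open>n\<close> let \<open>m\<close> tend to infinity: \<open>K\<close>
  multiplies only the discretization error, which disappears, so the final bound is free of
  \<open>K\<close>.\<close>

lemma quad_fun_tv_tests:
  "\<exists>k. \<forall>n\<ge>1. \<forall>f K. f \<in> borel_measurable borel \<longrightarrow> (\<forall>x. 0 \<le> f x \<and> f x \<le> 1) \<longrightarrow> (\<forall>x y. \<bar>f x - f y\<bar> \<le> K * \<bar>x - y\<bar>) \<longrightarrow>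
    \<bar>expectation (\<lambda>\<omega>. f (quad_fun H B n \<omega>)) - limit_law f\<bar> \<le> k * real n powr (- (1 - H) / 15)"
proof -
  obtain k where k: "\<And>n m f. 1 \<le> n \<Longrightarrow> n ^ 3 \<le> m \<Longrightarrow> f \<in> borel_measurable borel \<Longrightarrow> (\<forall>x. 0 \<le> f x \<and> f x \<le> 1) \<Longrightarrow>
    \<bar>expectation (\<lambda>\<omega>. f (quad_grid n m \<omega>)) - limit_law f\<bar> \<le> k * real n powr (- (1 - H) / 15)"
    using quad_grid_tv by blast
  have "\<bar>expectation (\<lambda>\<omega>. f (quad_fun H B n \<omega>)) - limit_law f\<bar> \<le> k * real n powr (- (1 - H) / 15)"
    if n: "1 \<le> n" and f[measurable]: "f \<in> borel_measurable borel" and f01: "\<forall>x. 0 \<le> f x \<and> f x \<le> 1"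
      and lip: "\<And>x y. \<bar>f x - f y\<bar> \<le> K * \<bar>x - y\<bar>" for n f K
  proof -
    have K0: "0 \<le> K" using order_trans[OF abs_ge_zero lip[of 1 0]] by simp
    let ?r = "k * real n powr (- (1 - H) / 15)"
    have bound: "\<bar>expectation (\<lambda>\<omega>. f (quad_fun H B n \<omega>)) - limit_law f\<bar> \<le> ?r + K * (3 * real n powr H * (1 / real m) powr H)"
      if m: "n ^ 3 \<le> m" for m
    proof -
      have m1: "1 \<le> m" using n m by (metis le_trans one_le_power)
      note [measurable] = quad_fun_approx(1)[OF n m1]
      have [measurable]: "quad_grid n m \<in> borel_measurable P"
        unfolding quad_grid_def[abs_def] by (intro borel_measurable_times borel_measurable_sum borel_measurable_diff borel_measurable_power borel_measurable_const lin_measurable lin_B) auto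
      have i: "integrable P (\<lambda>\<omega>. f (quad_fun H B n \<omega>))" "integrable P (\<lambda>\<omega>. f (quad_grid n m \<omega>))"
        by (rule integrable_const_bound[where B = 1]; use f01 in \<open>auto simp: abs_le_iff intro: order_trans[of _ 0]\<close>)+
      have "\<bar>expectation (\<lambda>\<omega>. f (quad_fun H B n \<omega>)) - expectation (\<lambda>\<omega>. f (quad_grid n m \<omega>))\<bar>
        = \<bar>expectation (\<lambda>\<omega>. f (quad_fun H B n \<omega>) - f (quad_grid n m \<omega>))\<bar>" using i by simp
      also have "\<dots> \<le> expectation (\<lambda>\<omega>. K * \<bar>quad_fun H B n \<omega> - quad_grid n m \<omega>\<bar>)"
        by (rule order_trans[OF integral_abs_bound integral_mono])
          (use i lip quad_fun_approx(2)[OF n m1] in auto)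
      also have "\<dots> = K * expectation (\<lambda>\<omega>. \<bar>quad_fun H B n \<omega> - quad_grid n m \<omega>\<bar>)" by simp
      also have "\<dots> \<le> K * (3 * real n powr H * (1 / real m) powr H)"
        using quad_fun_approx(3)[OF n m1] K0 by (intro mult_left_mono)
      finally show ?thesis using k[OF n m f f01] by linarith
    qed
    have "(\<lambda>m. (1 / real m) powr H) \<longlonglongrightarrow> 0"
    proof -
      have "(\<lambda>m. real m powr (- H)) \<longlonglongrightarrow> 0"
        by (rule tendsto_neg_powr[OF _ filterlim_real_sequentially]) (use H in simp)
      then show ?thesis by (simp add: powr_minus inverse_eq_divide powr_divide)
    qed
    then have "(\<lambda>m. ?r + K * (3 * real n powr H * (1 / real m) powr H)) \<longlonglongrightarrow> ?r + K * (3 * real n powr H * 0)"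
      by (intro tendsto_intros)
    then have "(\<lambda>m. ?r + K * (3 * real n powr H * (1 / real m) powr H)) \<longlonglongrightarrow> ?r" by simp
    then show ?thesis by (rule LIMSEQ_le_const) (use bound in blast)
  qed
  then show ?thesis by blast
qed

section \<open>The extended probability space\<close>

lemma process_sigma_B: "0 \<le> t \<Longrightarrow> B t \<in> borel_measurable (process_sigma P {0..} B)"
proof (rule measurableI)
  fix A :: "real set" assume t: "0 \<le> t" and A: "A \<in> sets borel"
  have "B t -` A \<inter> space P \<in> (\<Union>t\<in>{0..}. {B t -` A \<inter> space P | A. A \<in> sets borel})" using t A by auto
  then have "B t -` A \<inter> space P \<in> sets (process_sigma P {0..} B)"
    unfolding process_sigma_def by (rule in_measure_of[rotated]) auto 
  then show "B t -` A \<inter> space (process_sigma P {0..} B) \<in> sets (process_sigma P {0..} B)"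
    using process_subalgebra by (simp add: subalgebra_def)
qed simp

text \<open>The pair of \<open>\<eta>\<close> and \<open>p\<close> has a product law on the Borel
  sets times the sigma-algebra of the process, so Fubini's theorem applies. \<open>F\<close> is
  measurable for the uncompleted sigma-algebra because the independence hypothesis speaks of that
  one.\<close>

lemma extension_expectation:
  fixes P' :: "'b measure" and p :: "'b \<Rightarrow> 'a" and \<eta> :: "'b \<Rightarrow> real"
    and F :: "real \<Rightarrow> 'a \<Rightarrow> 'c :: {banach, second_countable_topology}"
  assumes ext: "extends_prob_space P' p P"
    and \<eta>: "distributed P' lborel \<eta> std_normal_density"
    and ind: "independent_of_process P' \<eta> {0..} (\<lambda>t \<omega>'. B t (p \<omega>'))"
    and F: "case_prod F \<in> borel_measurable (borel \<Otimes>\<^sub>M process_sigma P {0..} B)"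
    and bnd: "\<And>y \<omega>. norm (F y \<omega>) \<le> C"
  shows "(\<integral>\<omega>'. F (\<eta> \<omega>') (p \<omega>') \<partial>P') = (\<integral>\<omega>. (\<integral>y. F y \<omega> \<partial>std_normal_distribution) \<partial>P)"
proof -
  let ?S = "process_sigma P {0..} B"
  let ?S' = "process_sigma P' {0..} (\<lambda>t \<omega>'. B t (p \<omega>'))"
  let ?N = "std_normal_distribution"
  interpret P': prob_space P' using ext by (simp add: extends_prob_space_def)
  interpret N: prob_space ?N by (rule prob_space_normal_density) simp
  have p: "p \<in> measurable P' P" and dp: "distr P' P p = P" using ext by (auto simp: extends_prob_space_def)
  have space_S: "space ?S = space P" and sets_S: "sets ?S \<subseteq> sets P"
    using process_subalgebra by (auto simp: subalgebra_def)
  have \<eta>m[measurable]: "\<eta> \<in> borel_measurable P'" using \<eta> by (simp add: distributed_def)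
  have pS[measurable]: "p \<in> measurable P' ?S"
    using measurable_space[OF p] measurable_sets[OF p] sets_S by (intro measurableI) (auto simp: space_S)
  \<comment> \<open>Events of the process on \<open>P\<close> pull back to events of the process
    \<open>B t (p \<omega>')\<close>, to which the independence hypothesis refers.\<close>
  have pull: "p \<in> measurable ?S' ?S"
    unfolding process_sigma_def[of P]
  proof (rule measurable_measure_of)
    show "(\<Union>t\<in>{0..}. {B t -` A \<inter> space P | A. A \<in> sets borel}) \<subseteq> Pow (space P)" by auto
    have sp: "space ?S' = space P'" by (simp add: process_sigma_def space_measure_of_conv)
    show "p \<in> space ?S' \<rightarrow> space P" using measurable_space[OF p] by (simp add: sp)
    fix Y assume "Y \<in> (\<Union>t\<in>{0..}. {B t -` A \<inter> space P | A. A \<in> sets borel})"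
    then obtain t A where t: "0 \<le> t" "A \<in> sets borel" "Y = B t -` A \<inter> space P" by auto
    have "p -` Y \<inter> space ?S' = (\<lambda>\<omega>'. B t (p \<omega>')) -` A \<inter> space P'"
      using measurable_space[OF p] t(3) by (auto simp: sp)
    moreover have "\<dots> \<in> (\<Union>t\<in>{0..}. {(\<lambda>\<omega>'. B t (p \<omega>')) -` A \<inter> space P' | A. A \<in> sets borel})" using t by auto
    ultimately show "p -` Y \<inter> space ?S' \<in> sets ?S'"
      unfolding process_sigma_def[of P'] by (auto intro!: in_measure_of)
  qed
  define Q where "Q = distr P' ?S p"
  interpret Q: prob_space Q unfolding Q_def by (rule P'.prob_space_distr[OF pS])
  interpret NQ: pair_prob_space ?N Q ..
  have d\<eta>: "distr P' borel \<eta> = ?N"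
    using distributed_distr_eq_density[OF \<eta>] by (metis distr_cong sets_lborel)
  have prod: "?N \<Otimes>\<^sub>M Q = distr P' (borel \<Otimes>\<^sub>M ?S) (\<lambda>\<omega>'. (\<eta> \<omega>', p \<omega>'))"
  proof (rule pair_measure_eqI)
    show "sigma_finite_measure ?N" "sigma_finite_measure Q" by unfold_locales
    show "sets (?N \<Otimes>\<^sub>M Q) = sets (distr P' (borel \<Otimes>\<^sub>M ?S) (\<lambda>\<omega>'. (\<eta> \<omega>', p \<omega>')))"
      by (simp add: Q_def cong: sets_pair_measure_cong)
    fix A E assume AE: "A \<in> sets ?N" "E \<in> sets Q"
    then have A: "A \<in> sets borel" and E: "E \<in> sets ?S" by (auto simp: Q_def)
    have E': "p -` E \<inter> space P' \<in> sets ?S'"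
      using measurable_sets[OF pull E] by (simp add: process_sigma_def space_measure_of_conv)
    have "P'.prob ((\<eta> -` A \<inter> space P') \<inter> (p -` E \<inter> space P')) = P'.prob (\<eta> -` A \<inter> space P') * P'.prob (p -` E \<inter> space P')"
      using ind E' A unfolding independent_of_process_def by (intro P'.indep_setD) auto
    moreover have "(\<eta> -` A \<inter> space P') \<inter> (p -` E \<inter> space P') = (\<lambda>\<omega>'. (\<eta> \<omega>', p \<omega>')) -` (A \<times> E) \<inter> space P'" by auto
    moreover have "emeasure ?N A = emeasure P' (\<eta> -` A \<inter> space P')"
      unfolding d\<eta>[symmetric] using A by (simp add: emeasure_distr)
    moreover have "emeasure Q E = emeasure P' (p -` E \<inter> space P')"
      unfolding Q_def using E pS by (simp add: emeasure_distr)
    moreover have "emeasure (distr P' (borel \<Otimes>\<^sub>M ?S) (\<lambda>\<omega>'. (\<eta> \<omega>', p \<omega>'))) (A \<times> E) = emeasure P' ((\<lambda>\<omega>'. (\<eta> \<omega>', p \<omega>')) -` (A \<times> E) \<inter> space P')"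
      using A E by (intro emeasure_distr measurable_Pair \<eta>m pS) auto
    ultimately show "emeasure ?N A * emeasure Q E = emeasure (distr P' (borel \<Otimes>\<^sub>M ?S) (\<lambda>\<omega>'. (\<eta> \<omega>', p \<omega>'))) (A \<times> E)"
      by (simp add: P'.emeasure_eq_measure ennreal_mult)
  qed
  have FQ: "case_prod F \<in> borel_measurable (?N \<Otimes>\<^sub>M Q)"
    using F by (simp add: Q_def cong: measurable_cong_sets sets_pair_measure_cong)
  have iF: "integrable (?N \<Otimes>\<^sub>M Q) (case_prod F)"
    by (rule NQ.integrable_const_bound[where B = C, OF _ FQ]) (use bnd in auto)
  have h: "(\<lambda>\<omega>. \<integral>y. F y \<omega> \<partial>?N) \<in> borel_measurable ?S"
  proof -
    have "(\<lambda>(\<omega>, y). F y \<omega>) \<in> borel_measurable (?S \<Otimes>\<^sub>M borel)"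
      using measurable_compose[OF measurable_pair_swap' F] by (simp add: split_beta')
    then have "(\<lambda>(\<omega>, y). F y \<omega>) \<in> borel_measurable (?S \<Otimes>\<^sub>M ?N)"
      by (simp cong: measurable_cong_sets sets_pair_measure_cong)
    then show ?thesis by (rule N.borel_measurable_lebesgue_integral)
  qed
  have "(\<integral>\<omega>'. F (\<eta> \<omega>') (p \<omega>') \<partial>P') = (\<integral>z. case_prod F z \<partial>distr P' (borel \<Otimes>\<^sub>M ?S) (\<lambda>\<omega>'. (\<eta> \<omega>', p \<omega>')))"
    by (subst integral_distr[OF measurable_Pair[OF \<eta>m pS] F]) simp
  also have "\<dots> = (\<integral>q. (\<integral>y. F y q \<partial>?N) \<partial>Q)"
    unfolding prod[symmetric] by (rule NQ.integral_snd[OF iF, symmetric])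
  also have "\<dots> = (\<integral>\<omega>'. (\<integral>y. F y (p \<omega>') \<partial>?N) \<partial>P')"
    unfolding Q_def by (rule integral_distr[OF pS h])
  also have "\<dots> = (\<integral>\<omega>. (\<integral>y. F y \<omega> \<partial>?N) \<partial>distr P' P p)"
    by (rule integral_distr[OF p measurable_from_subalg[OF process_subalgebra h], symmetric])
  finally show ?thesis unfolding dp .
qed

text \<open>For fixed B_1 its sign can be moved to the other normal variable, whose law is
  symmetric; this removes the absolute value.\<close>

lemma limit_law_extension:
  fixes P' :: "'b measure" and p :: "'b \<Rightarrow> 'a" and \<eta> :: "'b \<Rightarrow> real"
  assumes ext: "extends_prob_space P' p P"
    and \<eta>: "distributed P' lborel \<eta> std_normal_density"
    and ind: "independent_of_process P' \<eta> {0..} (\<lambda>t \<omega>'. B t (p \<omega>'))"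
    and f[measurable]: "f \<in> borel_measurable borel" and f01: "\<And>x. 0 \<le> f x" "\<And>x. f x \<le> 1"
  shows "(\<integral>\<omega>'. f (c_const H * \<bar>B 1 (p \<omega>')\<bar> * \<eta> \<omega>') \<partial>P') = limit_law f"
proof -
  let ?N = "std_normal_distribution"
  have [measurable]: "B 1 \<in> borel_measurable (process_sigma P {0..} B)" by (rule process_sigma_B) simp
  have NI: "(\<integral>y. g y \<partial>?N) = (\<integral>y. g y * std_normal_density y \<partial>lborel)"
    if "g \<in> borel_measurable borel" for g :: "real \<Rightarrow> real"
    using that by (subst integral_density) (auto simp: mult.commute)
  define h where "h b = (\<integral>y. f (c_const H * b * y) * std_normal_density y \<partial>lborel)" for b
  have [measurable]: "h \<in> borel_measurable borel" unfolding h_def[abs_def] by measurable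
  have h_abs: "(\<integral>y. f (c_const H * \<bar>b\<bar> * y) \<partial>?N) = h b" for b
  proof (cases "0 \<le> b")
    case True
    then show ?thesis unfolding h_def by (subst NI) auto
  next
    case False
    have "(\<integral>y. f (c_const H * \<bar>b\<bar> * y) \<partial>?N) = (\<integral>y. f (c_const H * b * (- y)) * std_normal_density y \<partial>lborel)"
      using False by (subst NI) auto
    also have "\<dots> = h b" unfolding h_def by (rule std_normal_integral_reflect[of "\<lambda>y. f (c_const H * b * y)"])
    finally show ?thesis .
  qed
  have "(\<integral>\<omega>'. f (c_const H * \<bar>B 1 (p \<omega>')\<bar> * \<eta> \<omega>') \<partial>P') = (\<integral>\<omega>. (\<integral>y. f (c_const H * \<bar>B 1 \<omega>\<bar> * y) \<partial>?N) \<partial>P)"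
  proof (rule extension_expectation[OF ext \<eta> ind, where F = "\<lambda>y \<omega>. f (c_const H * \<bar>B 1 \<omega>\<bar> * y)" and C = 1])
    show "(\<lambda>(y, \<omega>). f (c_const H * \<bar>B 1 \<omega>\<bar> * y)) \<in> borel_measurable (borel \<Otimes>\<^sub>M process_sigma P {0..} B)"
      by measurable
    show "norm (f (c_const H * \<bar>B 1 \<omega>\<bar> * y)) \<le> 1" for y \<omega>
      using f01 by simp
  qed
  also have "\<dots> = (\<integral>\<omega>. h (B 1 \<omega>) \<partial>P)" by (simp only: h_abs)
  also have "\<dots> = (\<integral>x. std_normal_density x * h x \<partial>lborel)"
    by (rule distributed_integral[OF B1_std_normal, symmetric]) auto
  finally show ?thesis unfolding limit_law_def h_def by (simp only: mult.commute)
qed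

end

theorem theorem3p6:
  fixes P :: "'a measure" and P' :: "'b measure"
    and B :: "real \<Rightarrow> 'a \<Rightarrow> real" and p :: "'b \<Rightarrow> 'a" and \<eta> :: "'b \<Rightarrow> real" and H :: real
  assumes "1/2 \<le> H" and "H < 1"
    and "fractional_brownian_motion P H B"
    and "completed_generated_by P {0..} B"
    and "measurable_process_01 P B"
    and "extends_prob_space P' p P"
    and "distributed P' lborel \<eta> std_normal_density"
    and "independent_of_process P' \<eta> {0..} (\<lambda>t \<omega>'. B t (p \<omega>'))"
  shows "converges_stably P (quad_fun H B) P' p (\<lambda>\<omega>'. c_const H * \<bar>B 1 (p \<omega>')\<bar> * \<eta> \<omega>') \<and>
    (\<exists>k::real. \<forall>n\<ge>1.
       dTV P (quad_fun H B n) P' (\<lambda>\<omega>'. c_const H * \<bar>B 1 (p \<omega>')\<bar> * \<eta> \<omega>')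
         \<le> k * real n powr (- (1 - H) / 15))"
proof -
  have "prob_space P" using assms(3) by (simp add: fractional_brownian_motion_def gaussian_process_def)
  then interpret measurable_fbm P H B
    using assms by (auto simp: measurable_fbm_def measurable_fbm_axioms_def fbm_def fbm_axioms_def)
  interpret P': prob_space P' using assms(6) by (simp add: extends_prob_space_def)
  have p[measurable]: "p \<in> measurable P' P" and dp: "distr P' P p = P"
    using assms(6) by (auto simp: extends_prob_space_def)
  have B1[measurable]: "B 1 \<in> borel_measurable P" by (intro lin_measurable lin_B) simp
  have B1S[measurable]: "B 1 \<in> borel_measurable (process_sigma P {0..} B)" by (rule process_sigma_B) simp
  have \<eta>[measurable]: "\<eta> \<in> borel_measurable P'" using assms(7) by (simp add: distributed_def)
  define G where "G \<omega>' = c_const H * \<bar>B 1 (p \<omega>')\<bar> * \<eta> \<omega>'" for \<omega>'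
  have Gm[measurable]: "G \<in> borel_measurable P'" unfolding G_def[abs_def] by measurable
  \<comment> \<open>\<open>0 powr (1 + H)\<close> is 0. The definition of stable convergence asks
    for measurability at the index 0 as well.\<close>
  have A0: "quad_fun H B 0 = (\<lambda>\<omega>. 0)" by (simp add: quad_fun_def fun_eq_iff)
  have Am: "quad_fun H B n \<in> borel_measurable P" for n
    using quad_fun_approx(1)[of n 1] by (cases "n = 0") (auto simp: A0)
  have stable: "converges_stably P (quad_fun H B) P' p G"
    unfolding converges_stably_def
  proof (intro conjI allI impI Am Gm)
    fix l :: real and Z :: "'a \<Rightarrow> real"
    assume Z: "Z \<in> borel_measurable P" and "\<exists>C. \<forall>\<omega>\<in>space P. \<bar>Z \<omega>\<bar> \<le> C"
    then obtain C where C: "\<And>\<omega>. \<omega> \<in> space P \<Longrightarrow> \<bar>Z \<omega>\<bar> \<le> C" by blast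
    obtain Z0 where Z0: "Z0 \<in> borel_measurable (process_sigma P {0..} B)" "AE \<omega> in P. Z \<omega> = Z0 \<omega>"
      by (rule process_measurable_version[OF Z])
    \<comment> \<open>\<open>Z0\<close> is bounded only almost surely; clamping gives a version that
      is bounded everywhere, as \<open>extension_expectation\<close> requires.\<close>
    define Y where "Y \<omega> = max (- \<bar>C\<bar>) (min \<bar>C\<bar> (Z0 \<omega>))" for \<omega>
    have Ym[measurable]: "Y \<in> borel_measurable (process_sigma P {0..} B)"
      unfolding Y_def[abs_def] using Z0(1) by measurable
    have YP[measurable]: "Y \<in> borel_measurable P" by (rule measurable_from_subalg[OF process_subalgebra Ym])
    have Yb: "\<bar>Y \<omega>\<bar> \<le> \<bar>C\<bar>" for \<omega> by (auto simp: Y_def)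
    have ZY: "AE \<omega> in P. Z \<omega> = Y \<omega>"
      using Z0(2) AE_space
    proof eventually_elim
      case (elim \<omega>)
      then show ?case using C[OF elim(2)] by (auto simp: Y_def abs_le_iff)
    qed
    have ZY': "AE \<omega>' in P'. Z (p \<omega>') = Y (p \<omega>')"
    proof (rule AE_distrD[OF p])
      show "AE \<omega> in distr P' P p. Z \<omega> = Y \<omega>" unfolding dp by (rule ZY)
    qed
    have Zp: "(\<lambda>\<omega>'. Z (p \<omega>')) \<in> borel_measurable P'" by (rule measurable_compose[OF p Z])
    have lim: "(\<lambda>n. \<integral>\<omega>. complex_of_real (Z \<omega>) * iexp (l * quad_fun H B n \<omega>) \<partial>P)
      \<longlonglongrightarrow> (\<integral>\<omega>. complex_of_real (Z \<omega> * exp (- (l * B 1 \<omega> * c_const H)\<^sup>2 / 2)) \<partial>P)"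
      by (rule quad_fun_stable_limit[OF Z C])
    have "(\<integral>\<omega>'. complex_of_real (Z (p \<omega>')) * iexp (l * G \<omega>') \<partial>P')
      = (\<integral>\<omega>'. complex_of_real (Y (p \<omega>')) * iexp (l * (c_const H * \<bar>B 1 (p \<omega>')\<bar> * \<eta> \<omega>')) \<partial>P')"
    proof (rule integral_cong_AE)
      show "AE \<omega>' in P'. complex_of_real (Z (p \<omega>')) * iexp (l * G \<omega>') = complex_of_real (Y (p \<omega>')) * iexp (l * (c_const H * \<bar>B 1 (p \<omega>')\<bar> * \<eta> \<omega>'))"
        using ZY' by eventually_elim (simp only: G_def)
    qed (use Zp in measurable)
    also have "\<dots> = (\<integral>\<omega>. (\<integral>y. complex_of_real (Y \<omega>) * iexp (l * (c_const H * \<bar>B 1 \<omega>\<bar> * y)) \<partial>std_normal_distribution) \<partial>P)"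
    proof (rule extension_expectation[OF assms(6-8), where F = "\<lambda>y \<omega>. complex_of_real (Y \<omega>) * iexp (l * (c_const H * \<bar>B 1 \<omega>\<bar> * y))" and C = "\<bar>C\<bar>"])
      show "(\<lambda>(y, \<omega>). complex_of_real (Y \<omega>) * iexp (l * (c_const H * \<bar>B 1 \<omega>\<bar> * y))) \<in> borel_measurable (borel \<Otimes>\<^sub>M process_sigma P {0..} B)"
        by measurable
      show "norm (complex_of_real (Y \<omega>) * iexp (l * (c_const H * \<bar>B 1 \<omega>\<bar> * y))) \<le> \<bar>C\<bar>" for y \<omega>
        using Yb[of \<omega>] by (simp only: norm_mult norm_exp_i_times norm_of_real mult_1_right)
    qed
    also have "\<dots> = (\<integral>\<omega>. complex_of_real (Y \<omega> * exp (- (l * B 1 \<omega> * c_const H)\<^sup>2 / 2)) \<partial>P)"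
    proof (rule Bochner_Integration.integral_cong[OF refl])
      fix \<omega>
      \<comment> \<open>The inner integral is the standard normal characteristic function at l times
        c_H |B_1|; its square in the exponent removes the absolute value and gives the limit found
        on \<open>P\<close>.\<close>
      have "(\<integral>y. complex_of_real (Y \<omega>) * iexp (l * (c_const H * \<bar>B 1 \<omega>\<bar> * y)) \<partial>std_normal_distribution)
        = complex_of_real (Y \<omega>) * char std_normal_distribution (l * (c_const H * \<bar>B 1 \<omega>\<bar>))"
        unfolding char_def integral_mult_right_zero by (simp only: mult.assoc)
      also have "\<dots> = complex_of_real (Y \<omega>) * complex_of_real (exp (- (l * (c_const H * \<bar>B 1 \<omega>\<bar>))\<^sup>2 / 2))"
        by (simp only: char_std_normal_distribution)
      also have "(l * (c_const H * \<bar>B 1 \<omega>\<bar>))\<^sup>2 = (l * B 1 \<omega> * c_const H)\<^sup>2" by (simp add: power_mult_distrib)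
      finally show "(\<integral>y. complex_of_real (Y \<omega>) * iexp (l * (c_const H * \<bar>B 1 \<omega>\<bar> * y)) \<partial>std_normal_distribution)
        = complex_of_real (Y \<omega> * exp (- (l * B 1 \<omega> * c_const H)\<^sup>2 / 2))" by (simp only: of_real_mult)
    qed
    also have "\<dots> = (\<integral>\<omega>. complex_of_real (Z \<omega> * exp (- (l * B 1 \<omega> * c_const H)\<^sup>2 / 2)) \<partial>P)"
    proof (rule integral_cong_AE)
      show "AE \<omega> in P. complex_of_real (Y \<omega> * exp (- (l * B 1 \<omega> * c_const H)\<^sup>2 / 2)) = complex_of_real (Z \<omega> * exp (- (l * B 1 \<omega> * c_const H)\<^sup>2 / 2))"
        using ZY by eventually_elim (simp only:)
    qed (use Z in measurable)
    finally show "(\<lambda>n. \<integral>\<omega>. complex_of_real (Z \<omega>) * exp (\<i> * complex_of_real (l * quad_fun H B n \<omega>)) \<partial>P)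
      \<longlonglongrightarrow> (\<integral>\<omega>'. complex_of_real (Z (p \<omega>')) * exp (\<i> * complex_of_real (l * G \<omega>')) \<partial>P')"
      using lim by (simp only:)
  qed
  obtain k where k: "\<And>n f K. 1 \<le> n \<Longrightarrow> f \<in> borel_measurable borel \<Longrightarrow> (\<forall>x. 0 \<le> f x \<and> f x \<le> 1) \<Longrightarrow> (\<forall>x y. \<bar>f x - f y\<bar> \<le> K * \<bar>x - y\<bar>) \<Longrightarrow>
    \<bar>expectation (\<lambda>\<omega>. f (quad_fun H B n \<omega>)) - limit_law f\<bar> \<le> k * real n powr (- (1 - H) / 15)"
    using quad_fun_tv_tests by blast
  have tv: "dTV P (quad_fun H B n) P' G \<le> k * real n powr (- (1 - H) / 15)" if n: "1 \<le> n" for n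
    unfolding dTV_def
  proof (rule cSUP_least)
    show "sets (borel :: real measure) \<noteq> {}" by auto
    fix A :: "real set" assume A: "A \<in> sets borel"
    have "\<bar>measure (distr P borel (quad_fun H B n)) A - measure (distr P' borel G) A\<bar> \<le> k * real n powr (- (1 - H) / 15)"
    proof (rule tv_bound_of_lipschitz_tests[OF _ _ _ A])
      show "real_distribution (distr P borel (quad_fun H B n))" by (rule real_distribution_distr[OF Am])
      show "real_distribution (distr P' borel G)" by (rule P'.real_distribution_distr[OF Gm])
      fix f :: "real \<Rightarrow> real" and K
      assume f: "\<And>x y. \<bar>f x - f y\<bar> \<le> K * \<bar>x - y\<bar>" "\<And>x. 0 \<le> f x" "\<And>x. f x \<le> 1" "f \<in> borel_measurable borel"
      have "(\<integral>x. f x \<partial>distr P borel (quad_fun H B n)) = expectation (\<lambda>\<omega>. f (quad_fun H B n \<omega>))"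
        by (rule integral_distr[OF Am f(4)])
      moreover have "(\<integral>x. f x \<partial>distr P' borel G) = limit_law f"
        unfolding integral_distr[OF Gm f(4)] G_def by (rule limit_law_extension[OF assms(6-8) f(4) f(2,3)])
      ultimately show "\<bar>(\<integral>x. f x \<partial>distr P borel (quad_fun H B n)) - (\<integral>x. f x \<partial>distr P' borel G)\<bar> \<le> k * real n powr (- (1 - H) / 15)"
        using k[OF n f(4), of K] f(1-3) by simp
    qed
    then show "\<bar>measure P (quad_fun H B n -` A \<inter> space P) - measure P' (G -` A \<inter> space P')\<bar> \<le> k * real n powr (- (1 - H) / 15)"
      using A by (simp add: measure_distr[OF Am] measure_distr[OF Gm])
  qed
  show ?thesis using stable tv unfolding G_def[abs_def] by blast
qed

end
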